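(* Let $\nu,\lambda>0$, $\tfrac12<\beta<\beta'<H<1$, $\sigma\in\ell^2$, $\delta>0$. Assume: (i) $f_i\in C^1(\mathbb R,\mathbb R)$ for $i\in\mathbb Z$, and there is $D_f\ge 0$ with $|f_i'(\zeta)|\le D_f$ for all $\zeta\in\mathbb R$, $i\in\mathbb Z$; moreover $f_i(0)=f_i'(0)=0$, $f_i\in C^2([-\delta,\delta],\mathbb R)$, and there is $M_f>0$ with $|f_i''(\zeta)|\le M_f$ for all $\zeta\in[-\delta,\delta]$, $i\in\mathbb Z$; (ii) $h_i\in C^2(\mathbb R,\mathbb R)$ for $i\in\mathbb Z$, there are $D_h,M_h\ge0$ with $|h_i'(\zeta)|\le D_h$, $|h_i''(\zeta)|\le M_h$ for all $\zeta\in\mathbb R$, $i\in\mathbb Z$, and $h_i(0)=h_i'(0)=0$ for $i\in\mathbb Z$. Let $\varphi(t,\omega,x)=u(t)$, $t\ge 0$, where for $\omega\in\Omega:=C_0^{\beta'}(\mathbb R;\ell^2)$ and $x\in\ell^2$, $u$ is the unique function that is in $C^\beta([0,T];\ell^2)$ for every $T>0$ and satisfies $$u(t)=S_\lambda(t)x+\int_0^tS_\lambda(t-r)f(u(r))\,dr+\int_0^tS_\lambda(t-r)h(u(r))\,d\omega(r),\qquad t\ge0.$$ Let $\hat\epsilon\in(0,1-e^{-\lambda})$. Then for every $\mu$ with $0<\mu<\lambda-\log(1+\hat\epsilon e^\lambda)$ the trivial solution $u\equiv 0$ is exponentially stable with rate $\mu$.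
   Context: $\ell^2$ is the Hilbert space of square summable real sequences $(u_i)_{i\in\mathbb Z}$ with its usual norm and inner product and standard orthonormal basis $(\mathbf e_i)_{i\in\mathbb Z}$; $L_2(\ell^2)$ is the space of Hilbert–Schmidt operators on $\ell^2$. $C^\beta([0,T];\ell^2)$ is the space of $\beta$-Hölder continuous functions. Exponential stability: the trivial solution is exponentially stable with rate $\mu>0$ if there are a random variable $\alpha(\omega)>0$ and a random neighborhood $U(\omega)\subset\ell^2$ of zero such that for $P_H$-almost every $\omega\in\Omega$ and all $t\ge0$ $$\sup_{x\in U(\omega)}\|\varphi(t,\omega,x)\|\le\alpha(\omega)e^{-\mu t}.$$ Operators: $(Au)_i=-\nu(u_{i-1}-2u_i+u_{i+1})$, $A_\lambda=A+\lambda\,\mathrm{id}$ (bounded on $\ell^2$), $S_\lambda(t)=e^{-A_\lambda t}$. For $u\in\ell^2$: $f(u)=(f_i(u_i))_{i\in\mathbb Z}$, and $h(u)$ is the operator $h(u)v=(h_i(u_i)v_i)_{i\in\mathbb Z}$; under the assumptions $f:\ell^2\to\ell^2$ and $h:\ell^2\to L_2(\ell^2)$. Noise: $C_0(\mathbb R;\ell^2)$ is the space of continuous functions $\mathbb R\to\ell^2$ vanishing at $0$, with the compact open topology; $P_H$ is the law on its Borel $\sigma$-algebra of $B^H(t)=\sum_{i}\sigma_iB_i^H(t)\mathbf e_i$, where $(B_i^H)_{i}$ are i.i.d. centered Gaussian processes on $\mathbb R$ with covariance $\frac12(|s|^{2H}+|t|^{2H}-|t-s|^{2H})$. $\Omega=C_0^{\beta'}(\mathbb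 R;\ell^2)$ is the subset of functions with finite $\beta'$-Hölder seminorm on every compact interval; it has $P_H$-measure one and is equipped with the trace $\sigma$-algebra. Integral: for $Z\in C^\beta([T_1,T_2];L_2(\ell^2))$, $\omega\in C^{\beta'}([T_1,T_2];\ell^2)$ with $\beta+\beta'>1$, $T_1\le s<t\le T_2$ and any $\alpha$ with $1-\beta'<\alpha<\beta$, $$\int_s^tZ\,d\omega:=(-1)^\alpha\sum_{j\in\mathbb Z}\Big(\sum_{i\in\mathbb Z}\int_s^tD^\alpha_{s+}\langle\mathbf e_j,Z(\cdot)\mathbf e_i\rangle[r]\;D^{1-\alpha}_{t-}\langle\mathbf e_i,\omega(\cdot)\rangle_{t-}[r]\,dr\Big)\mathbf e_j,$$ where for real functions $z,w$ and $s<r<t$ $$D^\alpha_{s+}z[r]=\frac1{\Gamma(1-\alpha)}\Big(\frac{z(r)}{(r-s)^\alpha}+\alpha\int_s^r\frac{z(r)-z(q)}{(r-q)^{1+\alpha}}dq\Big),$$ $$D^{1-\alpha}_{t-}w_{t-}[r]=\frac{(-1)^{1-\alpha}}{\Gamma(\alpha)}\Big(\frac{w(r)-w(t)}{(t-r)^{1-\alpha}}+(1-\alpha)\int_r^t\frac{w(r)-w(q)}{(q-r)^{2-\alpha}}dq\Big),$$ with the convention $(-1)^\alpha(-1)^{1-\alpha}=-1$. (This is the Young integral.) *)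

theory Defs
  imports "HOL-Probability.Probability"
begin

typedef ell2 = "{u :: int \<Rightarrow> real. (\<lambda>i. (u i)\<^sup>2) summable_on UNIV}"
  morphisms coord Ell2
  by (rule exI[of _ "\<lambda>_. 0"]) simp

setup_lifting type_definition_ell2

lemma coord_sq_summable: "(\<lambda>i. (coord u i)\<^sup>2) summable_on UNIV"
  using coord[of u] by simp

lemma square_summable_add:
  fixes u v :: "int \<Rightarrow> real"
  assumes "(\<lambda>i. (u i)\<^sup>2) summable_on UNIV" "(\<lambda>i. (v i)\<^sup>2) summable_on UNIV"
  shows "(\<lambda>i. (u i + v i)\<^sup>2) summable_on UNIV"
proof (rule summable_on_comparison_test)
  show "(\<lambda>i. 2 * ((u i)\<^sup>2 + (v i)\<^sup>2)) summable_on UNIV"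
    by (intro summable_on_cmult_right summable_on_add assms)
  show "(u i + v i)\<^sup>2 \<le> 2 * ((u i)\<^sup>2 + (v i)\<^sup>2)" for i
    using sum_squares_bound[of "u i" "v i"] by (simp add: power2_sum algebra_simps)
qed simp

lemma square_summable_scale:
  fixes u :: "int \<Rightarrow> real"
  assumes "(\<lambda>i. (u i)\<^sup>2) summable_on UNIV"
  shows "(\<lambda>i. (c * u i)\<^sup>2) summable_on UNIV"
  using summable_on_cmult_right[OF assms, of "c\<^sup>2"] by (simp add: power_mult_distrib)

lemma square_summable_shift:
  fixes u :: "int \<Rightarrow> real"
  assumes "(\<lambda>i. (u i)\<^sup>2) summable_on UNIV"
  shows "(\<lambda>i. (u (i + k))\<^sup>2) summable_on UNIV"
proof -
  have "bij_betw (\<lambda>i. i + k) UNIV UNIV"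
    by (rule bij_betwI[of _ _ _ "\<lambda>i. i - k"]) auto
  from summable_on_reindex_bij_betw[OF this, of "\<lambda>i. (u i)\<^sup>2"] assms show ?thesis by simp
qed

lemma square_summable_product:
  fixes u v :: "int \<Rightarrow> real"
  assumes "(\<lambda>i. (u i)\<^sup>2) summable_on UNIV" "(\<lambda>i. (v i)\<^sup>2) summable_on UNIV"
  shows "(\<lambda>i. u i * v i) summable_on UNIV"
proof -
  have "(\<lambda>i. \<bar>u i * v i\<bar>) summable_on UNIV"
  proof (rule summable_on_comparison_test)
    show "(\<lambda>i. (u i)\<^sup>2 + (v i)\<^sup>2) summable_on UNIV"
      by (intro summable_on_add assms)
    show "\<bar>u i * v i\<bar> \<le> (u i)\<^sup>2 + (v i)\<^sup>2" for i
      using sum_squares_bound[of "u i" "v i"] sum_squares_bound[of "u i" "- v i"]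
        zero_le_power2[of "u i"] zero_le_power2[of "v i"] unfolding abs_le_iff
      by simp
  qed simp
  then have "(\<lambda>i. norm (u i * v i)) summable_on UNIV" by simp
  then show ?thesis by (rule abs_summable_summable)
qed

instantiation ell2 :: real_vector
begin

lift_definition zero_ell2 :: ell2 is "\<lambda>_. 0" by simp

lift_definition plus_ell2 :: "ell2 \<Rightarrow> ell2 \<Rightarrow> ell2" is "\<lambda>u v i. u i + v i"
  by (rule square_summable_add)

lift_definition uminus_ell2 :: "ell2 \<Rightarrow> ell2" is "\<lambda>u i. - u i" by simp

lift_definition minus_ell2 :: "ell2 \<Rightarrow> ell2 \<Rightarrow> ell2" is "\<lambda>u v i. u i - v i"
  subgoal for u v using square_summable_add[of u "\<lambda>i. - v i"] by simp
  done

lift_definition scaleR_ell2 :: "real \<Rightarrow> ell2 \<Rightarrow> ell2" is "\<lambda>c u i. c * u i"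
  by (rule square_summable_scale)

instance
  by (standard; transfer) (auto simp: algebra_simps)

end

instantiation ell2 :: real_inner
begin

definition inner_ell2 :: "ell2 \<Rightarrow> ell2 \<Rightarrow> real" where
  "inner_ell2 u v = (\<Sum>\<^sub>\<infinity>i. coord u i * coord v i)"

definition norm_ell2 :: "ell2 \<Rightarrow> real" where
  "norm_ell2 u = sqrt (inner u u)"

definition sgn_ell2 :: "ell2 \<Rightarrow> ell2" where
  "sgn_ell2 u = u /\<^sub>R norm u"

definition dist_ell2 :: "ell2 \<Rightarrow> ell2 \<Rightarrow> real" where
  "dist_ell2 u v = norm (u - v)"

definition uniformity_ell2 :: "(ell2 \<times> ell2) filter" where
  "uniformity_ell2 = (INF e\<in>{0<..}. principal {(u, v). dist u v < e})"

definition open_ell2 :: "ell2 set \<Rightarrow> bool" where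
  "open_ell2 U \<longleftrightarrow> (\<forall>u\<in>U. eventually (\<lambda>(u', v). u' = u \<longrightarrow> v \<in> U) uniformity)"

instance
proof
  fix u v w :: ell2 and c :: real and U :: "ell2 set"
  have prod: "(\<lambda>i. coord x i * coord y i) summable_on UNIV" for x y
    by (intro square_summable_product coord_sq_summable)
  show "dist u v = norm (u - v)" by (rule dist_ell2_def)
  show "sgn u = u /\<^sub>R norm u" by (rule sgn_ell2_def)
  show "(uniformity :: (ell2 \<times> ell2) filter) = (INF e\<in>{0<..}. principal {(u, v). dist u v < e})"
    by (rule uniformity_ell2_def)
  show "open U \<longleftrightarrow> (\<forall>u\<in>U. \<forall>\<^sub>F (u', v) in uniformity. u' = u \<longrightarrow> v \<in> U)"
    by (rule open_ell2_def)
  show "inner u v = inner v u" by (simp add: inner_ell2_def mult.commute)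
  show "inner (u + v) w = inner u w + inner v w"
    unfolding inner_ell2_def plus_ell2.rep_eq distrib_right by (rule infsum_add[OF prod prod])
  show "inner (c *\<^sub>R u) v = c * inner u v"
    unfolding inner_ell2_def scaleR_ell2.rep_eq mult.assoc by (rule infsum_cmult_right')
  show "0 \<le> inner u u" unfolding inner_ell2_def by (rule infsum_nonneg) simp
  show "inner u u = 0 \<longleftrightarrow> u = 0"
  proof
    assume "inner u u = 0"
    then have "coord u i * coord u i = 0" for i
      using nonneg_infsum_le_0D[OF _ prod[of u u], of i] by (simp add: inner_ell2_def)
    then show "u = 0" by (intro coord_inject[THEN iffD1] ext) (simp add: zero_ell2.rep_eq)
  qed (simp add: inner_ell2_def zero_ell2.rep_eq)
  show "norm u = sqrt (inner u u)" by (rule norm_ell2_def)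
qed

end

lemma norm_ell2_sq: "(norm u)\<^sup>2 = (\<Sum>\<^sub>\<infinity>i. (coord u i)\<^sup>2)"
  unfolding power2_norm_eq_inner inner_ell2_def by (simp add: power2_eq_square)

lemma sum_coord_sq_le_norm: "finite F \<Longrightarrow> (\<Sum>i\<in>F. (coord u i)\<^sup>2) \<le> (norm u)\<^sup>2"
  unfolding norm_ell2_sq by (rule finite_sum_le_infsum[OF coord_sq_summable]) auto

lemma abs_coord_le_norm: "\<bar>coord u i\<bar> \<le> norm u"
  using sum_coord_sq_le_norm[of "{i}" u] by (simp add: abs_le_square_iff[symmetric])

instance ell2 :: banach
proof
  fix X :: "nat \<Rightarrow> ell2"
  assume X: "Cauchy X"
  have "Cauchy (\<lambda>n. coord (X n) i)" for i
  proof (rule metric_CauchyI)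
    fix e :: real assume "e > 0"
    then obtain N where N: "\<And>m n. m \<ge> N \<Longrightarrow> n \<ge> N \<Longrightarrow> dist (X m) (X n) < e"
      using metric_CauchyD[OF X] by blast
    have "dist (coord (X m) i) (coord (X n) i) < e" if "m \<ge> N" "n \<ge> N" for m n
      using abs_coord_le_norm[of "X m - X n" i] N[OF that]
      by (simp add: dist_norm minus_ell2.rep_eq)
    then show "\<exists>N. \<forall>m\<ge>N. \<forall>n\<ge>N. dist (coord (X m) i) (coord (X n) i) < e" by blast
  qed
  then have "\<exists>g. \<forall>i. (\<lambda>n. coord (X n) i) \<longlonglongrightarrow> g i"
    by (intro choice) (simp add: Cauchy_convergent_iff convergent_def)
  then obtain g where g: "\<And>i. (\<lambda>n. coord (X n) i) \<longlonglongrightarrow> g i" by blast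
  have bound: "(\<Sum>i\<in>F. (coord (X m) i - g i)\<^sup>2) \<le> e\<^sup>2"
    if "finite F" and close: "\<And>n. n \<ge> N \<Longrightarrow> dist (X m) (X n) < e" for F m N e
  proof (rule tendsto_upperbound)
    show "(\<lambda>n. \<Sum>i\<in>F. (coord (X m) i - coord (X n) i)\<^sup>2) \<longlonglongrightarrow> (\<Sum>i\<in>F. (coord (X m) i - g i)\<^sup>2)"
      by (intro tendsto_intros g)
    have "(\<Sum>i\<in>F. (coord (X m) i - coord (X n) i)\<^sup>2) \<le> e\<^sup>2" if n: "n \<ge> N" for n
    proof -
      have "(\<Sum>i\<in>F. (coord (X m) i - coord (X n) i)\<^sup>2) \<le> (norm (X m - X n))\<^sup>2"
        using sum_coord_sq_le_norm[OF \<open>finite F\<close>, of "X m - X n"] by (simp add: minus_ell2.rep_eq)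
      also have "\<dots> \<le> e\<^sup>2"
        using close[OF n] by (intro power_mono) (auto simp: dist_norm)
      finally show ?thesis .
    qed
    then show "\<forall>\<^sub>F n in sequentially. (\<Sum>i\<in>F. (coord (X m) i - coord (X n) i)\<^sup>2) \<le> e\<^sup>2"
      by (auto simp: eventually_sequentially)
  qed simp
  have summ: "(\<lambda>i. (coord (X m) i - g i)\<^sup>2) summable_on UNIV"
    if "\<And>n. n \<ge> N \<Longrightarrow> dist (X m) (X n) < e" for m N e
    by (rule nonneg_bdd_above_summable_on)
       (auto intro!: bdd_aboveI2[where M = "e\<^sup>2"] bound[OF _ that])
  have g2: "(\<lambda>i. (g i)\<^sup>2) summable_on UNIV"
  proof -
    obtain N where N: "\<And>m n. m \<ge> N \<Longrightarrow> n \<ge> N \<Longrightarrow> dist (X m) (X n) < 1"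
      using metric_CauchyD[OF X, of 1] by auto
    have "(\<lambda>i. (coord (X N) i - g i)\<^sup>2) summable_on UNIV" by (rule summ[OF N]) auto
    then have "(\<lambda>i. (g i - coord (X N) i)\<^sup>2) summable_on UNIV"
      by (simp add: power2_commute)
    from square_summable_add[OF this coord_sq_summable[of "X N"]] show ?thesis by simp
  qed
  have coord_L: "coord (Ell2 g) = g" by (rule Ell2_inverse) (simp add: g2)
  have "X \<longlonglongrightarrow> Ell2 g"
  proof (rule metric_LIMSEQ_I)
    fix e :: real assume e: "e > 0"
    then obtain N where N: "\<And>m n. m \<ge> N \<Longrightarrow> n \<ge> N \<Longrightarrow> dist (X m) (X n) < e / 2"
      using metric_CauchyD[OF X, of "e / 2"] by auto
    have "dist (X m) (Ell2 g) < e" if m: "m \<ge> N" for m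
    proof -
      have "(norm (X m - Ell2 g))\<^sup>2 = (\<Sum>\<^sub>\<infinity>i. (coord (X m) i - g i)\<^sup>2)"
        by (simp add: norm_ell2_sq minus_ell2.rep_eq coord_L)
      also have "\<dots> \<le> (e / 2)\<^sup>2"
        by (rule infsum_le_finite_sums[OF summ[OF N[OF m]] bound[OF _ N[OF m]]])
      finally have "norm (X m - Ell2 g) \<le> e / 2" by (rule power2_le_imp_le) (use e in simp)
      then show ?thesis using e by (simp add: dist_norm)
    qed
    then show "\<exists>N. \<forall>m\<ge>N. dist (X m) (Ell2 g) < e" by blast
  qed
  then show "convergent X" by (rule convergentI)
qed

lift_definition ebasis :: "int \<Rightarrow> ell2" is "\<lambda>j i. if i = j then 1 else 0"
  subgoal for j
    by (rule finite_nonzero_values_imp_summable_on, rule finite_subset[of _ "{j}"]) auto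
  done

lift_definition lattice_Laplace :: "real \<Rightarrow> ell2 \<Rightarrow> ell2" is
  "\<lambda>\<nu> u i. - \<nu> * (u (i - 1) - 2 * u i + u (i + 1))"
  subgoal premises u for \<nu> u
  proof -
    have "(\<lambda>i. (u (i - 1) + (-2) * u i + u (i + 1))\<^sup>2) summable_on UNIV"
      using u square_summable_shift[OF u, of "-1"]
      by (intro square_summable_add square_summable_scale square_summable_shift) simp_all
    from square_summable_scale[OF this, of "- \<nu>"] show ?thesis by simp
  qed
  done

definition A_op :: "real \<Rightarrow> real \<Rightarrow> ell2 \<Rightarrow> ell2" where
  "A_op \<nu> lam u = lattice_Laplace \<nu> u + lam *\<^sub>R u"

text \<open>The operator exponential of a bounded operator, written as a power series applied to a vector.\<close>

definition S_op :: "real \<Rightarrow> real \<Rightarrow> real \<Rightarrow> ell2 \<Rightarrow> ell2" where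
  "S_op \<nu> lam t x = (\<Sum>n. ((- t) ^ n / fact n) *\<^sub>R (A_op \<nu> lam ^^ n) x)"

text \<open>\<^const>\<open>Ell2\<close> is only meaningful on square summable sequences; in the following two
  definitions the argument is one whenever the \<open>f\<^sub>i\<close>, \<open>h\<^sub>i\<close> are uniformly Lipschitz and vanish at 0.\<close>

definition f_op :: "(int \<Rightarrow> real \<Rightarrow> real) \<Rightarrow> ell2 \<Rightarrow> ell2" where
  "f_op f u = Ell2 (\<lambda>i. f i (coord u i))"

definition h_op :: "(int \<Rightarrow> real \<Rightarrow> real) \<Rightarrow> ell2 \<Rightarrow> ell2 \<Rightarrow> ell2" where
  "h_op h u v = Ell2 (\<lambda>i. h i (coord u i) * coord v i)"

definition Hoelder_on :: "real \<Rightarrow> real set \<Rightarrow> (real \<Rightarrow> 'a::metric_space) \<Rightarrow> bool" where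
  "Hoelder_on \<gamma> I u \<longleftrightarrow> (\<exists>C. \<forall>s\<in>I. \<forall>t\<in>I. dist (u s) (u t) \<le> C * \<bar>s - t\<bar> powr \<gamma>)"

definition C0 :: "(real \<Rightarrow> ell2) set" where
  "C0 = {\<omega>. continuous_on UNIV \<omega> \<and> \<omega> 0 = 0}"

definition compact_open_C0 :: "(real \<Rightarrow> ell2) topology" where
  "compact_open_C0 = topology_generated_by {{\<omega>\<in>C0. \<omega> ` K \<subseteq> V} | K V. compact K \<and> open V}"

definition borel_C0 :: "(real \<Rightarrow> ell2) measure" where
  "borel_C0 = sigma C0 {G. openin compact_open_C0 G}"

definition C0_Hoelder :: "real \<Rightarrow> (real \<Rightarrow> ell2) set" where
  "C0_Hoelder \<gamma> = {\<omega>\<in>C0. \<forall>a b. Hoelder_on \<gamma> {a..b} \<omega>}"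

text \<open>The first disjunct is the degenerate case of variance 0.\<close>

definition centered_gaussian :: "'a measure \<Rightarrow> ('a \<Rightarrow> real) \<Rightarrow> bool" where
  "centered_gaussian M X \<longleftrightarrow> X \<in> borel_measurable M \<and>
     ((AE w in M. X w = 0) \<or> (\<exists>s>0. distributed M lborel X (normal_density 0 s)))"

definition centered_gaussian_process :: "'a measure \<Rightarrow> (real \<Rightarrow> 'a \<Rightarrow> real) \<Rightarrow> bool" where
  "centered_gaussian_process M b \<longleftrightarrow>
     (\<forall>J c. finite J \<longrightarrow> centered_gaussian M (\<lambda>w. \<Sum>t\<in>J. c t * b t w))"

definition fBm :: "'a measure \<Rightarrow> real \<Rightarrow> (real \<Rightarrow> 'a \<Rightarrow> real) \<Rightarrow> bool" where
  "fBm M H b \<longleftrightarrow> centered_gaussian_process M b \<and>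
     (\<forall>s t. integral\<^sup>L M (\<lambda>w. b s w * b t w) =
        (\<bar>s\<bar> powr (2 * H) + \<bar>t\<bar> powr (2 * H) - \<bar>t - s\<bar> powr (2 * H)) / 2)"

text \<open>\<open>B\<close> has paths in \<^const>\<open>C0\<close> and is a version of
  \<open>\<Sum>\<^sub>i \<sigma>\<^sub>i B\<^sub>i\<^sup>H e\<^sub>i\<close>; the \<open>B\<^sub>i\<^sup>H\<close> are identically distributed because a centered
  Gaussian process is determined in law by its covariance.\<close>

definition ell2_fBm :: "'a measure \<Rightarrow> real \<Rightarrow> ell2 \<Rightarrow> ('a \<Rightarrow> real \<Rightarrow> ell2) \<Rightarrow> bool" where
  "ell2_fBm M H \<sigma> B \<longleftrightarrow> prob_space M \<and> B \<in> M \<rightarrow>\<^sub>M borel_C0 \<and>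
     (\<exists>b :: int \<Rightarrow> real \<Rightarrow> 'a \<Rightarrow> real.
        (\<forall>i. fBm M H (b i)) \<and>
        prob_space.indep_vars M (\<lambda>_. PiM UNIV (\<lambda>_. borel)) (\<lambda>i w t. b i t w) UNIV \<and>
        (\<forall>t. AE w in M. ((\<lambda>i. (coord \<sigma> i * b i t w) *\<^sub>R ebasis i) has_sum B w t) UNIV))"

definition frac_deriv_left :: "real \<Rightarrow> real \<Rightarrow> (real \<Rightarrow> real) \<Rightarrow> real \<Rightarrow> real" where
  "frac_deriv_left \<alpha> s z r = 1 / Gamma (1 - \<alpha>) *
     (z r / (r - s) powr \<alpha> + \<alpha> * (LBINT q:{s..r}. (z r - z q) / (r - q) powr (1 + \<alpha>)))"

text \<open>The right-sided derivative of order \<open>1 - \<alpha>\<close> of \<open>w - w(t)\<close>, without the factor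
  \<open>(-1)\<^sup>1\<^sup>-\<^sup>\<alpha>\<close>: only the product \<open>(-1)\<^sup>\<alpha> (-1)\<^sup>1\<^sup>-\<^sup>\<alpha> = -1\<close> enters the integral, as its leading sign.\<close>

definition frac_deriv_right :: "real \<Rightarrow> real \<Rightarrow> (real \<Rightarrow> real) \<Rightarrow> real \<Rightarrow> real" where
  "frac_deriv_right \<alpha> t w r = 1 / Gamma \<alpha> *
     ((w r - w t) / (t - r) powr (1 - \<alpha>)
      + (1 - \<alpha>) * (LBINT q:{r..t}. (w r - w q) / (q - r) powr (2 - \<alpha>)))"

text \<open>For \<open>Z\<close> Hoelder of order \<open>\<beta>\<close> into the Hilbert-Schmidt operators and \<open>\<omega>\<close> Hoelder of order
  \<open>\<beta>'\<close>, both series converge unconditionally and the value is the same for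
  all \<open>\<alpha>\<close> with \<open>1 - \<beta>' < \<alpha> < \<beta>\<close>; the parameter \<open>\<alpha>\<close> is therefore only a choice of representation.\<close>

definition young_integral ::
  "real \<Rightarrow> (real \<Rightarrow> ell2 \<Rightarrow> ell2) \<Rightarrow> (real \<Rightarrow> ell2) \<Rightarrow> real \<Rightarrow> real \<Rightarrow> ell2" where
  "young_integral \<alpha> Z \<omega> s t = (\<Sum>\<^sub>\<infinity>j.
     (- (\<Sum>\<^sub>\<infinity>i. LBINT r:{s..t}.
           frac_deriv_left \<alpha> s (\<lambda>q. ebasis j \<bullet> Z q (ebasis i)) r *
           frac_deriv_right \<alpha> t (\<lambda>q. ebasis i \<bullet> \<omega> q) r)) *\<^sub>R ebasis j)"

text \<open>The values of \<open>u\<close> at negative times are irrelevant. The drift integrand is continuous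
  under the standing assumptions, so the Henstock-Kurzweil integral is the Bochner integral.\<close>

definition mild_solution ::
  "real \<Rightarrow> real \<Rightarrow> real \<Rightarrow> real \<Rightarrow> (int \<Rightarrow> real \<Rightarrow> real) \<Rightarrow> (int \<Rightarrow> real \<Rightarrow> real) \<Rightarrow>
   (real \<Rightarrow> ell2) \<Rightarrow> ell2 \<Rightarrow> (real \<Rightarrow> ell2) \<Rightarrow> bool" where
  "mild_solution \<alpha> \<beta> \<nu> lam f h \<omega> x u \<longleftrightarrow>
     (\<forall>T>0. Hoelder_on \<beta> {0..T} u) \<and>
     (\<forall>t\<ge>0. u t = S_op \<nu> lam t x
        + integral {0..t} (\<lambda>r. S_op \<nu> lam (t - r) (f_op f (u r)))
        + young_integral \<alpha> (\<lambda>r v. S_op \<nu> lam (t - r) (h_op h (u r) v)) \<omega> 0 t)"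

text \<open>A random set is, as usual for random dynamical systems, a set-valued map all of whose
  distance functions are measurable.\<close>

definition random_neighborhood :: "'w measure \<Rightarrow> ('w \<Rightarrow> 'b::metric_space set) \<Rightarrow> 'b \<Rightarrow> bool" where
  "random_neighborhood P U x0 \<longleftrightarrow> (\<forall>\<omega>\<in>space P. x0 \<in> interior (U \<omega>)) \<and>
     (\<forall>x. (\<lambda>\<omega>. infdist x (U \<omega>)) \<in> borel_measurable P)"

definition exponentially_stable ::
  "'w measure \<Rightarrow> (real \<Rightarrow> 'w \<Rightarrow> 'b::real_normed_vector \<Rightarrow> 'b) \<Rightarrow> real \<Rightarrow> bool" where
  "exponentially_stable P \<phi> \<mu> \<longleftrightarrow> \<mu> > 0 \<and>
     (\<exists>a U. a \<in> borel_measurable P \<and> (\<forall>\<omega>\<in>space P. a \<omega> > 0) \<and> random_neighborhood P U 0 \<and>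
        (AE \<omega> in P. \<forall>t\<ge>0.
           (SUP x\<in>U \<omega>. ereal (norm (\<phi> t \<omega> x))) \<le> ereal (a \<omega> * exp (- \<mu> * t))))"

end

theory Submission
  imports Defs
begin

text \<open>Since \<open>f\<close> and \<open>h\<close> vanish to second order at 0, along a solution of size
  \<open>R * exp (- \<mu> * t)\<close> the drift and the diffusion coefficient are of size \<open>R\<^sup>2 * exp (- \<gamma> * t)\<close>
  with \<open>\<gamma> = min lam (2 * \<mu>) > \<mu>\<close>. Writing the Young integral by fractional derivatives
  over the whole interval \<open>{0..t}\<close>, one loses only a power of \<open>t\<close> and the Hoelder seminorm of the path
  on \<open>{0..t}\<close>. Almost surely that seminorm grows slower than any exponential: the increments of the
  Gaussian process have moments of all orders, and a dyadic chaining argument applies. Hence a solution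
  with small initial value cannot leave the regime of size \<open>R * exp (- \<mu> * t)\<close>, where \<open>R\<close> depends on
  the path only through its growth constant. Instead of the additivity of the Young integral, the
  increments of the solution in time are estimated from the change of the right-sided fractional
  derivative with the endpoint.\<close>

section \<open>The lattice semigroup\<close>

text \<open>The stochastic integrand \<open>S (t - r) (h (u r))\<close> depends on the endpoint
  \<open>t\<close>, so the integrals up to \<open>s \<le> t\<close> differ in three ways: a new
  piece \<open>{s..t}\<close>, another right-sided derivative on \<open>{0..s}\<close>, another
  integrand on \<open>{0..s}\<close>. Each contributes a power of \<open>t - s\<close>; this is the
  source of the Hoelder control of the solution. Hilbert-Schmidt bounds are obtained by testing
  finite blocks of matrix entries against coefficients: each test is a scalar function, so scalar
  estimates carry over with constants independent of the block. Smallness closes because the a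
  priori bound is linear, \<open>C * (norm x + a * \<kappa>)\<close>, with \<open>a\<close> of order
  \<open>R\<^sup>2\<close>: for \<open>R = \<rho> / \<kappa>\<close> the second term is a fraction
  of \<open>R\<close>. Thus the growth constant \<open>\<kappa>\<close> only shrinks the
  neighborhood, and the prefactor of \<open>exp (- \<mu> * t)\<close> can be 1. The continuity
  argument has to get beyond the time reached so far; the exponent \<open>b\<close> of the path
  exceeds the exponent \<open>\<beta>\<close> of the solution, and this gain makes short increments
  small in the \<open>\<beta>\<close>-seminorm.\<close>

lift_definition shift_ell2 :: "int \<Rightarrow> ell2 \<Rightarrow> ell2" is "\<lambda>k u i. u (i + k)"
  by (rule square_summable_shift)

lemma norm_shift_ell2: "norm (shift_ell2 k u) = norm u"
proof -
  have "bij_betw (\<lambda>i. i + k) UNIV UNIV"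
    by (rule bij_betwI[of _ _ _ "\<lambda>i. i - k"]) auto
  from infsum_reindex_bij_betw[OF this, of "\<lambda>i. (coord u i)\<^sup>2"]
  have "(norm (shift_ell2 k u))\<^sup>2 = (norm u)\<^sup>2"
    by (simp add: norm_ell2_sq shift_ell2.rep_eq)
  then show ?thesis by simp
qed

lemma ell2_eqI: "(\<And>i. coord u i = coord v i) \<Longrightarrow> u = v"
  by (metis coord_inject ext)

lemma coord_simps [simp]:
  "coord (u + v) i = coord u i + coord v i" "coord (u - v) i = coord u i - coord v i"
  "coord (- u) i = - coord u i" "coord (c *\<^sub>R u) i = c * coord u i" "coord 0 i = 0"
  by (simp_all add: plus_ell2.rep_eq minus_ell2.rep_eq uminus_ell2.rep_eq scaleR_ell2.rep_eq
      zero_ell2.rep_eq)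

text \<open>The shifts are isometries, so this form yields the operator bound
  \<open>4 * \<nu> + lam\<close> by the triangle inequality and coercivity by
  Cauchy-Schwarz.\<close>

lemma A_op_shift:
  "A_op \<nu> lam u = (2 * \<nu> + lam) *\<^sub>R u - \<nu> *\<^sub>R (shift_ell2 (-1) u + shift_ell2 1 u)"
  by (rule ell2_eqI) (simp add: A_op_def lattice_Laplace.rep_eq shift_ell2.rep_eq algebra_simps)

lemma linear_A_op: "linear (A_op \<nu> lam)"
  by (rule linearI; rule ell2_eqI)
     (simp_all add: A_op_shift shift_ell2.rep_eq algebra_simps)

lemma norm_A_op_le:
  assumes "\<nu> \<ge> 0" "lam \<ge> 0"
  shows "norm (A_op \<nu> lam u) \<le> (4 * \<nu> + lam) * norm u"
proof -
  have "norm (A_op \<nu> lam u) \<le> (2 * \<nu> + lam) * norm u + \<nu> * (norm u + norm u)"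
    unfolding A_op_shift using assms
    by (intro norm_triangle_le_diff add_mono)
       (auto intro!: mult_left_mono norm_triangle_le simp: norm_shift_ell2)
  then show ?thesis by (simp add: algebra_simps)
qed

text \<open>Each shift term is at most \<open>(norm u)\<^sup>2\<close> by Cauchy-Schwarz, so the
  \<open>2 * \<nu>\<close> on the diagonal absorbs both and \<open>lam\<close> is left as the decay
  rate.\<close>

lemma A_op_coercive:
  assumes "\<nu> \<ge> 0"
  shows "lam * (norm u)\<^sup>2 \<le> inner (A_op \<nu> lam u) u"
proof -
  have "inner (shift_ell2 k u) u \<le> (norm u)\<^sup>2" for k
    using norm_cauchy_schwarz[of "shift_ell2 k u" u]
    by (simp add: norm_shift_ell2 power2_eq_square)
  from mult_left_mono[OF add_mono[OF this this] assms, of "-1" 1]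
  show ?thesis
    by (simp add: A_op_shift inner_diff_left inner_add_left power2_norm_eq_inner algebra_simps)
qed

lemma norm_A_op_pow_le:
  assumes "\<nu> \<ge> 0" "lam \<ge> 0"
  shows "norm ((A_op \<nu> lam ^^ n) u) \<le> (4 * \<nu> + lam) ^ n * norm u"
proof (induction n)
  case (Suc n)
  have "norm ((A_op \<nu> lam ^^ Suc n) u) \<le> (4 * \<nu> + lam) * norm ((A_op \<nu> lam ^^ n) u)"
    using norm_A_op_le[OF assms] by simp
  also have "\<dots> \<le> (4 * \<nu> + lam) * ((4 * \<nu> + lam) ^ n * norm u)"
    using assms by (intro mult_left_mono Suc) auto
  finally show ?case by simp
qed simp

lemma bounded_linear_A_op:
  assumes "\<nu> \<ge> 0" "lam \<ge> 0"
  shows "bounded_linear (A_op \<nu> lam)"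
  using linear_A_op norm_A_op_le[OF assms]
  by (auto intro!: bounded_linear_intro[of _ "4 * \<nu> + lam"] simp: linear_add linear_scale mult.commute)

lemma summable_S_op:
  assumes "\<nu> \<ge> 0" "lam \<ge> 0"
  shows "summable (\<lambda>n. ((- t) ^ n / fact n) *\<^sub>R (A_op \<nu> lam ^^ n) x)"
proof (rule summable_norm_cancel, rule summable_comparison_test)
  let ?L = "4 * \<nu> + lam"
  show "summable (\<lambda>n. norm x * ((\<bar>t\<bar> * ?L) ^ n /\<^sub>R fact n))"
    by (intro summable_mult summable_exp_generic)
  have "norm (((- t) ^ n / fact n) *\<^sub>R (A_op \<nu> lam ^^ n) x)
      \<le> norm x * ((\<bar>t\<bar> * ?L) ^ n /\<^sub>R fact n)" for n
    using mult_left_mono[OF norm_A_op_pow_le[OF assms, of n x], of "\<bar>t\<bar> ^ n / fact n"]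
    by (simp add: power_mult_distrib power_abs divide_simps mult_ac)
  then show "\<exists>N. \<forall>n\<ge>N. norm (norm (((- t) ^ n / fact n) *\<^sub>R (A_op \<nu> lam ^^ n) x))
      \<le> norm x * ((\<bar>t\<bar> * ?L) ^ n /\<^sub>R fact n)" by simp
qed

lemma S_op_has_vector_derivative:
  assumes "\<nu> \<ge> 0" "lam \<ge> 0"
  shows "((\<lambda>t. S_op \<nu> lam t x) has_vector_derivative - A_op \<nu> lam (S_op \<nu> lam t x)) (at t)"
proof -
  let ?L = "4 * \<nu> + lam" and ?A = "A_op \<nu> lam"
  define a where "a n = (?A ^^ n) x" for n
  \<comment> \<open>Term-by-term differentiation needs uniform convergence on a convex neighborhood
    of \<open>t\<close>; a ball about 0 of this radius contains \<open>t\<close> and lets the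
    majorant be an exponential series in \<open>r\<close>.\<close>
  define r where "r = \<bar>t\<bar> + 1"
  define f where "f n t = ((- t) ^ n / fact n) *\<^sub>R a n" for n t
  \<comment> \<open>The derivative of summand \<open>n\<close>, hence the index shift: the constant
    summand gives 0, and summand \<open>Suc k\<close> gives minus \<open>A_op\<close> applied to
    summand \<open>k\<close>.\<close>
  define d where "d n t = (case n of 0 \<Rightarrow> 0 | Suc k \<Rightarrow> - (((- t) ^ k / fact k) *\<^sub>R a (Suc k)))"
    for n :: nat and t :: real
  define g where "g t = - ?A (S_op \<nu> lam t x)" for t
  have fder: "(f n has_derivative (\<lambda>h. h *\<^sub>R d n t)) (at t within ball 0 r)" for n t
  proof (cases n)
    case 0
    have "f 0 = (\<lambda>_. a 0)" by (simp add: f_def fun_eq_iff)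
    with 0 show ?thesis by (simp add: d_def)
  next
    case (Suc k)
    have ne: "1 + real k \<noteq> 0" by (simp add: add_nonneg_eq_0_iff)
    have "((\<lambda>t. - t) has_real_derivative - 1) (at t within ball 0 r)"
      by (auto intro!: derivative_eq_intros)
    from DERIV_cdivide[OF DERIV_power_Suc[OF this, of k], of "fact (Suc k)"]
    have "((\<lambda>t. (- t) ^ Suc k / fact (Suc k)) has_real_derivative
        - ((- t) ^ k / fact k)) (at t within ball 0 r)"
      by (rule DERIV_cong) (use ne in simp)
    from has_derivative_scaleR_left[OF this[unfolded has_field_derivative_def], of "a (Suc k)"]
    show ?thesis unfolding f_def d_def Suc by (simp add: mult.commute)
  qed
  have dsum: "(\<lambda>n. d n t) sums g t" for t
  proof -
    have "(\<lambda>n. ((- t) ^ n / fact n) *\<^sub>R a n) sums S_op \<nu> lam t x"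
      unfolding S_op_def a_def by (rule summable_sums[OF summable_S_op[OF assms]])
    from sums_minus[OF bounded_linear.sums[OF bounded_linear_A_op[OF assms] this]]
    have "(\<lambda>n. d (Suc n) t) sums g t"
      by (simp add: d_def g_def a_def linear_scale[OF linear_A_op])
    then have "(\<lambda>n. d n t) sums (g t + d 0 t)" by (rule sums_Suc)
    then show ?thesis by (simp add: d_def)
  qed
  have unif: "uniform_limit (ball 0 r) (\<lambda>n t. \<Sum>i<n. d i t) (\<lambda>t. suminf (\<lambda>n. d n t)) sequentially"
  proof (rule Weierstrass_m_test)
    have "summable (\<lambda>n. (?L * norm x) * ((r * ?L) ^ n /\<^sub>R fact n))"
      by (intro summable_mult summable_exp_generic)
    then show "summable (\<lambda>n. case n of 0 \<Rightarrow> 0 | Suc k \<Rightarrow> (?L * norm x) * ((r * ?L) ^ k /\<^sub>R fact k))"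
      by (subst summable_Suc_iff[symmetric]) simp
    fix n and t :: real assume t: "t \<in> ball 0 r"
    show "norm (d n t) \<le> (case n of 0 \<Rightarrow> 0 | Suc k \<Rightarrow> (?L * norm x) * ((r * ?L) ^ k /\<^sub>R fact k))"
    proof (cases n)
      case (Suc k)
      have "norm (d n t) = \<bar>t\<bar> ^ k / fact k * norm (a (Suc k))"
        by (simp add: Suc d_def power_abs)
      also have "\<dots> \<le> r ^ k / fact k * (?L ^ Suc k * norm x)"
        unfolding a_def using t assms
        by (intro mult_mono divide_right_mono power_mono norm_A_op_pow_le) (auto simp: r_def)
      finally show ?thesis by (simp add: Suc power_mult_distrib divide_simps mult_ac)
    qed (simp add: d_def)
  qed
  have "\<exists>G. \<forall>t\<in>ball 0 r. (\<lambda>n. f n t) sums (G t) \<and>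
      (G has_derivative (\<lambda>h. h *\<^sub>R g t)) (at t within ball 0 r)"
  proof (rule has_derivative_series[where x = 0])
    fix e :: real assume "e > 0"
    with unif have "\<forall>\<^sub>F n in sequentially. \<forall>t\<in>ball 0 r. dist (\<Sum>i<n. d i t) (suminf (\<lambda>n. d n t)) < e"
      by (rule uniform_limitD)
    then show "\<forall>\<^sub>F n in sequentially. \<forall>t\<in>ball 0 r. \<forall>h.
        norm ((\<Sum>i<n. h *\<^sub>R d i t) - h *\<^sub>R g t) \<le> e * norm h"
    proof (rule eventually_mono, intro ballI allI)
      fix n and t h :: real
      assume "\<forall>t\<in>ball 0 r. dist (\<Sum>i<n. d i t) (suminf (\<lambda>n. d n t)) < e" and "t \<in> ball 0 r"
      then have "norm ((\<Sum>i<n. d i t) - g t) \<le> e"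
        using sums_unique[OF dsum] by (auto simp: dist_norm less_imp_le)
      then show "norm ((\<Sum>i<n. h *\<^sub>R d i t) - h *\<^sub>R g t) \<le> e * norm h"
        by (simp add: scaleR_sum_right[symmetric] scaleR_diff_right[symmetric]
            mult.commute[of e] mult_left_mono)
    qed
  next
    show "(\<lambda>n. f n 0) sums S_op \<nu> lam 0 x"
      unfolding f_def a_def S_op_def by (rule summable_sums[OF summable_S_op[OF assms]])
  next
    show "(0::real) \<in> ball 0 r" by (simp add: r_def)
  qed (rule convex_ball fder)+
  then obtain G where G: "\<And>t. t \<in> ball 0 r \<Longrightarrow> (\<lambda>n. f n t) sums (G t)"
      "\<And>t. t \<in> ball 0 r \<Longrightarrow> (G has_derivative (\<lambda>h. h *\<^sub>R g t)) (at t within ball 0 r)"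
    by blast
  have t: "t \<in> ball 0 r" by (simp add: r_def)
  have "G t = S_op \<nu> lam t x" if "t \<in> ball 0 r" for t
    using sums_unique[OF G(1)[OF that]] by (simp add: S_op_def f_def a_def)
  then have "((\<lambda>t. S_op \<nu> lam t x) has_derivative (\<lambda>h. h *\<^sub>R g t)) (at t within ball 0 r)"
    by (intro has_derivative_transform[OF t _ G(2)[OF t]]) auto
  then show ?thesis
    using at_within_open[OF t] by (simp add: has_vector_derivative_def g_def)
qed

text \<open>Energy method: by coercivity \<open>exp (2 * lam * r) * inner (y r) (y r)\<close> is
  nonincreasing. Stating it for every trajectory of the linear equation, not only for
  \<open>S_op\<close>, makes uniqueness a corollary.\<close>

lemma A_flow_decay:
  assumes "\<nu> \<ge> 0" and "s \<le> t"
    and y: "\<And>r. (y has_vector_derivative - A_op \<nu> lam (y r)) (at r)"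
  shows "norm (y t) \<le> exp (- lam * (t - s)) * norm (y s)"
proof -
  define E where "E r = exp (2 * lam * r) * inner (y r) (y r)" for r
  have "(E has_real_derivative
     (exp (2 * lam * r) * (2 * lam)) * inner (y r) (y r)
       + exp (2 * lam * r) * (inner (y r) (- A_op \<nu> lam (y r)) + inner (- A_op \<nu> lam (y r)) (y r))) (at r)" for r
  proof -
    have "((\<lambda>r. inner (y r) (y r)) has_derivative
       (\<lambda>h. inner (y r) (h *\<^sub>R - A_op \<nu> lam (y r)) + inner (h *\<^sub>R - A_op \<nu> lam (y r)) (y r))) (at r)"
      using y[of r] unfolding has_vector_derivative_def by (intro has_derivative_inner)
    then have i: "((\<lambda>r. inner (y r) (y r)) has_real_derivative
       (inner (y r) (- A_op \<nu> lam (y r)) + inner (- A_op \<nu> lam (y r)) (y r))) (at r)"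
      by (rule has_derivative_imp_has_field_derivative) (simp add: algebra_simps)
    have "((\<lambda>r. exp (2 * lam * r)) has_real_derivative exp (2 * lam * r) * (2 * lam)) (at r)"
      by (auto intro!: derivative_eq_intros)
    from DERIV_mult[OF this i] show ?thesis unfolding E_def by (simp add: algebra_simps)
  qed
  moreover have "(exp (2 * lam * r) * (2 * lam)) * inner (y r) (y r)
       + exp (2 * lam * r) * (inner (y r) (- A_op \<nu> lam (y r)) + inner (- A_op \<nu> lam (y r)) (y r)) \<le> 0" for r
    using mult_left_mono[OF A_op_coercive[OF assms(1), of lam "y r"], of "2 * exp (2 * lam * r)"]
    by (simp add: inner_commute power2_norm_eq_inner algebra_simps)
  ultimately have "E t \<le> E s"
    by (intro DERIV_nonpos_imp_nonincreasing[OF assms(2)]) blast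
  then have "exp (- (2 * lam * t)) * E t \<le> exp (- (2 * lam * t)) * E s" by simp
  then have "(norm (y t))\<^sup>2 \<le> exp (- (2 * lam * t)) * exp (2 * lam * s) * (norm (y s))\<^sup>2"
    by (simp add: E_def power2_norm_eq_inner mult.assoc[symmetric] exp_add[symmetric])
  also have "\<dots> = (exp (- lam * (t - s)) * norm (y s))\<^sup>2"
    by (simp add: power_mult_distrib power2_eq_square[of "exp _"] exp_add[symmetric] algebra_simps)
  finally show ?thesis by (rule power2_le_imp_le) simp
qed

text \<open>Uniqueness for the linear equation. Linearity and the semigroup law of
  \<open>S_op\<close> follow by applying it to the defect, with no manipulation of the power
  series.\<close>

lemma A_flow_zero:
  assumes "\<nu> \<ge> 0" "0 \<le> t" "y 0 = 0"
    and "\<And>r. (y has_vector_derivative - A_op \<nu> lam (y r)) (at r)"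
  shows "y t = 0"
  using A_flow_decay[OF assms(1,2,4)] assms(3) by simp

lemma S_op_0 [simp]: "S_op \<nu> lam 0 x = x"
proof -
  have "(\<lambda>n. ((- 0 :: real) ^ n / fact n) *\<^sub>R (A_op \<nu> lam ^^ n) x) = (\<lambda>n. if n = 0 then x else 0)"
    by (auto simp: fun_eq_iff)
  then show ?thesis unfolding S_op_def using sums_single[of 0 "\<lambda>_. x"]
    by (simp add: sums_unique[symmetric])
qed

lemma norm_S_op_le:
  assumes "\<nu> \<ge> 0" "lam \<ge> 0" "t \<ge> 0"
  shows "norm (S_op \<nu> lam t x) \<le> exp (- lam * t) * norm x"
  using A_flow_decay[OF assms(1,3) S_op_has_vector_derivative[OF assms(1,2)]] by simp

lemma linear_S_op:
  assumes "\<nu> \<ge> 0" "lam \<ge> 0" "t \<ge> 0"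
  shows "linear (S_op \<nu> lam t)"
proof (rule linearI)
  note der = S_op_has_vector_derivative[OF assms(1,2)]
  note lin = linear_add[OF linear_A_op] linear_diff[OF linear_A_op] linear_scale[OF linear_A_op]
  fix x y :: ell2 and c :: real
  have "S_op \<nu> lam t (x + y) - S_op \<nu> lam t x - S_op \<nu> lam t y = 0"
    by (rule A_flow_zero[where lam = lam, OF assms(1,3)], simp)
       (rule derivative_eq_intros der refl | simp add: lin)+
  then show "S_op \<nu> lam t (x + y) = S_op \<nu> lam t x + S_op \<nu> lam t y" by (simp add: algebra_simps)
  have "S_op \<nu> lam t (c *\<^sub>R x) - c *\<^sub>R S_op \<nu> lam t x = 0"
    by (rule A_flow_zero[where lam = lam, OF assms(1,3)], simp)
       (rule derivative_eq_intros der refl | simp add: lin)+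
  then show "S_op \<nu> lam t (c *\<^sub>R x) = c *\<^sub>R S_op \<nu> lam t x" by simp
qed

lemma S_op_add:
  assumes "\<nu> \<ge> 0" "lam \<ge> 0" "t \<ge> 0"
  shows "S_op \<nu> lam (t + s) x = S_op \<nu> lam t (S_op \<nu> lam s x)"
proof -
  note der = S_op_has_vector_derivative[OF assms(1,2)]
  have der': "((\<lambda>t. S_op \<nu> lam (t + s) x) has_vector_derivative - A_op \<nu> lam (S_op \<nu> lam (r + s) x)) (at r)" for r
    using vector_diff_chain_at[of "\<lambda>t. t + s" 1 r, OF _ der[of x "r + s"]]
    by (simp add: o_def has_vector_derivative_add_const)
  have "S_op \<nu> lam (t + s) x - S_op \<nu> lam t (S_op \<nu> lam s x) = 0"
    by (rule A_flow_zero[where lam = lam, OF assms(1,3)], simp)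
       (rule derivative_eq_intros der der' refl | simp add: linear_diff[OF linear_A_op])+
  then show ?thesis by simp
qed

lemma norm_S_op_diff_id_le:
  assumes "\<nu> \<ge> 0" "lam \<ge> 0" "t \<ge> 0"
  shows "norm (S_op \<nu> lam t x - x) \<le> (4 * \<nu> + lam) * t * norm x"
proof -
  have "norm (S_op \<nu> lam t x - S_op \<nu> lam 0 x) \<le> (4 * \<nu> + lam) * norm x * norm (t - 0)"
  proof (rule differentiable_bound[of "{0..t}"])
    fix r assume r: "r \<in> {0..t}"
    show "((\<lambda>t. S_op \<nu> lam t x) has_derivative (\<lambda>h. h *\<^sub>R - A_op \<nu> lam (S_op \<nu> lam r x)))
        (at r within {0..t})"
      using S_op_has_vector_derivative[OF assms(1,2), of x r]
      unfolding has_vector_derivative_def by (rule has_derivative_at_withinI)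
    have "norm (A_op \<nu> lam (S_op \<nu> lam r x)) \<le> (4 * \<nu> + lam) * norm (S_op \<nu> lam r x)"
      by (rule norm_A_op_le[OF assms(1,2)])
    also have "\<dots> \<le> (4 * \<nu> + lam) * norm x"
    proof (rule mult_left_mono)
      have "exp (- lam * r) * norm x \<le> 1 * norm x"
        using r assms by (intro mult_right_mono) auto
      with norm_S_op_le[OF assms(1,2), of r x] r show "norm (S_op \<nu> lam r x) \<le> norm x" by simp
    qed (use assms in auto)
    finally have *: "norm (A_op \<nu> lam (S_op \<nu> lam r x)) \<le> (4 * \<nu> + lam) * norm x" .
    show "onorm (\<lambda>h. h *\<^sub>R - A_op \<nu> lam (S_op \<nu> lam r x)) \<le> (4 * \<nu> + lam) * norm x"
      by (rule onorm_le) (use mult_left_mono[OF *] in \<open>simp add: mult.commute\<close>)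
  qed (use assms in auto)
  then show ?thesis using assms by (simp add: mult_ac)
qed

text \<open>Factoring out \<open>S_op \<nu> lam s\<close> keeps the decay at the earlier time, which
  the bound for the difference to the identity alone would lose.\<close>

lemma norm_S_op_diff_le:
  assumes "\<nu> \<ge> 0" "lam \<ge> 0" "0 \<le> s" "s \<le> t"
  shows "norm (S_op \<nu> lam t x - S_op \<nu> lam s x) \<le> (4 * \<nu> + lam) * (t - s) * exp (- lam * s) * norm x"
proof -
  have "S_op \<nu> lam t x - S_op \<nu> lam s x = S_op \<nu> lam (t - s) (S_op \<nu> lam s x) - S_op \<nu> lam s x"
    using S_op_add[OF assms(1,2), of "t - s" s x] assms by simp
  also have "norm \<dots> \<le> (4 * \<nu> + lam) * (t - s) * norm (S_op \<nu> lam s x)"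
    using assms by (intro norm_S_op_diff_id_le) auto
  also have "\<dots> \<le> (4 * \<nu> + lam) * (t - s) * (exp (- lam * s) * norm x)"
    using assms by (intro mult_left_mono norm_S_op_le) auto
  finally show ?thesis by (simp add: mult.assoc)
qed

section \<open>Fractional derivatives\<close>

text \<open>A non-integrable \<open>f\<close> is covered as well: its integral has the default value
  0, and \<open>g\<close> is nonnegative on \<open>S\<close> because it dominates an absolute
  value.\<close>

lemma abs_set_integral_le:
  fixes f g :: "real \<Rightarrow> real"
  assumes g: "set_integrable lborel S g" and le: "\<And>r. r \<in> S \<Longrightarrow> \<bar>f r\<bar> \<le> g r"
  shows "\<bar>LBINT r:S. f r\<bar> \<le> (LBINT r:S. g r)"
proof -
  have nonneg: "0 \<le> (LBINT r:S. g r)"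
    unfolding set_lebesgue_integral_def
    by (rule integral_nonneg_AE) (use le in \<open>force simp: indicator_def intro: order_trans[OF abs_ge_zero]\<close>)
  show ?thesis
  proof (cases "set_integrable lborel S f")
    case True
    have "\<bar>LBINT r:S. f r\<bar> \<le> (LBINT r:S. \<bar>f r\<bar>)"
      using set_integral_norm_bound[OF True] by simp
    also have "\<dots> \<le> (LBINT r:S. g r)"
      by (rule set_integral_mono) (use True g le in \<open>auto intro: set_integrable_abs\<close>)
    finally show ?thesis .
  next
    case False
    then have "(LBINT r:S. f r) = 0"
      by (simp add: set_lebesgue_integral_def set_integrable_def not_integrable_integral_eq)
    with nonneg show ?thesis by simp
  qed
qed

lemma set_integrable_bounded_by:
  fixes f g :: "real \<Rightarrow> real"
  assumes g: "set_integrable lborel S g"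
    and f: "(\<lambda>r. indicator S r * f r) \<in> borel_measurable borel"
    and le: "\<And>r. r \<in> S \<Longrightarrow> \<bar>f r\<bar> \<le> g r"
  shows "set_integrable lborel S f"
  using g unfolding set_integrable_def
proof (rule Bochner_Integration.integrable_bound)
  show "AE r in lborel. norm (indicator S r *\<^sub>R f r) \<le> norm (indicator S r *\<^sub>R g r)"
    using le by (force simp: indicator_def)
qed (use f in simp)

text \<open>Moving the endpoints into the integrand lets \<open>measurable\<close> treat integrals
  whose limits depend on the outer variable.\<close>

lemma set_integral_Icc_if:
  fixes f :: "real \<Rightarrow> real"
  shows "(LBINT q:{a..b}. f q) = (\<integral>q. (if a \<le> q \<and> q \<le> b then f q else 0) \<partial>lborel)"
  unfolding set_lebesgue_integral_def by (rule Bochner_Integration.integral_cong) auto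

lemma set_integral_sum:
  fixes f :: "'k \<Rightarrow> real \<Rightarrow> real"
  assumes "\<And>k. k \<in> K \<Longrightarrow> set_integrable lborel S (f k)"
  shows "(LBINT r:S. (\<Sum>k\<in>K. f k r)) = (\<Sum>k\<in>K. LBINT r:S. f k r)"
  using assms unfolding set_lebesgue_integral_def set_integrable_def scaleR_sum_right
  by (rule Bochner_Integration.integral_sum)

section \<open>Integrals of power weights\<close>

lemma has_bochner_integral_powr:
  fixes a c :: real
  assumes "a > -1" "c \<ge> 0"
  shows "has_bochner_integral lborel (\<lambda>x. indicator {0..c} x * x powr a) (c powr (a + 1) / (a + 1))"
proof (rule has_bochner_integral_nn_integral)
  have "((\<lambda>x. if x \<in> {0..c} then x powr a else 0) has_integral (c powr (a + 1) / (a + 1))) UNIV"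
    unfolding has_integral_restrict_UNIV by (rule has_integral_powr_from_0[OF assms])
  then have "((\<lambda>x. indicator {0..c} x * x powr a) has_integral (c powr (a + 1) / (a + 1))) UNIV"
    by (rule has_integral_eq[rotated]) (simp add: indicator_def)
  then show "(\<integral>\<^sup>+x. ennreal (indicator {0..c} x * x powr a) \<partial>lborel) = ennreal (c powr (a + 1) / (a + 1))"
    by (intro nn_integral_has_integral_lborel) auto
qed (use assms in auto)

lemma set_integral_powr_left:
  fixes a s t :: real
  assumes "a > -1" "s \<le> t"
  shows "set_integrable lborel {s..t} (\<lambda>r. (r - s) powr a)"
    and "(LBINT r:{s..t}. (r - s) powr a) = (t - s) powr (a + 1) / (a + 1)"
proof -
  have "has_bochner_integral lborel (\<lambda>x. indicator {0..t - s} (- s + 1 * x) * (- s + 1 * x) powr a)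
      ((t - s) powr (a + 1) / (a + 1) /\<^sub>R \<bar>1\<bar>)"
    by (subst lborel_has_bochner_integral_real_affine_iff[symmetric])
       (use assms in \<open>auto intro: has_bochner_integral_powr\<close>)
  moreover have "(\<lambda>x. indicator {0..t - s} (- s + 1 * x) * (- s + 1 * x) powr a)
      = (\<lambda>x. indicator {s..t} x *\<^sub>R (x - s) powr a)"
    by (auto simp: indicator_def fun_eq_iff)
  ultimately have "has_bochner_integral lborel (\<lambda>x. indicator {s..t} x *\<^sub>R (x - s) powr a)
      ((t - s) powr (a + 1) / (a + 1))" by simp
  then show "set_integrable lborel {s..t} (\<lambda>r. (r - s) powr a)"
    and "(LBINT r:{s..t}. (r - s) powr a) = (t - s) powr (a + 1) / (a + 1)"
    by (simp_all add: has_bochner_integral_iff set_integrable_def set_lebesgue_integral_def)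
qed

lemma set_integral_powr_right:
  fixes a s t :: real
  assumes "a > -1" "s \<le> t"
  shows "set_integrable lborel {s..t} (\<lambda>r. (t - r) powr a)"
    and "(LBINT r:{s..t}. (t - r) powr a) = (t - s) powr (a + 1) / (a + 1)"
proof -
  have "has_bochner_integral lborel (\<lambda>x. indicator {0..t - s} (t + (-1) * x) * (t + (-1) * x) powr a)
      ((t - s) powr (a + 1) / (a + 1) /\<^sub>R \<bar>-1\<bar>)"
    by (subst lborel_has_bochner_integral_real_affine_iff[symmetric])
       (use assms in \<open>auto intro: has_bochner_integral_powr\<close>)
  moreover have "(\<lambda>x. indicator {0..t - s} (t + (-1) * x) * (t + (-1) * x) powr a)
      = (\<lambda>x. indicator {s..t} x *\<^sub>R (t - x) powr a)"
    by (auto simp: indicator_def fun_eq_iff)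
  ultimately have "has_bochner_integral lborel (\<lambda>x. indicator {s..t} x *\<^sub>R (t - x) powr a)
      ((t - s) powr (a + 1) / (a + 1))" by simp
  then show "set_integrable lborel {s..t} (\<lambda>r. (t - r) powr a)"
    and "(LBINT r:{s..t}. (t - r) powr a) = (t - s) powr (a + 1) / (a + 1)"
    by (simp_all add: has_bochner_integral_iff set_integrable_def set_lebesgue_integral_def)
qed

lemma indicator_mult_measurable:
  fixes z :: "real \<Rightarrow> real"
  assumes "continuous_on {a..b} z"
  shows "(\<lambda>q. indicator {a..b} q * z q) \<in> borel_measurable borel"
  using borel_measurable_continuous_on_indicator[OF _ assms] by simp

text \<open>The boundary term contributes 1 and the integral of
  \<open>(r - q) powr (\<beta> - \<alpha> - 1)\<close> contributes
  \<open>\<alpha> / (\<beta> - \<alpha>)\<close>; the condition \<open>\<alpha> < \<beta>\<close>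
  keeps that integral finite.\<close>

definition c_left :: "real \<Rightarrow> real \<Rightarrow> real" where
  "c_left \<alpha> \<beta> = (1 + \<alpha> / (\<beta> - \<alpha>)) / Gamma (1 - \<alpha>)"

text \<open>The counterpart for the weight \<open>(q - r) powr (b + \<alpha> - 2)\<close>, which is
  integrable because \<open>1 - b < \<alpha>\<close>.\<close>

definition c_right :: "real \<Rightarrow> real \<Rightarrow> real" where
  "c_right \<alpha> b = (1 + (1 - \<alpha>) / (b + \<alpha> - 1)) / Gamma \<alpha>"

section \<open>The left-sided fractional derivative of a scalar function\<close>

lemma frac_left_integrand_bound:
  fixes z :: "real \<Rightarrow> real"
  assumes "q \<le> r" "\<bar>z r - z q\<bar> \<le> A * \<bar>r - q\<bar> powr \<beta>"
  shows "\<bar>(z r - z q) / (r - q) powr (1 + \<alpha>)\<bar> \<le> A * (r - q) powr (\<beta> - \<alpha> - 1)"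
proof (cases "q = r")
  case False
  then have "\<bar>(z r - z q) / (r - q) powr (1 + \<alpha>)\<bar> \<le> A * (r - q) powr \<beta> / (r - q) powr (1 + \<alpha>)"
    using assms by (simp add: abs_divide divide_right_mono)
  also have "\<dots> = A * (r - q) powr (\<beta> - (1 + \<alpha>))"
    unfolding powr_diff by simp
  also have "\<beta> - (1 + \<alpha>) = \<beta> - \<alpha> - 1" by simp
  finally show ?thesis .
qed simp

lemma frac_left_integrable:
  fixes z :: "real \<Rightarrow> real"
  assumes \<alpha>: "\<alpha> < \<beta>" and sr: "s \<le> r" and cont: "continuous_on {s..r} z"
    and hoelder: "\<And>q. q \<in> {s..r} \<Longrightarrow> \<bar>z r - z q\<bar> \<le> A * \<bar>r - q\<bar> powr \<beta>"
  shows "set_integrable lborel {s..r} (\<lambda>q. (z r - z q) / (r - q) powr (1 + \<alpha>))"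
proof (rule set_integrable_bounded_by)
  show "set_integrable lborel {s..r} (\<lambda>q. A * (r - q) powr (\<beta> - \<alpha> - 1))"
    using \<alpha> sr by (intro set_integrable_mult_right set_integral_powr_right) auto
  have "(\<lambda>q. indicator {s..r} q * ((z r - z q) / (r - q) powr (1 + \<alpha>)))
      = (\<lambda>q. (indicator {s..r} q * z r - indicator {s..r} q * z q) / (r - q) powr (1 + \<alpha>))"
    by (auto simp: algebra_simps fun_eq_iff)
  also have "\<dots> \<in> borel_measurable borel"
    using indicator_mult_measurable[OF cont] by measurable
  finally show "(\<lambda>q. indicator {s..r} q * ((z r - z q) / (r - q) powr (1 + \<alpha>))) \<in> borel_measurable borel" .
qed (rule frac_left_integrand_bound, use hoelder in auto)

text \<open>Splitting the singular integral needs every summand integrable, which is where the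
  Hoelder bounds enter. This linearity serves the duality argument that turns scalar bounds into
  Hilbert-Schmidt bounds.\<close>

lemma frac_deriv_left_sum:
  fixes z :: "'k \<Rightarrow> real \<Rightarrow> real"
  assumes "finite K" and "\<alpha> < \<beta>" "s \<le> r" "\<And>k. k \<in> K \<Longrightarrow> continuous_on {s..r} (z k)"
    and "\<And>k q. k \<in> K \<Longrightarrow> q \<in> {s..r} \<Longrightarrow> \<bar>z k r - z k q\<bar> \<le> A k * \<bar>r - q\<bar> powr \<beta>"
  shows "frac_deriv_left \<alpha> s (\<lambda>q. \<Sum>k\<in>K. c k * z k q) r = (\<Sum>k\<in>K. c k * frac_deriv_left \<alpha> s (z k) r)"
proof -
  have "(LBINT q:{s..r}. ((\<Sum>k\<in>K. c k * z k r) - (\<Sum>k\<in>K. c k * z k q)) / (r - q) powr (1 + \<alpha>))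
      = (LBINT q:{s..r}. (\<Sum>k\<in>K. c k * ((z k r - z k q) / (r - q) powr (1 + \<alpha>))))"
    by (simp add: sum_subtractf[symmetric] sum_divide_distrib algebra_simps diff_divide_distrib)
  also have "\<dots> = (\<Sum>k\<in>K. LBINT q:{s..r}. c k * ((z k r - z k q) / (r - q) powr (1 + \<alpha>)))"
    using assms by (intro set_integral_sum set_integrable_mult_right frac_left_integrable) auto
  finally have "(LBINT q:{s..r}. ((\<Sum>k\<in>K. c k * z k r) - (\<Sum>k\<in>K. c k * z k q)) / (r - q) powr (1 + \<alpha>))
      = (\<Sum>k\<in>K. c k * (LBINT q:{s..r}. (z k r - z k q) / (r - q) powr (1 + \<alpha>)))"
    by (simp only: set_integral_mult_right)
  then show ?thesis
    by (simp add: frac_deriv_left_def sum_distrib_left sum.distrib sum_divide_distrib algebra_simps)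
qed

lemma frac_deriv_left_bound:
  fixes z :: "real \<Rightarrow> real"
  assumes \<alpha>: "0 < \<alpha>" "\<alpha> < \<beta>" "\<beta> \<le> 1" "\<alpha> < 1" and r: "0 \<le> r" "r \<le> T"
    and z: "\<bar>z r\<bar> \<le> A" and hoelder: "\<And>q. q \<in> {0..r} \<Longrightarrow> \<bar>z r - z q\<bar> \<le> A * \<bar>r - q\<bar> powr \<beta>"
  shows "\<bar>frac_deriv_left \<alpha> 0 z r\<bar>
    \<le> c_left \<alpha> \<beta> * (1 + T) * A * r powr (- \<alpha>)"
proof -
  have A: "A \<ge> 0" using z by simp
  have G: "Gamma (1 - \<alpha>) > 0" using \<alpha> by (intro Gamma_real_pos) auto
  have "\<bar>LBINT q:{0..r}. (z r - z q) / (r - q) powr (1 + \<alpha>)\<bar>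
      \<le> (LBINT q:{0..r}. A * (r - q) powr (\<beta> - \<alpha> - 1))"
    using \<alpha> r hoelder
    by (intro abs_set_integral_le set_integrable_mult_right set_integral_powr_right
        frac_left_integrand_bound) auto
  also have "\<dots> = A * (r powr (\<beta> - \<alpha>) / (\<beta> - \<alpha>))"
    using set_integral_powr_right(2)[of "\<beta> - \<alpha> - 1" 0 r] \<alpha> r by simp
  also have "r powr (\<beta> - \<alpha>) = r powr \<beta> * r powr (- \<alpha>)" by (simp add: powr_add[symmetric])
  finally have I: "\<bar>LBINT q:{0..r}. (z r - z q) / (r - q) powr (1 + \<alpha>)\<bar>
      \<le> A * (r powr \<beta> * r powr (- \<alpha>) / (\<beta> - \<alpha>))" .
  \<comment> \<open>Both terms are to carry the weight \<open>r powr (- \<alpha>)\<close>; the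
    surplus factor \<open>r powr \<beta>\<close> of the integral term is paid by
    \<open>1 + T\<close>.\<close>
  have "r powr \<beta> \<le> (1 + T) powr \<beta>" using \<alpha> r by (intro powr_mono2) auto
  also have "\<dots> \<le> (1 + T) powr 1" using \<alpha> r by (intro powr_mono) auto
  finally have rb: "r powr \<beta> \<le> 1 + T" using r by simp
  have "\<bar>z r / (r - 0) powr \<alpha> + \<alpha> * (LBINT q:{0..r}. (z r - z q) / (r - q) powr (1 + \<alpha>))\<bar>
     \<le> A * r powr (- \<alpha>) + \<alpha> * (A * ((1 + T) * r powr (- \<alpha>) / (\<beta> - \<alpha>)))"
  proof (rule order_trans[OF abs_triangle_ineq add_mono])
    show "\<bar>z r / (r - 0) powr \<alpha>\<bar> \<le> A * r powr (- \<alpha>)"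
      using z by (simp add: powr_minus divide_inverse[symmetric] abs_divide divide_right_mono)
    have "A * (r powr \<beta> * r powr (- \<alpha>) / (\<beta> - \<alpha>)) \<le> A * ((1 + T) * r powr (- \<alpha>) / (\<beta> - \<alpha>))"
      using A \<alpha> rb by (intro mult_left_mono divide_right_mono mult_right_mono) auto
    from mult_left_mono[OF order_trans[OF I this], of \<alpha>] \<alpha>
    show "\<bar>\<alpha> * (LBINT q:{0..r}. (z r - z q) / (r - q) powr (1 + \<alpha>))\<bar>
       \<le> \<alpha> * (A * ((1 + T) * r powr (- \<alpha>) / (\<beta> - \<alpha>)))"
      by (simp add: abs_mult)
  qed
  also have "\<dots> \<le> A * ((1 + T) * r powr (- \<alpha>)) + \<alpha> * (A * ((1 + T) * r powr (- \<alpha>) / (\<beta> - \<alpha>)))"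
    using A r by (intro add_right_mono mult_left_mono) (auto simp: algebra_simps)
  also have "\<dots> = (1 + \<alpha> / (\<beta> - \<alpha>)) * (1 + T) * A * r powr (- \<alpha>)"
    by (simp add: algebra_simps)
  finally show ?thesis
    using G by (simp add: frac_deriv_left_def c_left_def abs_mult divide_right_mono)
qed

lemma frac_deriv_left_measurable:
  fixes z :: "real \<Rightarrow> real"
  assumes "continuous_on {0..T} z"
  shows "(\<lambda>r. indicator {0..T} r * frac_deriv_left \<alpha> 0 z r) \<in> borel_measurable borel"
proof -
  \<comment> \<open>Only continuity on \<open>{0..T}\<close> is given; the truncation is Borel on
    the whole line and has the same derivative at every \<open>r \<in> {0..T}\<close>, because that
    derivative looks at \<open>{0..r}\<close> only.\<close>
  define y where "y q = indicator {0..T} q * z q" for q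
  have [measurable]: "y \<in> borel_measurable borel"
    unfolding y_def by (rule indicator_mult_measurable[OF assms])
  have "frac_deriv_left \<alpha> 0 z r = frac_deriv_left \<alpha> 0 y r" if "r \<in> {0..T}" for r
    using that unfolding frac_deriv_left_def
    by (intro arg_cong2[of _ _ _ _ "(*)"] arg_cong2[of _ _ _ _ "(+)"] set_lebesgue_integral_cong)
       (auto simp: y_def)
  then have "(\<lambda>r. indicator {0..T} r * frac_deriv_left \<alpha> 0 z r)
      = (\<lambda>r. indicator {0..T} r * (1 / Gamma (1 - \<alpha>) * (y r / (r - 0) powr \<alpha>
         + \<alpha> * (\<integral>q. (if 0 \<le> q \<and> q \<le> r then (y r - y q) / (r - q) powr (1 + \<alpha>) else 0) \<partial>lborel))))"
    by (auto simp: fun_eq_iff frac_deriv_left_def set_integral_Icc_if split: split_indicator)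
  also have "\<dots> \<in> borel_measurable borel" by measurable
  finally show ?thesis .
qed

section \<open>The right-sided fractional derivative of a scalar function\<close>

lemma frac_right_integrand_bound:
  fixes w :: "real \<Rightarrow> real"
  assumes "r \<le> q" "\<bar>w r - w q\<bar> \<le> L * \<bar>r - q\<bar> powr b"
  shows "\<bar>(w r - w q) / (q - r) powr (2 - \<alpha>)\<bar> \<le> L * (q - r) powr (b + \<alpha> - 2)"
proof (cases "q = r")
  case False
  then have "\<bar>(w r - w q) / (q - r) powr (2 - \<alpha>)\<bar> \<le> L * (q - r) powr b / (q - r) powr (2 - \<alpha>)"
    using assms by (simp add: abs_divide divide_right_mono abs_minus_commute)
  also have "\<dots> = L * (q - r) powr (b - (2 - \<alpha>))"
    unfolding powr_diff by simp
  also have "b - (2 - \<alpha>) = b + \<alpha> - 2" by simp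
  finally show ?thesis .
qed simp

lemma frac_right_integrable:
  fixes w :: "real \<Rightarrow> real"
  assumes \<alpha>: "1 - b < \<alpha>" and rt: "r \<le> t" and cont: "continuous_on {r..t} w"
    and hoelder: "\<And>q. q \<in> {r..t} \<Longrightarrow> \<bar>w r - w q\<bar> \<le> L * \<bar>r - q\<bar> powr b"
  shows "set_integrable lborel {r..t} (\<lambda>q. (w r - w q) / (q - r) powr (2 - \<alpha>))"
proof (rule set_integrable_bounded_by)
  show "set_integrable lborel {r..t} (\<lambda>q. L * (q - r) powr (b + \<alpha> - 2))"
    using \<alpha> rt by (intro set_integrable_mult_right set_integral_powr_left) auto
  have "(\<lambda>q. indicator {r..t} q * ((w r - w q) / (q - r) powr (2 - \<alpha>)))
      = (\<lambda>q. (indicator {r..t} q * w r - indicator {r..t} q * w q) / (q - r) powr (2 - \<alpha>))"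
    by (auto simp: algebra_simps fun_eq_iff)
  also have "\<dots> \<in> borel_measurable borel"
    using indicator_mult_measurable[OF cont] by measurable
  finally show "(\<lambda>q. indicator {r..t} q * ((w r - w q) / (q - r) powr (2 - \<alpha>))) \<in> borel_measurable borel" .
qed (rule frac_right_integrand_bound, use hoelder in auto)

lemma frac_deriv_right_sum:
  fixes w :: "'k \<Rightarrow> real \<Rightarrow> real"
  assumes "finite K" and "1 - b < \<alpha>" "r \<le> t" "\<And>k. k \<in> K \<Longrightarrow> continuous_on {r..t} (w k)"
    and "\<And>k q. k \<in> K \<Longrightarrow> q \<in> {r..t} \<Longrightarrow> \<bar>w k r - w k q\<bar> \<le> L k * \<bar>r - q\<bar> powr b"
  shows "frac_deriv_right \<alpha> t (\<lambda>q. \<Sum>k\<in>K. c k * w k q) r = (\<Sum>k\<in>K. c k * frac_deriv_right \<alpha> t (w k) r)"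
proof -
  have "(LBINT q:{r..t}. ((\<Sum>k\<in>K. c k * w k r) - (\<Sum>k\<in>K. c k * w k q)) / (q - r) powr (2 - \<alpha>))
      = (LBINT q:{r..t}. (\<Sum>k\<in>K. c k * ((w k r - w k q) / (q - r) powr (2 - \<alpha>))))"
    by (simp add: sum_subtractf[symmetric] sum_divide_distrib algebra_simps diff_divide_distrib)
  also have "\<dots> = (\<Sum>k\<in>K. LBINT q:{r..t}. c k * ((w k r - w k q) / (q - r) powr (2 - \<alpha>)))"
    using assms by (intro set_integral_sum set_integrable_mult_right frac_right_integrable) auto
  finally have I: "(LBINT q:{r..t}. ((\<Sum>k\<in>K. c k * w k r) - (\<Sum>k\<in>K. c k * w k q)) / (q - r) powr (2 - \<alpha>))
      = (\<Sum>k\<in>K. c k * (LBINT q:{r..t}. (w k r - w k q) / (q - r) powr (2 - \<alpha>)))"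
    by (simp only: set_integral_mult_right)
  have "frac_deriv_right \<alpha> t (\<lambda>q. \<Sum>k\<in>K. c k * w k q) r =
    1 / Gamma \<alpha> * ((\<Sum>k\<in>K. c k * (w k r - w k t)) / (t - r) powr (1 - \<alpha>) + (1 - \<alpha>) *
      (\<Sum>k\<in>K. c k * (LBINT q:{r..t}. (w k r - w k q) / (q - r) powr (2 - \<alpha>))))"
    unfolding frac_deriv_right_def I by (simp add: sum_subtractf right_diff_distrib)
  also have "\<dots> = (\<Sum>k\<in>K. c k * frac_deriv_right \<alpha> t (w k) r)"
    by (simp add: frac_deriv_right_def sum_distrib_left sum_divide_distrib
        sum.distrib[symmetric] distrib_left mult_ac)
  finally show ?thesis .
qed

lemma frac_deriv_right_bound:
  fixes w :: "real \<Rightarrow> real"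
  assumes \<alpha>: "0 < \<alpha>" "\<alpha> < 1" "1 - b < \<alpha>" and r: "r \<le> t"
    and hoelder: "\<And>q. q \<in> {r..t} \<Longrightarrow> \<bar>w r - w q\<bar> \<le> L * \<bar>r - q\<bar> powr b"
  shows "\<bar>frac_deriv_right \<alpha> t w r\<bar>
    \<le> c_right \<alpha> b * L * (t - r) powr (b + \<alpha> - 1)"
proof -
  have G: "Gamma \<alpha> > 0" using \<alpha> by (intro Gamma_real_pos) auto
  have "\<bar>LBINT q:{r..t}. (w r - w q) / (q - r) powr (2 - \<alpha>)\<bar>
      \<le> (LBINT q:{r..t}. L * (q - r) powr (b + \<alpha> - 2))"
    using \<alpha> r hoelder
    by (intro abs_set_integral_le set_integrable_mult_right set_integral_powr_left
        frac_right_integrand_bound) auto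
  also have "\<dots> = L * ((t - r) powr (b + \<alpha> - 1) / (b + \<alpha> - 1))"
    using set_integral_powr_left(2)[of "b + \<alpha> - 2" r t] \<alpha> r by simp
  finally have I: "\<bar>LBINT q:{r..t}. (w r - w q) / (q - r) powr (2 - \<alpha>)\<bar>
      \<le> L * ((t - r) powr (b + \<alpha> - 1) / (b + \<alpha> - 1))" .
  have "\<bar>(w r - w t) / (t - r) powr (1 - \<alpha>) + (1 - \<alpha>) * (LBINT q:{r..t}. (w r - w q) / (q - r) powr (2 - \<alpha>))\<bar>
     \<le> L * (t - r) powr (b + \<alpha> - 1) + (1 - \<alpha>) * (L * ((t - r) powr (b + \<alpha> - 1) / (b + \<alpha> - 1)))"
  proof (rule order_trans[OF abs_triangle_ineq add_mono])
    have "\<bar>(w r - w t) / (t - r) powr (1 - \<alpha>)\<bar> \<le> L * (t - r) powr b / (t - r) powr (1 - \<alpha>)"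
      using hoelder[of t] r by (simp add: abs_divide divide_right_mono abs_minus_commute)
    also have "\<dots> = L * (t - r) powr (b - (1 - \<alpha>))"
      unfolding powr_diff by simp
    also have "b - (1 - \<alpha>) = b + \<alpha> - 1" by simp
    finally show "\<bar>(w r - w t) / (t - r) powr (1 - \<alpha>)\<bar> \<le> L * (t - r) powr (b + \<alpha> - 1)" .
    from mult_left_mono[OF I, of "1 - \<alpha>"] \<alpha>
    show "\<bar>(1 - \<alpha>) * (LBINT q:{r..t}. (w r - w q) / (q - r) powr (2 - \<alpha>))\<bar>
       \<le> (1 - \<alpha>) * (L * ((t - r) powr (b + \<alpha> - 1) / (b + \<alpha> - 1)))"
      by (simp add: abs_mult)
  qed
  also have "\<dots> = (1 + (1 - \<alpha>) / (b + \<alpha> - 1)) * L * (t - r) powr (b + \<alpha> - 1)"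
    by (simp add: algebra_simps)
  finally show ?thesis
    using G by (simp add: frac_deriv_right_def c_right_def abs_mult divide_right_mono)
qed

text \<open>The exponent \<open>\<alpha> - 2\<close> is below -1, so the singularity
  \<open>r\<close> has to lie strictly to the left of the interval. The closed form produces the
  cancellation in the change of the endpoint.\<close>

lemma set_integral_powr_FTC:
  fixes r s t \<alpha> :: real
  assumes "r < s" "s \<le> t" "\<alpha> < 1"
  shows "set_integrable lborel {s..t} (\<lambda>q. (q - r) powr (\<alpha> - 2))"
    and "(LBINT q:{s..t}. (q - r) powr (\<alpha> - 2)) = ((s - r) powr (\<alpha> - 1) - (t - r) powr (\<alpha> - 1)) / (1 - \<alpha>)"
proof -
  have eq: "x / (\<alpha> - 1) - y / (\<alpha> - 1) = (y - x) / (1 - \<alpha>)" for x y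
    by (metis diff_divide_distrib minus_diff_eq minus_divide_divide)
  have "has_bochner_integral lborel (\<lambda>q. indicator {s..t} q *\<^sub>R (q - r) powr (\<alpha> - 2))
    ((t - r) powr (\<alpha> - 1) / (\<alpha> - 1) - (s - r) powr (\<alpha> - 1) / (\<alpha> - 1))"
    using assms
    by (intro has_bochner_integral_FTC_Icc)
       (auto intro!: derivative_eq_intros continuous_intros
          simp: has_real_derivative_iff_has_vector_derivative[symmetric])
  then show "set_integrable lborel {s..t} (\<lambda>q. (q - r) powr (\<alpha> - 2))"
    and "(LBINT q:{s..t}. (q - r) powr (\<alpha> - 2)) = ((s - r) powr (\<alpha> - 1) - (t - r) powr (\<alpha> - 1)) / (1 - \<alpha>)"
    unfolding eq by (simp_all add: has_bochner_integral_iff set_integrable_def set_lebesgue_integral_def)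
qed

text \<open>Changing the endpoint: the terms with \<open>w r\<close> cancel, so that the difference is controlled by
  the increments of \<open>w\<close> on \<open>{s..t}\<close> alone. This replaces the additivity of the Young integral.\<close>

lemma frac_deriv_right_diff_bound:
  fixes w :: "real \<Rightarrow> real"
  assumes \<alpha>: "0 < \<alpha>" "\<alpha> < 1" "1 - b < \<alpha>" "0 < b" and r: "r < s" "s \<le> t"
    and cont: "continuous_on {r..t} w"
    and hoelder: "\<And>p q. p \<in> {r..t} \<Longrightarrow> q \<in> {r..t} \<Longrightarrow> \<bar>w p - w q\<bar> \<le> L * \<bar>p - q\<bar> powr b"
  shows "\<bar>frac_deriv_right \<alpha> t w r - frac_deriv_right \<alpha> s w r\<bar>
    \<le> L / Gamma \<alpha> * (t - s) powr b * (s - r) powr (\<alpha> - 1)"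
proof -
  have G: "Gamma \<alpha> > 0" using \<alpha> by (intro Gamma_real_pos) auto
  let ?k = "\<lambda>q. (q - r) powr (\<alpha> - 2)"
  define I where "I = (\<lambda>a c. LBINT q:{a..c}. (w r - w q) / (q - r) powr (2 - \<alpha>))"
  define J where "J = (LBINT q:{s..t}. ?k q)"
  define E where "E = (LBINT q:{s..t}. (w s - w q) * ?k q)"
  have div: "x / (q - r) powr (2 - \<alpha>) = x * ?k q" for x q
    using powr_minus_divide[of "q - r" "2 - \<alpha>"] by simp
  have Lnn: "0 \<le> L * (t - s) powr b"
    using hoelder[of s t] r by (simp add: abs_minus_commute order_trans[OF abs_ge_zero])
  have int: "set_integrable lborel {r..t} (\<lambda>q. (w r - w q) / (q - r) powr (2 - \<alpha>))"
    using \<alpha> r by (intro frac_right_integrable[OF \<alpha>(3) _ cont, where L = L] hoelder) auto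
  have wsq: "\<bar>w s - w q\<bar> \<le> L * (t - s) powr b" if "q \<in> {s..t}" for q
  \<comment> \<open>\<open>L\<close> carries no sign here: if it is negative, \<open>hoelder\<close>
    leaves only a vanishing increment, and the right-hand side is nonnegative by
    \<open>Lnn\<close>.\<close>
  proof (cases "L \<ge> 0")
    case True
    have "\<bar>w s - w q\<bar> \<le> L * \<bar>s - q\<bar> powr b" using that r by (intro hoelder) auto
    also have "\<dots> \<le> L * (t - s) powr b"
      using that True \<alpha> by (intro mult_left_mono powr_mono2) auto
    finally show ?thesis .
  next
    case False
    have "\<bar>w s - w q\<bar> \<le> L * \<bar>s - q\<bar> powr b" using that r by (intro hoelder) auto
    also have "\<dots> \<le> 0" using False by (simp add: mult_nonpos_nonneg)
    finally show ?thesis using Lnn by simp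
  qed
  have Eb: "\<bar>E\<bar> \<le> L * (t - s) powr b * J"
  proof -
    have "\<bar>E\<bar> \<le> (LBINT q:{s..t}. L * (t - s) powr b * ?k q)"
      unfolding E_def using r \<alpha> wsq
      by (intro abs_set_integral_le set_integrable_mult_right set_integral_powr_FTC)
         (auto simp: abs_mult intro!: mult_right_mono)
    then show ?thesis by (simp add: J_def)
  qed
  have cont_st: "continuous_on {s..t} w"
    by (rule continuous_on_subset[OF cont]) (use r in auto)
  have intE: "set_integrable lborel {s..t} (\<lambda>q. (w s - w q) * ?k q)"
  proof (rule set_integrable_bounded_by)
    show "set_integrable lborel {s..t} (\<lambda>q. L * (t - s) powr b * ?k q)"
      using r \<alpha> by (intro set_integrable_mult_right set_integral_powr_FTC) auto
    have "(\<lambda>q. indicator {s..t} q * ((w s - w q) * ?k q))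
      = (\<lambda>q. (indicator {s..t} q * w s - indicator {s..t} q * w q) * ?k q)"
      by (auto simp: algebra_simps fun_eq_iff)
    also have "\<dots> \<in> borel_measurable borel"
      using indicator_mult_measurable[OF cont_st] by measurable
    finally show "(\<lambda>q. indicator {s..t} q * ((w s - w q) * ?k q)) \<in> borel_measurable borel" .
  qed (use wsq in \<open>auto simp: abs_mult intro!: mult_right_mono\<close>)
  have split: "I r t = I r s + I s t"
    unfolding I_def using r
    by (subst set_integral_Un_AE[symmetric])
       (auto simp: ivl_disj_un intro!: set_integrable_subset[OF int] AE_I[of _ _ "{s}"] arg_cong2[of _ _ _ _ "set_lebesgue_integral lborel"])
  have "I s t = (LBINT q:{s..t}. (w r - w s) * ?k q + (w s - w q) * ?k q)"
    unfolding I_def div by (simp add: algebra_simps)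
  also have "\<dots> = (w r - w s) * J + E"
    unfolding J_def E_def using intE r \<alpha>
    by (subst set_integral_add) (auto intro!: set_integrable_mult_right set_integral_powr_FTC)
  finally have Ist: "I s t = (w r - w s) * J + E" .
  have J: "(1 - \<alpha>) * J = (s - r) powr (\<alpha> - 1) - (t - r) powr (\<alpha> - 1)"
    unfolding J_def using set_integral_powr_FTC(2)[OF r \<alpha>(2)] \<alpha> by simp
  have div1: "x / y powr (1 - \<alpha>) = x * y powr (\<alpha> - 1)" for x y :: real
    using powr_minus_divide[of y "1 - \<alpha>"] by simp
  have "Gamma \<alpha> * (frac_deriv_right \<alpha> t w r - frac_deriv_right \<alpha> s w r)
     = (w r - w t) * (t - r) powr (\<alpha> - 1) - (w r - w s) * (s - r) powr (\<alpha> - 1) + (1 - \<alpha>) * I s t"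
    using G split unfolding frac_deriv_right_def div1 I_def by (simp add: algebra_simps)
  \<comment> \<open>Inserting \<open>w s\<close> isolates the part that contains \<open>w r\<close>;
    its coefficient, the last bracket, is 0 by the closed form \<open>J\<close>.\<close>
  also have "\<dots> = (w s - w t) * (t - r) powr (\<alpha> - 1) + (1 - \<alpha>) * E
      + (w r - w s) * ((t - r) powr (\<alpha> - 1) - (s - r) powr (\<alpha> - 1) + (1 - \<alpha>) * J)"
    unfolding Ist by (simp add: algebra_simps)
  also have "\<dots> = (w s - w t) * (t - r) powr (\<alpha> - 1) + (1 - \<alpha>) * E" unfolding J by simp
  finally have eq: "Gamma \<alpha> * (frac_deriv_right \<alpha> t w r - frac_deriv_right \<alpha> s w r)
      = (w s - w t) * (t - r) powr (\<alpha> - 1) + (1 - \<alpha>) * E" .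
  have "\<bar>(w s - w t) * (t - r) powr (\<alpha> - 1) + (1 - \<alpha>) * E\<bar>
     \<le> (L * (t - s) powr b) * (t - r) powr (\<alpha> - 1) + (1 - \<alpha>) * (L * (t - s) powr b * J)"
    using wsq[of t] r \<alpha> Eb
    by (intro order_trans[OF abs_triangle_ineq add_mono]) (auto simp: abs_mult intro!: mult_right_mono)
  also have "\<dots> = (L * (t - s) powr b) * ((t - r) powr (\<alpha> - 1) + (1 - \<alpha>) * J)"
    by (simp add: algebra_simps)
  \<comment> \<open>The same identity \<open>J\<close> collapses the two kernels into the single
    kernel at \<open>s\<close>.\<close>
  also have "\<dots> = L * (t - s) powr b * (s - r) powr (\<alpha> - 1)" unfolding J by simp
  finally have "\<bar>Gamma \<alpha> * (frac_deriv_right \<alpha> t w r - frac_deriv_right \<alpha> s w r)\<bar>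
     \<le> L * (t - s) powr b * (s - r) powr (\<alpha> - 1)" unfolding eq .
  then have "\<bar>frac_deriv_right \<alpha> t w r - frac_deriv_right \<alpha> s w r\<bar>
     \<le> L * (t - s) powr b * (s - r) powr (\<alpha> - 1) / Gamma \<alpha>"
    using G unfolding abs_mult pos_le_divide_eq[OF G] by (simp add: mult.commute)
  then show ?thesis by simp
qed

lemma frac_deriv_right_measurable:
  fixes w :: "real \<Rightarrow> real"
  assumes "continuous_on UNIV w"
  shows "frac_deriv_right \<alpha> t w \<in> borel_measurable borel"
proof -
  have [measurable]: "w \<in> borel_measurable borel"
    by (rule borel_measurable_continuous_onI[OF assms])
  have "frac_deriv_right \<alpha> t w = (\<lambda>r. 1 / Gamma \<alpha> * ((w r - w t) / (t - r) powr (1 - \<alpha>)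
       + (1 - \<alpha>) * (\<integral>q. (if r \<le> q \<and> q \<le> t then (w r - w q) / (q - r) powr (2 - \<alpha>) else 0) \<partial>lborel)))"
    by (auto simp: fun_eq_iff frac_deriv_right_def set_integral_Icc_if)
  also have "\<dots> \<in> borel_measurable borel" by measurable
  finally show ?thesis .
qed

section \<open>Hilbert-Schmidt estimates\<close>

lemma inner_ebasis: "ebasis j \<bullet> u = coord u j"
proof -
  have "ebasis j \<bullet> u = (\<Sum>\<^sub>\<infinity>i\<in>{j}. coord u i)"
    unfolding inner_ell2_def by (rule infsum_cong_neutral) (auto simp: ebasis.rep_eq)
  then show ?thesis by simp
qed

lemma coord_sum: "coord (\<Sum>k\<in>K. u k) i = (\<Sum>k\<in>K. coord (u k) i)"
  by (induction K rule: infinite_finite_induct) auto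

text \<open>A bound uniform over finite sets amounts to square summability, so that
  \<open>Ell2\<close> does not fall back on an unspecified value.\<close>

lemma coord_Ell2:
  assumes "\<And>F. finite F \<Longrightarrow> (\<Sum>i\<in>F. (y i)\<^sup>2) \<le> V"
  shows "coord (Ell2 y) = y"
proof -
  have "(\<lambda>i. (y i)\<^sup>2) summable_on UNIV"
    by (rule nonneg_bdd_above_summable_on) (auto intro!: bdd_aboveI2[where M = V] assms)
  then show ?thesis by (intro Ell2_inverse) simp
qed

lemma norm_ell2_le:
  assumes "\<And>F. finite F \<Longrightarrow> (\<Sum>i\<in>F. (coord u i)\<^sup>2) \<le> V\<^sup>2" and "V \<ge> 0"
  shows "norm u \<le> V"
proof (rule power2_le_imp_le[OF _ assms(2)])
  show "(norm u)\<^sup>2 \<le> V\<^sup>2"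
    unfolding norm_ell2_sq by (rule infsum_le_finite_sums[OF coord_sq_summable assms(1)])
qed

text \<open>By Pythagoras the squared error of a partial sum is \<open>(norm u)\<^sup>2\<close>
  minus the partial sum of the squared coordinates. This later identifies the outer series of the
  Young integral.\<close>

lemma infsum_ebasis: "(\<Sum>\<^sub>\<infinity>j. coord u j *\<^sub>R ebasis j) = u"
proof (rule infsumI, unfold has_sum_def)
  have eq: "(norm ((\<Sum>j\<in>F. coord u j *\<^sub>R ebasis j) - u))\<^sup>2 = (norm u)\<^sup>2 - (\<Sum>j\<in>F. (coord u j)\<^sup>2)"
    if "finite F" for F
  proof -
    let ?v = "\<Sum>j\<in>F. coord u j *\<^sub>R ebasis j"
    have vv: "?v \<bullet> v = (\<Sum>j\<in>F. coord u j * coord v j)" for v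
      by (simp add: inner_sum_left inner_ebasis)
    have "coord ?v j = coord u j" if "j \<in> F" for j
    proof -
      have "coord ?v j = (\<Sum>k\<in>F. if j = k then coord u k else 0)"
        by (auto simp: coord_sum ebasis.rep_eq intro!: sum.cong)
      then show ?thesis using that \<open>finite F\<close> by simp
    qed
    then have "?v \<bullet> ?v = (\<Sum>j\<in>F. (coord u j)\<^sup>2)" unfolding vv by (simp add: power2_eq_square)
    moreover have "?v \<bullet> u = (\<Sum>j\<in>F. (coord u j)\<^sup>2)" unfolding vv by (simp add: power2_eq_square)
    moreover have "(norm (?v - u))\<^sup>2 = ?v \<bullet> ?v - 2 * (?v \<bullet> u) + (norm u)\<^sup>2"
      by (simp add: power2_norm_eq_inner inner_diff_left inner_diff_right inner_commute)
    ultimately show ?thesis by simp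
  qed
  have "(sum (\<lambda>j. (coord u j)\<^sup>2) \<longlongrightarrow> (norm u)\<^sup>2) (finite_subsets_at_top UNIV)"
    unfolding norm_ell2_sq by (rule infsum_tendsto[OF coord_sq_summable])
  from tendsto_diff[OF tendsto_const[of "(norm u)\<^sup>2"] this]
  have "((\<lambda>F. (norm u)\<^sup>2 - (\<Sum>j\<in>F. (coord u j)\<^sup>2)) \<longlongrightarrow> 0) (finite_subsets_at_top UNIV)" by simp
  from tendsto_real_sqrt[OF this]
  have "((\<lambda>F. sqrt ((norm u)\<^sup>2 - (\<Sum>j\<in>F. (coord u j)\<^sup>2))) \<longlongrightarrow> 0) (finite_subsets_at_top UNIV)" by simp
  moreover have "\<forall>\<^sub>F F in finite_subsets_at_top UNIV. sqrt ((norm u)\<^sup>2 - (\<Sum>j\<in>F. (coord u j)\<^sup>2))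
      = norm ((\<Sum>j\<in>F. coord u j *\<^sub>R ebasis j) - u)"
    by (rule eventually_finite_subsets_at_top_weakI) (simp add: eq[symmetric])
  ultimately have "((\<lambda>F. norm ((\<Sum>j\<in>F. coord u j *\<^sub>R ebasis j) - u)) \<longlongrightarrow> 0) (finite_subsets_at_top UNIV)"
    by (rule Lim_transform_eventually)
  then have "((\<lambda>F. (\<Sum>j\<in>F. coord u j *\<^sub>R ebasis j) - u) \<longlongrightarrow> 0) (finite_subsets_at_top UNIV)"
    by (rule tendsto_norm_zero_cancel)
  then show "((\<lambda>F. \<Sum>j\<in>F. coord u j *\<^sub>R ebasis j) \<longlongrightarrow> u) (finite_subsets_at_top UNIV)"
    by (rule Lim_null[THEN iffD2])
qed

lemma abs_sum_mult_le_L2_set: "\<bar>\<Sum>k\<in>K. c k * x k\<bar> \<le> L2_set c K * L2_set x K"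
  by (rule order_trans[OF sum_abs])
     (use L2_set_mult_ineq[of c x K] in \<open>simp add: abs_mult\<close>)

lemma L2_set_le_iff:
  assumes "G \<ge> 0"
  shows "L2_set x K \<le> G \<longleftrightarrow> (\<Sum>k\<in>K. (x k)\<^sup>2) \<le> G\<^sup>2"
  unfolding L2_set_def using assms by (simp add: real_sqrt_le_iff' sum_nonneg)

text \<open>Converse of Cauchy-Schwarz, with \<open>c = x\<close> as the test. It reduces a block of
  entries to its scalar combinations, and the bound \<open>G\<close> does not see the size of
  \<open>K\<close>.\<close>

lemma L2_set_duality:
  assumes "\<And>c. \<bar>\<Sum>k\<in>K. c k * x k\<bar> \<le> L2_set c K * G" and "G \<ge> 0"
  shows "L2_set x K \<le> G"
proof (cases "L2_set x K = 0")
  case False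
  have pos: "L2_set x K > 0" using False L2_set_nonneg[of x K] by linarith
  have "L2_set x K * L2_set x K = (\<Sum>k\<in>K. x k * x k)"
    unfolding L2_set_def by (simp add: sum_nonneg power2_eq_square)
  also have "\<dots> \<le> L2_set x K * G" using assms(1)[of x] by simp
  finally show ?thesis using pos by simp
qed (use assms in simp)

lemma set_integrable_sum:
  fixes f :: "'k \<Rightarrow> real \<Rightarrow> real"
  assumes "\<And>k. k \<in> K \<Longrightarrow> set_integrable lborel S (f k)"
  shows "set_integrable lborel S (\<lambda>r. \<Sum>k\<in>K. f k r)"
  using assms unfolding set_integrable_def scaleR_sum_right
  by (rule Bochner_Integration.integrable_sum)

text \<open>Cauchy-Schwarz over \<open>J \<times> I\<close> at each \<open>r\<close> bounds the
  matrix-vector product by Hilbert-Schmidt norm times vector norm; integrating the product tested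
  against \<open>c\<close> bounds the vector of integrals. Only finite sums are interchanged with
  integrals; the infinite ones come from bounds uniform over finite sets.\<close>

lemma bilinear_integral_bound:
  fixes p :: "int \<Rightarrow> int \<Rightarrow> real \<Rightarrow> real" and q :: "int \<Rightarrow> real \<Rightarrow> real"
  assumes pm: "\<And>j i. (\<lambda>r. indicator S r * p j i r) \<in> borel_measurable borel"
    and qm: "\<And>i. (\<lambda>r. indicator S r * q i r) \<in> borel_measurable borel"
    and P: "\<And>J I r. finite J \<Longrightarrow> finite I \<Longrightarrow> r \<in> S \<Longrightarrow> L2_set (\<lambda>(j, i). p j i r) (J \<times> I) \<le> P r"
    and Q: "\<And>I r. finite I \<Longrightarrow> r \<in> S \<Longrightarrow> L2_set (\<lambda>i. q i r) I \<le> Q r"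
    and G: "set_integrable lborel S G" and PQ: "\<And>r. r \<in> S \<Longrightarrow> P r * Q r \<le> G r"
  shows "set_integrable lborel S (\<lambda>r. p j i r * q i r)"
    and "(\<lambda>i. LBINT r:S. p j i r * q i r) summable_on UNIV"
    and "\<exists>v. norm v \<le> (LBINT r:S. G r) \<and> (\<forall>j. coord v j = (\<Sum>\<^sub>\<infinity>i. LBINT r:S. p j i r * q i r))"
proof -
  define V where "V = (LBINT r:S. G r)"
  define x where "x j i = (LBINT r:S. p j i r * q i r)" for j i
  \<comment> \<open>With absolute values inside the sum one inequality serves three purposes:
    singletons give the integrable majorant, a single row gives absolute summability over
    \<open>i\<close>, and general \<open>c\<close> gives the norm of the result.\<close>
  have pointwise: "(\<Sum>j\<in>J. \<Sum>i\<in>I. \<bar>c j\<bar> * \<bar>p j i r * q i r\<bar>) \<le> L2_set c J * G r"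
    if "finite J" "finite I" "r \<in> S" for J I r c
  proof -
    have "(\<Sum>j\<in>J. \<Sum>i\<in>I. \<bar>c j\<bar> * \<bar>p j i r * q i r\<bar>)
      = (\<Sum>k\<in>J\<times>I. \<bar>case k of (j, i) \<Rightarrow> c j * q i r\<bar> * \<bar>case k of (j, i) \<Rightarrow> p j i r\<bar>)"
      by (simp add: sum.cartesian_product abs_mult mult_ac case_prod_unfold)
    also have "\<dots> \<le> L2_set (\<lambda>(j, i). c j * q i r) (J\<times>I) * L2_set (\<lambda>(j, i). p j i r) (J\<times>I)"
      by (rule L2_set_mult_ineq)
    also have "L2_set (\<lambda>(j, i). c j * q i r) (J\<times>I) = L2_set c J * L2_set (\<lambda>i. q i r) I"
    proof -
      have "(\<Sum>k\<in>J\<times>I. (case k of (j, i) \<Rightarrow> c j * q i r)\<^sup>2) = (\<Sum>j\<in>J. \<Sum>i\<in>I. (c j)\<^sup>2 * (q i r)\<^sup>2)"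
        by (simp add: sum.cartesian_product case_prod_unfold power_mult_distrib)
      then show ?thesis unfolding L2_set_def sum_product[symmetric] by (simp add: real_sqrt_mult)
    qed
    also have "L2_set c J * L2_set (\<lambda>i. q i r) I * L2_set (\<lambda>(j, i). p j i r) (J\<times>I)
      \<le> L2_set c J * Q r * P r"
      using that P[OF that] Q[OF that(2,3)]
      by (intro mult_mono mult_left_mono mult_nonneg_nonneg L2_set_nonneg
          order_trans[OF L2_set_nonneg Q[OF that(2,3)]])
    also have "\<dots> \<le> L2_set c J * G r"
      using mult_left_mono[OF PQ[OF that(3)] L2_set_nonneg[of c J]] by (simp add: mult_ac)
    finally show ?thesis .
  qed
  show int: "set_integrable lborel S (\<lambda>r. p j i r * q i r)" for j i
  proof (rule set_integrable_bounded_by[OF G])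
    have "(\<lambda>r. indicator S r * (p j i r * q i r))
        = (\<lambda>r. (indicator S r * p j i r) * (indicator S r * q i r))"
      by (auto simp: fun_eq_iff indicator_def)
    also have "\<dots> \<in> borel_measurable borel" using pm qm by measurable
    finally show "(\<lambda>r. indicator S r * (p j i r * q i r)) \<in> borel_measurable borel" .
    show "\<bar>p j i r * q i r\<bar> \<le> G r" if "r \<in> S" for r
      using pointwise[of "{j}" "{i}" r "\<lambda>_. 1"] that by (simp add: L2_set_def)
  qed
  have V0: "0 \<le> V"
  proof -
    have "0 \<le> G r" if "r \<in> S" for r
      using pointwise[of "{}" "{}" r "\<lambda>_. 1"] pointwise[of "{0}" "{0}" r "\<lambda>_. 1"] that
      by (auto simp: L2_set_def intro: order_trans[OF abs_ge_zero])
    then show ?thesis unfolding V_def set_lebesgue_integral_def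
      by (intro Bochner_Integration.integral_nonneg) (auto simp: indicator_def)
  qed
  have summ: "(\<Sum>i\<in>I. \<bar>x j i\<bar>) \<le> V" if "finite I" for I j
  proof -
    have "(\<Sum>i\<in>I. \<bar>x j i\<bar>) = (\<Sum>i\<in>I. sgn (x j i) * x j i)" by (simp add: abs_sgn mult.commute)
    also have "\<dots> = (LBINT r:S. (\<Sum>i\<in>I. sgn (x j i) * (p j i r * q i r)))"
      unfolding x_def by (subst set_integral_sum) (auto intro!: set_integrable_mult_right int)
    also have "\<dots> \<le> V"
      unfolding V_def
    proof (rule order_trans[OF abs_ge_self abs_set_integral_le[OF G]])
      fix r assume r: "r \<in> S"
      have "\<bar>\<Sum>i\<in>I. sgn (x j i) * (p j i r * q i r)\<bar> \<le> (\<Sum>i\<in>I. 1 * \<bar>p j i r * q i r\<bar>)"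
        by (intro order_trans[OF sum_abs] sum_mono) (auto simp: abs_mult sgn_if)
      also have "\<dots> \<le> G r"
        using pointwise[OF _ that r, of "{j}" "\<lambda>_. 1"] by (simp add: L2_set_def)
      finally show "\<bar>\<Sum>i\<in>I. sgn (x j i) * (p j i r * q i r)\<bar> \<le> G r" .
    qed
    finally show ?thesis .
  qed
  have summable: "x j summable_on UNIV" for j
    by (rule abs_summable_summable, rule nonneg_bdd_above_summable_on)
       (auto intro!: bdd_aboveI2[where M = V] summ)
  then show "(\<lambda>i. LBINT r:S. p j i r * q i r) summable_on UNIV" by (simp add: x_def[abs_def])
  have fin: "L2_set (\<lambda>j. \<Sum>i\<in>I. x j i) J \<le> V" if "finite J" "finite I" for J I
  proof (rule L2_set_duality[OF _ V0])
    fix c :: "int \<Rightarrow> real"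
    have "(\<Sum>j\<in>J. c j * (\<Sum>i\<in>I. x j i)) = (\<Sum>j\<in>J. LBINT r:S. (\<Sum>i\<in>I. c j * (p j i r * q i r)))"
      unfolding x_def sum_distrib_left
      by (subst set_integral_sum) (auto intro!: set_integrable_mult_right int)
    also have "\<dots> = (LBINT r:S. (\<Sum>j\<in>J. \<Sum>i\<in>I. c j * (p j i r * q i r)))"
      by (subst set_integral_sum)
         (auto intro!: set_integrable_mult_right int set_integrable_sum that)
    finally have eq: "(\<Sum>j\<in>J. c j * (\<Sum>i\<in>I. x j i)) = \<dots>" .
    have "\<bar>LBINT r:S. (\<Sum>j\<in>J. \<Sum>i\<in>I. c j * (p j i r * q i r))\<bar> \<le> (LBINT r:S. L2_set c J * G r)"
    proof (rule abs_set_integral_le)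
      fix r assume r: "r \<in> S"
      have "\<bar>\<Sum>j\<in>J. \<Sum>i\<in>I. c j * (p j i r * q i r)\<bar> \<le> (\<Sum>j\<in>J. \<Sum>i\<in>I. \<bar>c j\<bar> * \<bar>p j i r * q i r\<bar>)"
        by (intro order_trans[OF sum_abs] sum_mono) (auto simp: abs_mult)
      then show "\<bar>\<Sum>j\<in>J. \<Sum>i\<in>I. c j * (p j i r * q i r)\<bar> \<le> L2_set c J * G r"
        using pointwise[OF that r] by (rule order_trans)
    qed (intro set_integrable_mult_right G)
    then show "\<bar>\<Sum>j\<in>J. c j * (\<Sum>i\<in>I. x j i)\<bar> \<le> L2_set c J * V"
      unfolding eq by (simp add: V_def)
  qed
  \<comment> \<open>The limit over \<open>i\<close> is taken for a fixed finite set of rows, where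
    the sum of squares is continuous; the bound \<open>V\<close> does not depend on the
    rows.\<close>
  have lim: "(\<Sum>j\<in>J. (\<Sum>\<^sub>\<infinity>i. x j i)\<^sup>2) \<le> V\<^sup>2" if "finite J" for J
  proof (rule tendsto_upperbound)
    show "((\<lambda>I. \<Sum>j\<in>J. (\<Sum>i\<in>I. x j i)\<^sup>2) \<longlongrightarrow> (\<Sum>j\<in>J. (\<Sum>\<^sub>\<infinity>i. x j i)\<^sup>2)) (finite_subsets_at_top UNIV)"
      by (intro tendsto_intros infsum_tendsto summable)
    show "\<forall>\<^sub>F I in finite_subsets_at_top UNIV. (\<Sum>j\<in>J. (\<Sum>i\<in>I. x j i)\<^sup>2) \<le> V\<^sup>2"
      by (rule eventually_finite_subsets_at_top_weakI)
         (use fin[OF that] V0 in \<open>simp add: L2_set_le_iff\<close>)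
  qed simp
  let ?v = "Ell2 (\<lambda>j. \<Sum>\<^sub>\<infinity>i. x j i)"
  have c: "coord ?v = (\<lambda>j. \<Sum>\<^sub>\<infinity>i. x j i)" by (rule coord_Ell2[OF lim])
  then have "norm ?v \<le> V" by (intro norm_ell2_le V0) (simp add: lim)
  with c show "\<exists>v. norm v \<le> (LBINT r:S. G r) \<and> (\<forall>j. coord v j = (\<Sum>\<^sub>\<infinity>i. LBINT r:S. p j i r * q i r))"
    by (intro exI[of _ ?v]) (simp add: V_def x_def)
qed

text \<open>Hoelder continuity with values in the Hilbert-Schmidt operators, expressed by the matrix
  entries \<open>z j i\<close>: uniform bounds over finite blocks replace the operator norm. One
  constant covers size and seminorm, since the left-sided derivative needs both.\<close>

definition hs_hoelder :: "real \<Rightarrow> real \<Rightarrow> real \<Rightarrow> (int \<Rightarrow> int \<Rightarrow> real \<Rightarrow> real) \<Rightarrow> bool" where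
  "hs_hoelder \<beta> T A z \<longleftrightarrow> (\<forall>J I. finite J \<longrightarrow> finite I \<longrightarrow>
     (\<forall>r\<in>{0..T}. L2_set (\<lambda>(j, i). z j i r) (J \<times> I) \<le> A \<and>
       (\<forall>q\<in>{0..T}. L2_set (\<lambda>(j, i). z j i r - z j i q) (J \<times> I) \<le> A * \<bar>r - q\<bar> powr \<beta>)))"

lemma hs_hoelderD:
  assumes "hs_hoelder \<beta> T A z" "r \<in> {0..T}" "finite J" "finite I"
  shows "L2_set (\<lambda>(j, i). z j i r) (J \<times> I) \<le> A"
    and "q \<in> {0..T} \<Longrightarrow> L2_set (\<lambda>(j, i). z j i r - z j i q) (J \<times> I) \<le> A * \<bar>r - q\<bar> powr \<beta>"
  using assms unfolding hs_hoelder_def by auto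

lemma hs_hoelder_entry:
  assumes "hs_hoelder \<beta> T A z" "r \<in> {0..T}"
  shows "\<bar>z j i r\<bar> \<le> A" and "q \<in> {0..T} \<Longrightarrow> \<bar>z j i r - z j i q\<bar> \<le> A * \<bar>r - q\<bar> powr \<beta>"
  using hs_hoelderD[OF assms, of "{j}" "{i}"] by (simp_all add: L2_set_def)

lemma hoelder_continuous_on:
  fixes z :: "real \<Rightarrow> 'a::real_normed_vector"
  assumes "\<And>r q. r \<in> S \<Longrightarrow> q \<in> S \<Longrightarrow> norm (z r - z q) \<le> A * \<bar>r - q\<bar> powr \<beta>" and "\<beta> > 0"
  shows "continuous_on S z"
  unfolding continuous_on_def
proof
  fix r assume r: "r \<in> S"
  have "((\<lambda>q. A * \<bar>q - r\<bar> powr \<beta>) \<longlongrightarrow> A * \<bar>r - r\<bar> powr \<beta>) (at r within S)"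
    using assms(2) by (intro tendsto_intros) auto
  then have "((\<lambda>q. A * \<bar>q - r\<bar> powr \<beta>) \<longlongrightarrow> 0) (at r within S)" by simp
  then have "((\<lambda>q. z q - z r) \<longlongrightarrow> 0) (at r within S)"
    by (rule Lim_null_comparison[rotated]) (auto simp: eventually_at_filter intro!: assms(1) r always_eventually)
  then show "(z \<longlongrightarrow> z r) (at r within S)" by (rule Lim_null[THEN iffD2])
qed

lemma hs_hoelder_continuous_on:
  assumes "hs_hoelder \<beta> T A z" "\<beta> > 0"
  shows "continuous_on {0..T} (z j i)"
  using hs_hoelder_entry(2)[OF assms(1)] assms(2) by (intro hoelder_continuous_on[of _ _ A \<beta>]) auto

text \<open>A combination of the entries with coefficients \<open>c\<close> is a scalar function
  whose size and Hoelder constant are both controlled by \<open>A\<close> times the norm of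
  \<open>c\<close>. The scalar bound applies to it, and duality removes \<open>c\<close>. The bounds
  for the right-sided derivative below follow the same scheme.\<close>

lemma frac_deriv_left_L2_bound:
  assumes \<alpha>: "0 < \<alpha>" "\<alpha> < \<beta>" "\<beta> \<le> 1" and z: "hs_hoelder \<beta> T A z"
    and r: "r \<in> {0..T}" and fin: "finite J" "finite I"
  shows "L2_set (\<lambda>(j, i). frac_deriv_left \<alpha> 0 (z j i) r) (J \<times> I)
    \<le> c_left \<alpha> \<beta> * (1 + T) * A * r powr (- \<alpha>)"
proof (rule L2_set_duality)
  have G: "Gamma (1 - \<alpha>) > 0" using \<alpha> by (intro Gamma_real_pos) auto
  have A: "A \<ge> 0" using hs_hoelder_entry(1)[OF z r] abs_ge_zero order_trans by blast
  show "0 \<le> c_left \<alpha> \<beta> * (1 + T) * A * r powr (- \<alpha>)"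
    using \<alpha> r G A by (simp add: c_left_def)
  fix c :: "int \<times> int \<Rightarrow> real"
  let ?z = "\<lambda>k. case k of (j, i) \<Rightarrow> z j i" and ?K = "J \<times> I"
  have comb: "\<bar>\<Sum>k\<in>?K. c k * y k\<bar> \<le> L2_set c ?K * B" if "L2_set y ?K \<le> B" for y B
    using abs_sum_mult_le_L2_set mult_left_mono[OF that L2_set_nonneg[of c ?K]] by (rule order_trans)
  have cont: "continuous_on {0..r} (?z k)" for k
    using hs_hoelder_continuous_on[OF z, of "fst k" "snd k"] \<alpha> r
    by (auto simp: case_prod_unfold intro: continuous_on_subset)
  have "(\<Sum>k\<in>?K. c k * (case k of (j, i) \<Rightarrow> frac_deriv_left \<alpha> 0 (z j i) r))
      = frac_deriv_left \<alpha> 0 (\<lambda>q. \<Sum>k\<in>?K. c k * ?z k q) r"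
  proof (subst frac_deriv_left_sum[where \<beta> = \<beta> and A = "\<lambda>_. A"])
    fix k q assume "q \<in> {0..r}"
    then show "\<bar>?z k r - ?z k q\<bar> \<le> A * \<bar>r - q\<bar> powr \<beta>"
      using hs_hoelder_entry(2)[OF z r, of q "fst k" "snd k"] r by (simp add: case_prod_unfold)
  qed (use fin \<alpha> r cont in \<open>auto simp: case_prod_unfold\<close>)
  also have "\<bar>\<dots>\<bar> \<le> c_left \<alpha> \<beta> * (1 + T) * (L2_set c ?K * A) * r powr (- \<alpha>)"
  proof (rule frac_deriv_left_bound[OF \<alpha>])
    show "\<bar>\<Sum>k\<in>?K. c k * ?z k r\<bar> \<le> L2_set c ?K * A"
      by (rule comb) (use hs_hoelderD(1)[OF z r fin] in \<open>simp add: case_prod_unfold\<close>)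
    fix q assume "q \<in> {0..r}"
    then have q: "q \<in> {0..T}" using r by auto
    have "\<bar>\<Sum>k\<in>?K. c k * (?z k r - ?z k q)\<bar> \<le> L2_set c ?K * (A * \<bar>r - q\<bar> powr \<beta>)"
      by (rule comb) (use hs_hoelderD(2)[OF z r fin q] in \<open>simp add: case_prod_unfold\<close>)
    then show "\<bar>(\<Sum>k\<in>?K. c k * ?z k r) - (\<Sum>k\<in>?K. c k * ?z k q)\<bar> \<le> L2_set c ?K * A * \<bar>r - q\<bar> powr \<beta>"
      by (simp add: sum_subtractf right_diff_distrib mult.assoc)
  qed (use r \<alpha> in auto)
  finally show "\<bar>\<Sum>k\<in>?K. c k * (case k of (j, i) \<Rightarrow> frac_deriv_left \<alpha> 0 (z j i) r)\<bar>
    \<le> L2_set c ?K * (c_left \<alpha> \<beta> * (1 + T) * A * r powr (- \<alpha>))"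
    by (simp add: mult_ac)
qed

lemma L2_set_coord_le_norm: "finite I \<Longrightarrow> L2_set (coord u) I \<le> norm u"
  by (simp add: L2_set_le_iff sum_coord_sq_le_norm)

lemma abs_sum_coord_le: "finite I \<Longrightarrow> \<bar>\<Sum>i\<in>I. c i * coord u i\<bar> \<le> L2_set c I * norm u"
  using abs_sum_mult_le_L2_set mult_left_mono[OF L2_set_coord_le_norm L2_set_nonneg]
  by (rule order_trans)

lemma continuous_on_coord: "continuous_on S (\<lambda>u. coord u i)"
  unfolding inner_ebasis[symmetric] by (intro continuous_intros)

lemma continuous_on_coord_comp: "continuous_on S w \<Longrightarrow> continuous_on S (\<lambda>r. coord (w r) i)"
  by (rule continuous_on_compose2[OF continuous_on_coord, of _ w UNIV]) auto

lemma frac_deriv_right_L2_bound: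
  assumes \<alpha>: "0 < \<alpha>" "\<alpha> < 1" "1 - b < \<alpha>" and fin: "finite I"
    and cont: "continuous_on UNIV w"
    and w: "\<And>p q. p \<in> {0..T} \<Longrightarrow> q \<in> {0..T} \<Longrightarrow> norm (w p - w q) \<le> L * \<bar>p - q\<bar> powr b"
    and r: "0 \<le> r" "r \<le> t" "t \<le> T" and L: "L \<ge> 0"
  shows "L2_set (\<lambda>i. frac_deriv_right \<alpha> t (\<lambda>q. coord (w q) i) r) I
    \<le> c_right \<alpha> b * L * (t - r) powr (b + \<alpha> - 1)"
proof (rule L2_set_duality)
  have G: "Gamma \<alpha> > 0" using \<alpha> by (intro Gamma_real_pos) auto
  show "0 \<le> c_right \<alpha> b * L * (t - r) powr (b + \<alpha> - 1)"
    using \<alpha> G L by (simp add: c_right_def)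
  fix c :: "int \<Rightarrow> real"
  have entry: "\<bar>coord (w r) i - coord (w q) i\<bar> \<le> L * \<bar>r - q\<bar> powr b" if "q \<in> {r..t}" for q i
    using order_trans[OF abs_coord_le_norm w, of r q i] that r by simp
  have "(\<Sum>i\<in>I. c i * frac_deriv_right \<alpha> t (\<lambda>q. coord (w q) i) r)
      = frac_deriv_right \<alpha> t (\<lambda>q. \<Sum>i\<in>I. c i * coord (w q) i) r"
    using fin \<alpha> r entry
    by (intro frac_deriv_right_sum[where b = b and L = "\<lambda>_. L", symmetric])
       (auto intro!: continuous_on_coord_comp continuous_on_subset[OF cont])
  also have "\<bar>\<dots>\<bar> \<le> c_right \<alpha> b * (L2_set c I * L) * (t - r) powr (b + \<alpha> - 1)"
  proof (rule frac_deriv_right_bound[OF \<alpha> r(2)])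
    fix q assume q: "q \<in> {r..t}"
    have "\<bar>\<Sum>i\<in>I. c i * coord (w r - w q) i\<bar> \<le> L2_set c I * (L * \<bar>r - q\<bar> powr b)"
      by (rule order_trans[OF abs_sum_coord_le[OF fin] mult_left_mono[OF w L2_set_nonneg]])
         (use r q in auto)
    then show "\<bar>(\<Sum>i\<in>I. c i * coord (w r) i) - (\<Sum>i\<in>I. c i * coord (w q) i)\<bar> \<le> L2_set c I * L * \<bar>r - q\<bar> powr b"
      by (simp add: sum_subtractf right_diff_distrib mult.assoc)
  qed
  finally show "\<bar>\<Sum>i\<in>I. c i * frac_deriv_right \<alpha> t (\<lambda>q. coord (w q) i) r\<bar>
    \<le> L2_set c I * (c_right \<alpha> b * L * (t - r) powr (b + \<alpha> - 1))"
    by (simp add: mult_ac)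
qed

lemma frac_deriv_right_diff_L2_bound:
  assumes \<alpha>: "0 < \<alpha>" "\<alpha> < 1" "1 - b < \<alpha>" "0 < b" and fin: "finite I"
    and cont: "continuous_on UNIV w"
    and w: "\<And>p q. p \<in> {0..T} \<Longrightarrow> q \<in> {0..T} \<Longrightarrow> norm (w p - w q) \<le> L * \<bar>p - q\<bar> powr b"
    and r: "0 \<le> r" "r < s" "s \<le> t" "t \<le> T" and L: "L \<ge> 0"
  shows "L2_set (\<lambda>i. frac_deriv_right \<alpha> t (\<lambda>q. coord (w q) i) r
      - frac_deriv_right \<alpha> s (\<lambda>q. coord (w q) i) r) I
    \<le> L / Gamma \<alpha> * (t - s) powr b * (s - r) powr (\<alpha> - 1)"
proof (rule L2_set_duality)
  let ?R = "\<lambda>t i. frac_deriv_right \<alpha> t (\<lambda>q. coord (w q) i)"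
  have G: "Gamma \<alpha> > 0" using \<alpha> by (intro Gamma_real_pos) auto
  show "0 \<le> L / Gamma \<alpha> * (t - s) powr b * (s - r) powr (\<alpha> - 1)"
    using G L by (intro mult_nonneg_nonneg divide_nonneg_nonneg) auto
  fix c :: "int \<Rightarrow> real"
  have entry: "\<bar>coord (w r) i - coord (w q) i\<bar> \<le> L * \<bar>r - q\<bar> powr b" if "q \<in> {r..t}" for q i
    using order_trans[OF abs_coord_le_norm w, of r q i] that r by simp
  have eq: "(\<Sum>i\<in>I. c i * frac_deriv_right \<alpha> y (\<lambda>q. coord (w q) i) r)
      = frac_deriv_right \<alpha> y (\<lambda>q. \<Sum>i\<in>I. c i * coord (w q) i) r" if "r \<le> y" "y \<le> t" for y
    using fin \<alpha> r entry that
    by (intro frac_deriv_right_sum[where b = b and L = "\<lambda>_. L", symmetric])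
       (auto intro!: continuous_on_coord_comp continuous_on_subset[OF cont])
  have "(\<Sum>i\<in>I. c i * (?R t i r
      - ?R s i r))
      = frac_deriv_right \<alpha> t (\<lambda>q. \<Sum>i\<in>I. c i * coord (w q) i) r
      - frac_deriv_right \<alpha> s (\<lambda>q. \<Sum>i\<in>I. c i * coord (w q) i) r"
    using r by (simp add: eq[symmetric] right_diff_distrib sum_subtractf)
  also have "\<bar>\<dots>\<bar> \<le> (L2_set c I * L) / Gamma \<alpha> * (t - s) powr b * (s - r) powr (\<alpha> - 1)"
  proof (rule frac_deriv_right_diff_bound[OF \<alpha> r(2,3)])
    show "continuous_on {r..t} (\<lambda>q. \<Sum>i\<in>I. c i * coord (w q) i)"
      by (intro continuous_intros continuous_on_coord_comp continuous_on_subset[OF cont]) auto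
    fix p q assume pq: "p \<in> {r..t}" "q \<in> {r..t}"
    have "\<bar>\<Sum>i\<in>I. c i * coord (w p - w q) i\<bar> \<le> L2_set c I * (L * \<bar>p - q\<bar> powr b)"
      by (rule order_trans[OF abs_sum_coord_le[OF fin] mult_left_mono[OF w L2_set_nonneg]])
         (use r pq in auto)
    then show "\<bar>(\<Sum>i\<in>I. c i * coord (w p) i) - (\<Sum>i\<in>I. c i * coord (w q) i)\<bar> \<le> L2_set c I * L * \<bar>p - q\<bar> powr b"
      by (simp add: sum_subtractf right_diff_distrib mult.assoc)
  qed
  finally show "\<bar>\<Sum>i\<in>I. c i * (?R t i r
      - ?R s i r)\<bar>
    \<le> L2_set c I * (L / Gamma \<alpha> * (t - s) powr b * (s - r) powr (\<alpha> - 1))"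
    by (simp add: mult_ac)
qed

section \<open>The Young integral\<close>

text \<open>The pieces below are taken over half-open or open intervals: \<open>0 powr x\<close> is
  0, so comparisons of negative powers fail at a singular endpoint. Adding single points leads back
  to the closed intervals of the definition.\<close>

lemma set_integral_insert:
  fixes f :: "real \<Rightarrow> real"
  assumes "set_integrable lborel S f"
  shows "set_integrable lborel (insert x S) f" and "(LBINT r:insert x S. f r) = (LBINT r:S. f r)"
proof -
  have single: "has_bochner_integral lborel (\<lambda>r. indicator {x} r *\<^sub>R f r) 0"
  proof -
    have "has_bochner_integral lborel (\<lambda>r. indicator {x} r *\<^sub>R f x) (measure lborel {x} *\<^sub>R f x)"
      by (rule has_bochner_integral_indicator) auto
    then show ?thesis
      by (rule has_bochner_integral_cong[THEN iffD1, rotated -1]) (auto simp: indicator_def)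
  qed
  have "set_integrable lborel (insert x S) f \<and> (LBINT r:insert x S. f r) = (LBINT r:S. f r)"
  proof (cases "x \<in> S")
    case False
    have "has_bochner_integral lborel (\<lambda>r. indicator S r *\<^sub>R f r + indicator {x} r *\<^sub>R f r) ((LBINT r:S. f r) + 0)"
      using assms single unfolding set_integrable_def set_lebesgue_integral_def
      by (intro has_bochner_integral_add has_bochner_integral_integrable)
    moreover have "(\<lambda>r. indicator S r *\<^sub>R f r + indicator {x} r *\<^sub>R f r) = (\<lambda>r. indicator (insert x S) r *\<^sub>R f r)"
      using False by (auto simp: fun_eq_iff indicator_def)
    ultimately show ?thesis
      by (simp add: has_bochner_integral_iff set_integrable_def set_lebesgue_integral_def)
  qed (use assms in \<open>simp add: insert_absorb\<close>)
  then show "set_integrable lborel (insert x S) f" "(LBINT r:insert x S. f r) = (LBINT r:S. f r)" by auto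
qed

text \<open>A bound, divided by \<open>Gamma \<alpha>\<close>, for the Beta integral of
  \<open>r powr (- \<alpha>) * (s - r) powr (\<alpha> - 1)\<close> over \<open>{0..s}\<close>, split
  at the midpoint. By scaling it is free of \<open>s\<close>.\<close>

definition c_beta :: "real \<Rightarrow> real" where
  "c_beta \<alpha> = ((1 / 2) powr (\<alpha> - 1) / (1 - \<alpha>) + (1 / 2) powr (- \<alpha>) / \<alpha>) / Gamma \<alpha>"

text \<open>One constant for all pieces of an increment: \<open>c_right\<close> serves an integral
  up to the endpoint of its own right-sided derivative, \<open>c_beta\<close> a change of that
  endpoint.\<close>

definition young_const :: "real \<Rightarrow> real \<Rightarrow> real \<Rightarrow> real" where
  "young_const \<alpha> \<beta> b = c_left \<alpha> \<beta> * (c_right \<alpha> b / (1 - \<alpha>) + c_beta \<alpha>)"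

text \<open>\<open>\<alpha>\<close> is squeezed between \<open>1 - b\<close> and
  \<open>\<beta>\<close>: the lower bound controls the right-sided derivative of the path, the upper
  one the left-sided derivative of the integrand.\<close>

locale young_exponents =
  fixes \<alpha> \<beta> b :: real
  assumes exponents: "0 < \<alpha>" "\<alpha> < \<beta>" "\<beta> \<le> 1" "\<alpha> < 1" "1 - b < \<alpha>" "0 < b"
begin

lemma const_pos: "c_left \<alpha> \<beta> > 0" "c_right \<alpha> b > 0" "c_beta \<alpha> > 0"
proof -
  have "Gamma (1 - \<alpha>) > 0" "Gamma \<alpha> > 0" using exponents by (auto intro!: Gamma_real_pos)
  with exponents show "c_left \<alpha> \<beta> > 0" "c_right \<alpha> b > 0" "c_beta \<alpha> > 0"
    by (auto simp: c_left_def c_right_def c_beta_def intro!: divide_pos_pos add_pos_pos)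
qed

lemma hs_hoelder_nonneg:
  assumes "hs_hoelder \<beta> T A z" "T \<ge> 0"
  shows "A \<ge> 0"
  using order_trans[OF abs_ge_zero hs_hoelder_entry(1)[OF assms(1), of 0]] assms(2) by auto

lemma left_measurable:
  assumes "hs_hoelder \<beta> T A z" "S \<in> sets borel" "S \<subseteq> {0..T}"
  shows "(\<lambda>r. indicator S r * frac_deriv_left \<alpha> 0 (z j i) r) \<in> borel_measurable borel"
proof -
  have [measurable]: "(\<lambda>r. indicator {0..T} r * frac_deriv_left \<alpha> 0 (z j i) r) \<in> borel_measurable borel"
    using hs_hoelder_continuous_on[OF assms(1)] exponents by (intro frac_deriv_left_measurable) auto
  have "(\<lambda>r. indicator S r * frac_deriv_left \<alpha> 0 (z j i) r)
     = (\<lambda>r. indicator S r * (indicator {0..T} r * frac_deriv_left \<alpha> 0 (z j i) r))"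
    using assms(3) by (auto simp: fun_eq_iff indicator_def)
  also have "\<dots> \<in> borel_measurable borel" using assms(2) by measurable
  finally show ?thesis .
qed

lemma right_measurable:
  fixes w :: "real \<Rightarrow> ell2"
  assumes "continuous_on UNIV w"
  shows "frac_deriv_right \<alpha> t (\<lambda>q. coord (w q) i) \<in> borel_measurable borel"
  by (intro frac_deriv_right_measurable continuous_on_coord_comp assms)

context
  fixes z T A L and w :: "real \<Rightarrow> ell2"
  assumes z: "hs_hoelder \<beta> T A z" and cont: "continuous_on UNIV w" and L: "L \<ge> 0"
    and w: "\<forall>p\<in>{0..T}. \<forall>q\<in>{0..T}. norm (w p - w q) \<le> L * \<bar>p - q\<bar> powr b"
begin

text \<open>The left-sided derivative stays based at 0 although the piece starts at
  \<open>s\<close>. Since \<open>r - s \<le> r\<close>, its weight is at most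
  \<open>(r - s) powr (- \<alpha>)\<close>, whose integral combines with the weight
  \<open>(t - s) powr (b + \<alpha> - 1)\<close> to \<open>(t - s) powr b\<close>.\<close>

lemma young_piece:
  assumes st: "0 \<le> s" "s \<le> t" "t \<le> T"
  defines "x \<equiv> \<lambda>j i r. frac_deriv_left \<alpha> 0 (z j i) r * frac_deriv_right \<alpha> t (\<lambda>q. coord (w q) i) r"
  shows "set_integrable lborel {s<..t} (x j i)"
    and "(\<lambda>i. LBINT r:{s<..t}. x j i r) summable_on UNIV"
    and "\<exists>v. norm v \<le> c_left \<alpha> \<beta> * (c_right \<alpha> b / (1 - \<alpha>)) * (1 + T) * A * L * (t - s) powr b
          \<and> (\<forall>j. coord v j = (\<Sum>\<^sub>\<infinity>i. LBINT r:{s<..t}. x j i r))"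
proof -
  let ?D = "\<lambda>j i. frac_deriv_left \<alpha> 0 (z j i)" and ?R = "\<lambda>t i. frac_deriv_right \<alpha> t (\<lambda>q. coord (w q) i)"
  let ?S = "{s<..t}"
  define K where "K = c_left \<alpha> \<beta> * (1 + T) * A * (c_right \<alpha> b * L)"
  define G where "G r = K * (t - s) powr (b + \<alpha> - 1) * (r - s) powr (- \<alpha>)" for r
  have A: "A \<ge> 0" using hs_hoelder_nonneg[OF z] st by simp
  have K: "K \<ge> 0" unfolding K_def using A L st const_pos by simp
  have int': "set_integrable lborel {s..t} G"
    unfolding G_def using exponents st by (intro set_integrable_mult_right set_integral_powr_left) auto
  have int: "set_integrable lborel ?S G" by (rule set_integrable_subset[OF int']) auto
  have "insert s ?S = {s..t}" using st by auto
  with set_integral_insert(2)[OF int, of s] have "(LBINT r:?S. G r) = (LBINT r:{s..t}. G r)" by simp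
  also have "\<dots> = K * (t - s) powr (b + \<alpha> - 1) * ((t - s) powr (- \<alpha> + 1) / (- \<alpha> + 1))"
    unfolding G_def using set_integral_powr_left(2)[of "- \<alpha>" s t] exponents st by simp
  also have "\<dots> = K / (1 - \<alpha>) * ((t - s) powr (b + \<alpha> - 1) * (t - s) powr (- \<alpha> + 1))" by simp
  also have "\<dots> = K / (1 - \<alpha>) * (t - s) powr b" unfolding powr_add[symmetric] by simp
  finally have V: "(LBINT r:?S. G r) = c_left \<alpha> \<beta> * (c_right \<alpha> b / (1 - \<alpha>)) * (1 + T) * A * L * (t - s) powr b"
    by (simp add: K_def)
  have PQ: "(c_left \<alpha> \<beta> * (1 + T) * A * r powr (- \<alpha>)) * (c_right \<alpha> b * L * (t - r) powr (b + \<alpha> - 1)) \<le> G r"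
    if "r \<in> ?S" for r
  proof -
    have "r powr (- \<alpha>) * (t - r) powr (b + \<alpha> - 1) \<le> (r - s) powr (- \<alpha>) * (t - s) powr (b + \<alpha> - 1)"
      using that exponents st by (intro mult_mono powr_mono2' powr_mono2) auto
    from mult_left_mono[OF this K] show ?thesis by (simp add: K_def G_def mult_ac)
  qed
  note B = bilinear_integral_bound[OF _ _ _ _ int PQ,
      where p = "\<lambda>j i. ?D j i" and q = "\<lambda>i. ?R t i"]
  have 1: "(\<lambda>r. indicator ?S r * ?D j i r) \<in> borel_measurable borel" for j i
    using st by (intro left_measurable[OF z]) auto
  have 2: "(\<lambda>r. indicator ?S r * ?R t i r) \<in> borel_measurable borel" for i
    using right_measurable[OF cont, of t i] by measurable
  have 3: "L2_set (\<lambda>(j, i). ?D j i r) (J \<times> I) \<le> c_left \<alpha> \<beta> * (1 + T) * A * r powr (- \<alpha>)"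
    if "finite J" "finite I" "r \<in> ?S" for J I r
    using that st exponents by (intro frac_deriv_left_L2_bound[OF _ _ _ z]) auto
  have 4: "L2_set (\<lambda>i. ?R t i r) I \<le> c_right \<alpha> b * L * (t - r) powr (b + \<alpha> - 1)"
    if "finite I" "r \<in> ?S" for I r
    using that st exponents L by (intro frac_deriv_right_L2_bound[OF _ _ _ _ cont w[rule_format]]) auto
  show "set_integrable lborel {s<..t} (x j i)" unfolding x_def by (rule B(1)[OF 1 2 3 4])
  show "(\<lambda>i. LBINT r:{s<..t}. x j i r) summable_on UNIV" unfolding x_def by (rule B(2)[OF 1 2 3 4])
  show "\<exists>v. norm v \<le> c_left \<alpha> \<beta> * (c_right \<alpha> b / (1 - \<alpha>)) * (1 + T) * A * L * (t - s) powr b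
          \<and> (\<forall>j. coord v j = (\<Sum>\<^sub>\<infinity>i. LBINT r:{s<..t}. x j i r))"
    unfolding x_def V[symmetric] by (rule B(3)[OF 1 2 3 4])
qed

text \<open>The kernel is now \<open>r powr (- \<alpha>) * (s - r) powr (\<alpha> - 1)\<close>. Its
  integral over \<open>{0<..<s}\<close> is scale invariant, so no power of \<open>s\<close> appears
  next to \<open>(t - s) powr b\<close>.\<close>

lemma young_endpoint_change:
  assumes st: "0 \<le> s" "s \<le> t" "t \<le> T"
  defines "x \<equiv> \<lambda>j i r. frac_deriv_left \<alpha> 0 (z j i) r *
    (frac_deriv_right \<alpha> t (\<lambda>q. coord (w q) i) r - frac_deriv_right \<alpha> s (\<lambda>q. coord (w q) i) r)"
  shows "set_integrable lborel {0<..<s} (x j i)"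
    and "(\<lambda>i. LBINT r:{0<..<s}. x j i r) summable_on UNIV"
    and "\<exists>v. norm v \<le> c_left \<alpha> \<beta> * c_beta \<alpha> * (1 + T) * A * L * (t - s) powr b
          \<and> (\<forall>j. coord v j = (\<Sum>\<^sub>\<infinity>i. LBINT r:{0<..<s}. x j i r))"
proof -
  let ?D = "\<lambda>j i. frac_deriv_left \<alpha> 0 (z j i)" and ?R = "\<lambda>t i. frac_deriv_right \<alpha> t (\<lambda>q. coord (w q) i)"
  let ?S = "{0<..<s}"
  define K where "K = c_left \<alpha> \<beta> * (1 + T) * A * (L / Gamma \<alpha> * (t - s) powr b)"
  define G where "G r = K * ((s / 2) powr (\<alpha> - 1) * (r - 0) powr (- \<alpha>) + (s / 2) powr (- \<alpha>) * (s - r) powr (\<alpha> - 1))" for r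
  have Gam: "Gamma \<alpha> > 0" using exponents by (intro Gamma_real_pos) auto
  have A: "A \<ge> 0" using hs_hoelder_nonneg[OF z] st by simp
  have K: "K \<ge> 0" unfolding K_def using A L st const_pos Gam by simp
  have int': "set_integrable lborel {0..s} G"
    unfolding G_def using exponents st
    by (intro set_integrable_mult_right set_integral_add set_integral_powr_left set_integral_powr_right) auto
  have int: "set_integrable lborel ?S G" by (rule set_integrable_subset[OF int']) auto
  have int0: "set_integrable lborel (insert 0 ?S) G" by (rule set_integral_insert[OF int])
  have V: "(LBINT r:?S. G r) \<le> c_left \<alpha> \<beta> * c_beta \<alpha> * (1 + T) * A * L * (t - s) powr b"
  proof (cases "s = 0")
    case True
    then show ?thesis using A L st const_pos by (simp add: set_lebesgue_integral_def)
  next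
    case False
    then have s: "s > 0" using st by simp
    have "insert s (insert 0 ?S) = {0..s}" using s by auto
    with set_integral_insert(2)[OF int, of 0] set_integral_insert(2)[OF int0, of s]
    have "(LBINT r:?S. G r) = (LBINT r:{0..s}. G r)" by simp
    also have "\<dots> = K * ((s / 2) powr (\<alpha> - 1) * (s powr (1 - \<alpha>) / (1 - \<alpha>)) + (s / 2) powr (- \<alpha>) * (s powr \<alpha> / \<alpha>))"
      unfolding G_def using exponents s set_integral_powr_left(2)[of "- \<alpha>" 0 s] set_integral_powr_right(2)[of "\<alpha> - 1" 0 s]
        set_integral_powr_left(1)[of "- \<alpha>" 0 s] set_integral_powr_right(1)[of "\<alpha> - 1" 0 s]
      by (simp add: set_integral_add(2) set_integrable_mult_right)
    also have "(s / 2) powr (\<alpha> - 1) * (s powr (1 - \<alpha>) / (1 - \<alpha>)) = (1 / 2) powr (\<alpha> - 1) / (1 - \<alpha>) * (s powr (\<alpha> - 1) * s powr (1 - \<alpha>))"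
      using powr_mult[of s "1 / 2" "\<alpha> - 1"] s by simp
    also have "s powr (\<alpha> - 1) * s powr (1 - \<alpha>) = 1" unfolding powr_add[symmetric] using s by simp
    also have "(s / 2) powr (- \<alpha>) * (s powr \<alpha> / \<alpha>) = (1 / 2) powr (- \<alpha>) / \<alpha> * (s powr (- \<alpha>) * s powr \<alpha>)"
      using powr_mult[of s "1 / 2" "- \<alpha>"] s by simp
    also have "s powr (- \<alpha>) * s powr \<alpha> = 1" unfolding powr_add[symmetric] using s by simp
    finally show ?thesis by (simp add: K_def c_beta_def mult_ac)
  qed
  have PQ: "(c_left \<alpha> \<beta> * (1 + T) * A * r powr (- \<alpha>)) * (L / Gamma \<alpha> * (t - s) powr b * (s - r) powr (\<alpha> - 1)) \<le> G r"
    if r: "r \<in> ?S" for r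
  proof -
    have "r powr (- \<alpha>) * (s - r) powr (\<alpha> - 1)
      \<le> (s / 2) powr (\<alpha> - 1) * (r - 0) powr (- \<alpha>) + (s / 2) powr (- \<alpha>) * (s - r) powr (\<alpha> - 1)"
    \<comment> \<open>In each half only one factor is singular; the other one is frozen at
      \<open>s / 2\<close>.\<close>
    proof (cases "r \<le> s / 2")
      case True
      have "(s - r) powr (\<alpha> - 1) * r powr (- \<alpha>) \<le> (s / 2) powr (\<alpha> - 1) * (r - 0) powr (- \<alpha>)"
        using r True exponents by (intro mult_mono powr_mono2') auto
      then show ?thesis by (simp add: mult.commute add_increasing2)
    next
      case False
      have "r powr (- \<alpha>) * (s - r) powr (\<alpha> - 1) \<le> (s / 2) powr (- \<alpha>) * (s - r) powr (\<alpha> - 1)"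
        using r False exponents by (intro mult_right_mono powr_mono2') auto
      then show ?thesis by (simp add: add_increasing)
    qed
    from mult_left_mono[OF this K] show ?thesis by (simp add: K_def G_def mult_ac)
  qed
  let ?q = "\<lambda>i r. ?R t i r - ?R s i r"
  note B = bilinear_integral_bound[OF _ _ _ _ int PQ,
      where p = "\<lambda>j i. ?D j i" and q = ?q]
  have 1: "(\<lambda>r. indicator ?S r * ?D j i r) \<in> borel_measurable borel" for j i
    using st by (intro left_measurable[OF z]) auto
  have 2: "(\<lambda>r. indicator ?S r * ?q i r) \<in> borel_measurable borel" for i
    using right_measurable[OF cont, of t i] right_measurable[OF cont, of s i] by measurable
  have 3: "L2_set (\<lambda>(j, i). ?D j i r) (J \<times> I) \<le> c_left \<alpha> \<beta> * (1 + T) * A * r powr (- \<alpha>)"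
    if "finite J" "finite I" "r \<in> ?S" for J I r
    using that st exponents by (intro frac_deriv_left_L2_bound[OF _ _ _ z]) auto
  have 4: "L2_set (\<lambda>i. ?q i r) I \<le> L / Gamma \<alpha> * (t - s) powr b * (s - r) powr (\<alpha> - 1)"
    if "finite I" "r \<in> ?S" for I r
    using that st exponents L by (intro frac_deriv_right_diff_L2_bound[OF _ _ _ _ _ cont w[rule_format]]) auto
  show "set_integrable lborel ?S (x j i)" unfolding x_def by (rule B(1)[OF 1 2 3 4])
  show "(\<lambda>i. LBINT r:?S. x j i r) summable_on UNIV" unfolding x_def by (rule B(2)[OF 1 2 3 4])
  from B(3)[OF 1 2 3 4] obtain v where "norm v \<le> (LBINT r:?S. G r)"
    "\<And>j. coord v j = (\<Sum>\<^sub>\<infinity>i. LBINT r:?S. x j i r)" unfolding x_def by blast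
  then show "\<exists>v. norm v \<le> c_left \<alpha> \<beta> * c_beta \<alpha> * (1 + T) * A * L * (t - s) powr b
          \<and> (\<forall>j. coord v j = (\<Sum>\<^sub>\<infinity>i. LBINT r:?S. x j i r))"
    using V by (intro exI[of _ v]) auto
qed

end

text \<open>\<open>young_piece\<close> from 0 to \<open>t\<close> supplies a vector whose
  coordinates are the inner series, and the expansion in \<open>ebasis\<close> identifies the outer
  series with its negative. So the series in the definition have their true sums, not default
  values.\<close>

lemma young_integral_coord:
  assumes z: "hs_hoelder \<beta> t A (\<lambda>j i q. ebasis j \<bullet> Z q (ebasis i))" and cont: "continuous_on UNIV w"
    and L: "L \<ge> 0" and t: "t \<ge> 0"
    and w: "\<forall>p\<in>{0..t}. \<forall>q\<in>{0..t}. norm (w p - w q) \<le> L * \<bar>p - q\<bar> powr b"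
  shows "norm (young_integral \<alpha> Z w 0 t)
      \<le> c_left \<alpha> \<beta> * (c_right \<alpha> b / (1 - \<alpha>)) * (1 + t) * A * L * t powr b"
    and "coord (young_integral \<alpha> Z w 0 t) j = - (\<Sum>\<^sub>\<infinity>i. LBINT r:{0<..t}.
      frac_deriv_left \<alpha> 0 (\<lambda>q. ebasis j \<bullet> Z q (ebasis i)) r * frac_deriv_right \<alpha> t (\<lambda>q. coord (w q) i) r)"
proof -
  let ?x = "\<lambda>j i r. frac_deriv_left \<alpha> 0 (\<lambda>q. ebasis j \<bullet> Z q (ebasis i)) r * frac_deriv_right \<alpha> t (\<lambda>q. coord (w q) i) r"
  note Y = young_piece[OF z cont L w order_refl t order_refl]
  from Y(3) obtain v where v: "norm v \<le> c_left \<alpha> \<beta> * (c_right \<alpha> b / (1 - \<alpha>)) * (1 + t) * A * L * (t - 0) powr b"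
    "\<And>j. coord v j = (\<Sum>\<^sub>\<infinity>i. LBINT r:{0<..t}. ?x j i r)" by blast
  have ins: "insert 0 {0<..t} = {0..t}" using t by auto
  have "(LBINT r:{0..t}. ?x j i r) = (LBINT r:{0<..t}. ?x j i r)" for j i
    using set_integral_insert(2)[OF Y(1), of 0 j i] unfolding ins .
  then have eq: "young_integral \<alpha> Z w 0 t = (\<Sum>\<^sub>\<infinity>j. coord (- v) j *\<^sub>R ebasis j)"
    unfolding young_integral_def inner_ebasis[of _ "w _"] by (simp add: v(2))
  then have y: "young_integral \<alpha> Z w 0 t = - v" by (simp only: infsum_ebasis)
  with v show "norm (young_integral \<alpha> Z w 0 t)
      \<le> c_left \<alpha> \<beta> * (c_right \<alpha> b / (1 - \<alpha>)) * (1 + t) * A * L * t powr b" by simp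
  show "coord (young_integral \<alpha> Z w 0 t) j = - (\<Sum>\<^sub>\<infinity>i. LBINT r:{0<..t}. ?x j i r)"
    unfolding y by (simp add: v(2))
qed

lemma norm_young_integral_le:
  assumes "hs_hoelder \<beta> t A (\<lambda>j i q. ebasis j \<bullet> Z q (ebasis i))" "continuous_on UNIV w" "L \<ge> 0" "t \<ge> 0"
    and "\<forall>p\<in>{0..t}. \<forall>q\<in>{0..t}. norm (w p - w q) \<le> L * \<bar>p - q\<bar> powr b"
  shows "norm (young_integral \<alpha> Z w 0 t) \<le> young_const \<alpha> \<beta> b * (1 + t) * A * L * t powr b"
proof (rule order_trans[OF young_integral_coord(1)[OF assms]])
  have "c_left \<alpha> \<beta> * (c_right \<alpha> b / (1 - \<alpha>)) \<le> young_const \<alpha> \<beta> b"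
    using const_pos unfolding young_const_def by (intro mult_left_mono) auto
  then show "c_left \<alpha> \<beta> * (c_right \<alpha> b / (1 - \<alpha>)) * (1 + t) * A * L * t powr b
     \<le> young_const \<alpha> \<beta> b * (1 + t) * A * L * t powr b"
    using assms hs_hoelder_nonneg[OF assms(1)] by (intro mult_right_mono) auto
qed

text \<open>\<open>v1\<close> is the change of the right-sided derivative on \<open>{0..s}\<close>,
  \<open>v2\<close> the new piece, \<open>v3\<close> the change of the integrand on
  \<open>{0..s}\<close>. \<open>D\<close> is kept apart from \<open>A\<close> because in the
  application it is itself small in \<open>t - s\<close>.\<close>

lemma norm_young_integral_diff_le:
  assumes z: "hs_hoelder \<beta> t A (\<lambda>j i q. ebasis j \<bullet> Z q (ebasis i))"
    and z': "hs_hoelder \<beta> s A' (\<lambda>j i q. ebasis j \<bullet> Z' q (ebasis i))"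
    and d: "hs_hoelder \<beta> s D (\<lambda>j i q. ebasis j \<bullet> Z q (ebasis i) - ebasis j \<bullet> Z' q (ebasis i))"
    and cont: "continuous_on UNIV w" and L: "L \<ge> 0" and st: "0 \<le> s" "s \<le> t"
    and w: "\<forall>p\<in>{0..t}. \<forall>q\<in>{0..t}. norm (w p - w q) \<le> L * \<bar>p - q\<bar> powr b"
  shows "norm (young_integral \<alpha> Z w 0 t - young_integral \<alpha> Z' w 0 s)
    \<le> young_const \<alpha> \<beta> b * (1 + t) * L * (A * (t - s) powr b + D * s powr b)"
proof -
  let ?z = "\<lambda>j i q. ebasis j \<bullet> Z q (ebasis i)" and ?z' = "\<lambda>j i q. ebasis j \<bullet> Z' q (ebasis i)"
  let ?d = "\<lambda>j i q. ?z j i q - ?z' j i q"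
  let ?D = "\<lambda>z j i r. frac_deriv_left \<alpha> 0 (z j i) r"
  let ?R = "\<lambda>t i r. frac_deriv_right \<alpha> t (\<lambda>q. coord (w q) i) r"
  have t: "t \<ge> 0" using st by simp
  have ws: "\<forall>p\<in>{0..s}. \<forall>q\<in>{0..s}. norm (w p - w q) \<le> L * \<bar>p - q\<bar> powr b"
    using w st by auto
  have Y: "coord (young_integral \<alpha> Z w 0 t) j = - (\<Sum>\<^sub>\<infinity>i. LBINT r:{0<..t}. ?D ?z j i r * ?R t i r)" for j
    by (rule young_integral_coord(2)[OF z cont L t w])
  have Y': "coord (young_integral \<alpha> Z' w 0 s) j = - (\<Sum>\<^sub>\<infinity>i. LBINT r:{0<..s}. ?D ?z' j i r * ?R s i r)" for j
    by (rule young_integral_coord(2)[OF z' cont L st(1) ws])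
  note P0 = young_piece[OF z cont L w order_refl t order_refl]
  note P0' = young_piece[OF z' cont L ws order_refl st(1) order_refl]
  note P1 = young_endpoint_change[OF z cont L w st order_refl]
  note P2 = young_piece[OF z cont L w st order_refl]
  note P3 = young_piece[OF d cont L ws order_refl st(1) order_refl]
  let ?C1 = "c_left \<alpha> \<beta> * c_beta \<alpha>" and ?C2 = "c_left \<alpha> \<beta> * (c_right \<alpha> b / (1 - \<alpha>))"
  obtain v1 where v1: "norm v1 \<le> ?C1 * (1 + t) * A * L * (t - s) powr b"
      "\<And>j. coord v1 j = (\<Sum>\<^sub>\<infinity>i. LBINT r:{0<..<s}. ?D ?z j i r * (?R t i r - ?R s i r))" using P1(3) by blast
  obtain v2 where v2: "norm v2 \<le> ?C2 * (1 + t) * A * L * (t - s) powr b"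
      "\<And>j. coord v2 j = (\<Sum>\<^sub>\<infinity>i. LBINT r:{s<..t}. ?D ?z j i r * ?R t i r)" using P2(3) by blast
  obtain v3 where v3: "norm v3 \<le> ?C2 * (1 + s) * D * L * (s - 0) powr b"
      "\<And>j. coord v3 j = (\<Sum>\<^sub>\<infinity>i. LBINT r:{0<..s}. ?D ?d j i r * ?R s i r)" using P3(3) by blast
  \<comment> \<open>The difference is written as a sum over the two Booleans to reuse
    \<open>frac_deriv_left_sum\<close>, with separate Hoelder bounds for the two integrands.\<close>
  have lin: "?D ?d j i r = ?D ?z j i r - ?D ?z' j i r" if r: "r \<in> {0..s}" for j i r
  proof -
    have "frac_deriv_left \<alpha> 0 (\<lambda>q. \<Sum>k\<in>{True, False}. (if k then 1 else -1) * (if k then ?z j i q else ?z' j i q)) r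
      = (\<Sum>k\<in>{True, False}. (if k then 1 else -1) * frac_deriv_left \<alpha> 0 (\<lambda>q. if k then ?z j i q else ?z' j i q) r)"
    proof (rule frac_deriv_left_sum[where \<beta> = \<beta> and A = "\<lambda>k. if k then A else A'"])
      show "continuous_on {0..r} (\<lambda>q. if k then ?z j i q else ?z' j i q)" for k
        using hs_hoelder_continuous_on[OF z, of j i] hs_hoelder_continuous_on[OF z', of j i] r st exponents
        by (cases k) (auto elim!: continuous_on_subset)
      show "\<bar>(if k then ?z j i r else ?z' j i r) - (if k then ?z j i q else ?z' j i q)\<bar>
          \<le> (if k then A else A') * \<bar>r - q\<bar> powr \<beta>" if "q \<in> {0..r}" for k q
        using hs_hoelder_entry(2)[OF z, of r q j i] hs_hoelder_entry(2)[OF z', of r q j i] r st that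
        by (cases k) auto
    qed (use exponents r in auto)
    then show ?thesis by simp
  qed
  \<comment> \<open>On \<open>{0<..s}\<close> the derivatives satisfy
    \<open>D * R_t - D' * R_s = D * (R_t - R_s) + (D - D') * R_s\<close>; the rest of
    \<open>{0<..t}\<close> is the new piece.\<close>
  have split: "(LBINT r:{0<..t}. ?D ?z j i r * ?R t i r) - (LBINT r:{0<..s}. ?D ?z' j i r * ?R s i r)
     = (LBINT r:{0<..<s}. ?D ?z j i r * (?R t i r - ?R s i r)) + (LBINT r:{s<..t}. ?D ?z j i r * ?R t i r)
      + (LBINT r:{0<..s}. ?D ?d j i r * ?R s i r)" for j i
  proof (cases "s = 0")
    case False
    have ins: "insert s {0<..<s} = {0<..s}" using False st by auto
    have I1: "set_integrable lborel {0<..s} (\<lambda>r. ?D ?z j i r * (?R t i r - ?R s i r))"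
      "(LBINT r:{0<..<s}. ?D ?z j i r * (?R t i r - ?R s i r)) = (LBINT r:{0<..s}. ?D ?z j i r * (?R t i r - ?R s i r))"
      using set_integral_insert[OF P1(1), of s j i] unfolding ins by auto
    have It: "set_integrable lborel {0<..s} (\<lambda>r. ?D ?z j i r * ?R t i r)"
      by (rule set_integrable_subset[OF P0(1)]) (use st in auto)
    have "{0<..t} = {0<..s} \<union> {s<..t}" using st by auto
    then have "(LBINT r:{0<..t}. ?D ?z j i r * ?R t i r)
      = (LBINT r:{0<..s}. ?D ?z j i r * ?R t i r) + (LBINT r:{s<..t}. ?D ?z j i r * ?R t i r)"
      using It P2(1) by (simp add: set_integral_Un)
    moreover have "(LBINT r:{0<..s}. ?D ?d j i r * ?R s i r)
      = (LBINT r:{0<..s}. ?D ?z j i r * ?R t i r - ?D ?z j i r * (?R t i r - ?R s i r) - ?D ?z' j i r * ?R s i r)"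
      by (rule set_lebesgue_integral_cong) (auto simp: lin algebra_simps)
    moreover have "\<dots> = (LBINT r:{0<..s}. ?D ?z j i r * ?R t i r)
      - (LBINT r:{0<..s}. ?D ?z j i r * (?R t i r - ?R s i r)) - (LBINT r:{0<..s}. ?D ?z' j i r * ?R s i r)"
      using set_integral_diff(2)[OF set_integral_diff(1)[OF It I1(1)] P0'(1)[of j i]]
        set_integral_diff(2)[OF It I1(1)] by simp
    ultimately show ?thesis using I1(2) by simp
  qed (simp add: set_lebesgue_integral_def)
  have "young_integral \<alpha> Z w 0 t - young_integral \<alpha> Z' w 0 s = - (v1 + v2 + v3)"
  proof (rule ell2_eqI)
    fix j
    note S12 = summable_on_add[OF P1(2)[of j] P2(2)[of j]]
    have "(\<Sum>\<^sub>\<infinity>i. LBINT r:{0<..t}. ?D ?z j i r * ?R t i r)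
      = (\<Sum>\<^sub>\<infinity>i. (LBINT r:{0<..s}. ?D ?z' j i r * ?R s i r)
        + ((LBINT r:{0<..<s}. ?D ?z j i r * (?R t i r - ?R s i r)) + (LBINT r:{s<..t}. ?D ?z j i r * ?R t i r)
          + (LBINT r:{0<..s}. ?D ?d j i r * ?R s i r)))"
      by (rule infsum_cong) (simp add: split[symmetric])
    also have "\<dots> = (\<Sum>\<^sub>\<infinity>i. LBINT r:{0<..s}. ?D ?z' j i r * ?R s i r) + coord (v1 + v2 + v3) j"
      unfolding coord_simps v1(2) v2(2) v3(2)
      by (simp only: infsum_add[OF P0'(2) summable_on_add[OF S12 P3(2)]] infsum_add[OF S12 P3(2)]
          infsum_add[OF P1(2) P2(2)])
    finally show "coord (young_integral \<alpha> Z w 0 t - young_integral \<alpha> Z' w 0 s) j = coord (- (v1 + v2 + v3)) j"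
      unfolding coord_simps Y Y' by simp
  qed
  then have "norm (young_integral \<alpha> Z w 0 t - young_integral \<alpha> Z' w 0 s) \<le> norm v1 + norm v2 + norm v3"
    by (simp only: norm_minus_cancel) (metis add_mono norm_triangle_ineq norm_triangle_le order_refl)
  also have "\<dots> \<le> ?C1 * (1 + t) * A * L * (t - s) powr b + ?C2 * (1 + t) * A * L * (t - s) powr b
     + (?C1 + ?C2) * (1 + t) * D * L * s powr b"
  proof (intro add_mono v1(1) v2(1) order_trans[OF v3(1)])
    have "?C2 * (1 + s) \<le> (?C1 + ?C2) * (1 + t)"
      using const_pos st exponents by (intro mult_mono) auto
    then have "?C2 * (1 + s) * (D * L * s powr b) \<le> (?C1 + ?C2) * (1 + t) * (D * L * s powr b)"
      using hs_hoelder_nonneg[OF d st(1)] L by (intro mult_right_mono) auto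
    then show "?C2 * (1 + s) * D * L * (s - 0) powr b \<le> (?C1 + ?C2) * (1 + t) * D * L * s powr b"
      by (simp only: mult.assoc diff_zero)
  qed
  also have "\<dots> = young_const \<alpha> \<beta> b * (1 + t) * L * (A * (t - s) powr b + D * s powr b)"
  proof -
    have "k1 * (1 + t) * A * L * x + k2 * (1 + t) * A * L * x + (k1 + k2) * (1 + t) * D * L * y
        = (k2 + k1) * (1 + t) * L * (A * x + D * y)" for k1 k2 x y
      by (simp add: algebra_simps)
    then show ?thesis unfolding young_const_def distrib_left[of "c_left \<alpha> \<beta>"] .
  qed
  finally show ?thesis .
qed

end

section \<open>Decay estimates for mild solutions\<close>

lemma sum_sq_le_of_coord_le:
  assumes "\<And>i. \<bar>y i\<bar> \<le> c * \<bar>coord u i\<bar>" "finite F"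
  shows "(\<Sum>i\<in>F. (y i)\<^sup>2) \<le> (c * norm u)\<^sup>2"
proof -
  have "(\<Sum>i\<in>F. (y i)\<^sup>2) \<le> (\<Sum>i\<in>F. c\<^sup>2 * (coord u i)\<^sup>2)"
  proof (rule sum_mono)
    fix i
    have "\<bar>y i\<bar>\<^sup>2 \<le> (c * \<bar>coord u i\<bar>)\<^sup>2" by (rule power_mono[OF assms(1)]) simp
    then show "(y i)\<^sup>2 \<le> c\<^sup>2 * (coord u i)\<^sup>2" by (simp add: power_mult_distrib)
  qed
  also have "\<dots> \<le> (c * norm u)\<^sup>2"
    unfolding sum_distrib_left[symmetric] power_mult_distrib
    by (intro mult_left_mono sum_coord_sq_le_norm assms(2)) auto
  finally show ?thesis .
qed

lemma norm_ell2_mono: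
  assumes "\<And>i. \<bar>coord v i\<bar> \<le> c * \<bar>coord u i\<bar>" "c \<ge> 0"
  shows "norm v \<le> c * norm u"
  by (rule norm_ell2_le[OF sum_sq_le_of_coord_le[OF assms(1)]]) (use assms(2) in auto)

lemma coord_f_op:
  assumes "\<And>i. \<bar>k i (coord u i)\<bar> \<le> c * \<bar>coord u i\<bar>"
  shows "coord (f_op k u) i = k i (coord u i)"
  unfolding f_op_def by (subst coord_Ell2[OF sum_sq_le_of_coord_le[OF assms]]) auto

text \<open>On a basis vector the defining sequence has at most one nonzero entry, so
  \<open>Ell2\<close> is meaningful for every \<open>h\<close>; the Young integral sees the operator
  only through these columns.\<close>

lemma h_op_ebasis: "h_op h u (ebasis i) = h i (coord u i) *\<^sub>R ebasis i"
proof -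
  have "(\<lambda>k. h k (coord u k) * coord (ebasis i) k) = coord (h i (coord u i) *\<^sub>R ebasis i)"
    by (auto simp: fun_eq_iff ebasis.rep_eq)
  then show ?thesis unfolding h_op_def by (simp add: coord_inverse)
qed

text \<open>Summing the squares of a block column by column reduces Hilbert-Schmidt bounds to norms
  of images of basis vectors.\<close>

lemma L2_set_coord_family:
  assumes "finite J"
  shows "L2_set (\<lambda>(j, i). coord (y i) j) (J \<times> I) \<le> L2_set (\<lambda>i. norm (y i)) I"
proof -
  have "(\<Sum>k\<in>J \<times> I. (case k of (j, i) \<Rightarrow> coord (y i) j)\<^sup>2) = (\<Sum>i\<in>I. \<Sum>j\<in>J. (coord (y i) j)\<^sup>2)"
    by (subst sum.swap) (simp add: sum.cartesian_product case_prod_unfold)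
  also have "\<dots> \<le> (\<Sum>i\<in>I. (norm (y i))\<^sup>2)"
    by (intro sum_mono sum_coord_sq_le_norm assms)
  finally show ?thesis unfolding L2_set_def by (rule real_sqrt_le_mono)
qed

lemma L2_set_abs_coord_le: "finite I \<Longrightarrow> L2_set (\<lambda>i. \<bar>coord u i\<bar>) I \<le> norm u"
  using L2_set_coord_le_norm[of I u] by (simp add: L2_set_def)

lemma norm_ebasis [simp]: "norm (ebasis i) = 1"
  unfolding norm_eq_sqrt_inner inner_ebasis by (simp add: ebasis.rep_eq)

text \<open>The differentiability hypotheses are used in the form of these inequalities. As the
  derivatives vanish at 0, \<open>M * R\<close> is a Lipschitz constant on \<open>{- R..R}\<close>;
  for \<open>f\<close> the second derivative is bounded only near 0, hence
  \<open>R \<le> \<delta>\<close>. The exponent \<open>b\<close> is that of the paths, strictly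
  above \<open>\<beta>\<close>.\<close>

locale lattice_stability = young_exponents +
  fixes \<nu> lam \<mu> \<delta> D M :: real and f h :: "int \<Rightarrow> real \<Rightarrow> real"
  assumes params: "\<nu> > 0" "lam > 0" "0 < \<mu>" "\<mu> < lam" "\<beta> < b" "b \<le> 1" "\<delta> > 0" "D \<ge> 0" "M > 0"
    and zero: "f i 0 = 0" "h i 0 = 0"
    and f_lipschitz: "\<bar>f i x - f i y\<bar> \<le> D * \<bar>x - y\<bar>"
    and f_quadratic: "\<bar>x\<bar> \<le> R \<Longrightarrow> R \<le> \<delta> \<Longrightarrow> \<bar>f i x\<bar> \<le> M * R * \<bar>x\<bar>"
    and h_quadratic: "\<bar>x\<bar> \<le> R \<Longrightarrow> \<bar>y\<bar> \<le> R \<Longrightarrow> \<bar>h i x - h i y\<bar> \<le> M * R * \<bar>x - y\<bar>"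
begin

definition "\<Lambda> = 4 * \<nu> + lam"
definition "\<gamma> = min lam (2 * \<mu>)"
definition "\<theta> = (\<gamma> - \<mu>) / 2"

lemma rates: "\<Lambda> > 0" "\<mu> < \<gamma>" "\<gamma> \<le> lam" "\<gamma> \<le> 2 * \<mu>" "\<theta> > 0" "\<gamma> > 0" "\<gamma> = \<mu> + \<theta> + \<theta>" "\<beta> > 0"
  using params exponents by (auto simp: \<Lambda>_def \<gamma>_def \<theta>_def min_def)

abbreviation "S \<equiv> S_op \<nu> lam"

lemma S_bound: "t \<ge> 0 \<Longrightarrow> norm (S t y) \<le> exp (- lam * t) * norm y"
  using norm_S_op_le[of \<nu> lam t y] params by simp

lemma S_diff_bound: "0 \<le> s \<Longrightarrow> s \<le> t \<Longrightarrow> norm (S t y - S s y) \<le> \<Lambda> * (t - s) * exp (- lam * s) * norm y"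
  using norm_S_op_diff_le[of \<nu> lam s t y] params by (simp add: \<Lambda>_def)

lemma S_linear: "t \<ge> 0 \<Longrightarrow> linear (S t)"
  using linear_S_op[of \<nu> lam t] params by simp

lemma exp_rate_le: "0 \<le> r \<Longrightarrow> r \<le> t \<Longrightarrow> exp (- lam * (t - r)) * exp (- \<gamma> * r) \<le> exp (- \<gamma> * t)"
  using mult_right_mono[of \<gamma> lam "t - r"] rates by (simp add: exp_add[symmetric] algebra_simps)

lemma coord_f: "coord (f_op f u) i = f i (coord u i)"
  by (rule coord_f_op[of f u D]) (use f_lipschitz[of _ _ 0] zero in simp)

text \<open>\<open>f_op h u\<close> stands for the diagonal of the operator \<open>h_op h u\<close>.
  The Hilbert-Schmidt norm of a diagonal operator is the norm of its diagonal, so the estimates for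
  \<open>h\<close> become vector estimates like those for \<open>f\<close>.\<close>

lemma coord_h: "coord (f_op h u) i = h i (coord u i)"
  by (rule coord_f_op[of h u "M * norm u"])
     (use h_quadratic[of _ "norm u" 0] zero abs_coord_le_norm in simp)

lemma f_op_diff: "norm (f_op f u - f_op f v) \<le> D * norm (u - v)"
  using f_lipschitz params by (intro norm_ell2_mono) (auto simp: coord_f)

lemma f_op_bound: "norm (f_op f u) \<le> D * norm u"
  using f_lipschitz[of _ _ 0] zero params by (intro norm_ell2_mono) (auto simp: coord_f)

lemma f_op_quadratic:
  assumes "norm u \<le> R" "R \<le> \<delta>"
  shows "norm (f_op f u) \<le> M * R * norm u"
  using f_quadratic[OF order_trans[OF abs_coord_le_norm assms(1)] assms(2)] params
    order_trans[OF norm_ge_zero assms(1)]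
  by (intro norm_ell2_mono) (auto simp: coord_f)

lemma h_op_diff:
  assumes "norm u \<le> R" "norm v \<le> R"
  shows "norm (f_op h u - f_op h v) \<le> M * R * norm (u - v)"
  using h_quadratic[OF order_trans[OF abs_coord_le_norm assms(1)] order_trans[OF abs_coord_le_norm assms(2)]]
    params order_trans[OF norm_ge_zero assms(1)]
  by (intro norm_ell2_mono) (auto simp: coord_h)

lemma h_op_zero: "f_op h 0 = 0"
  by (rule ell2_eqI) (simp add: coord_h zero)

lemma h_op_quadratic:
  assumes "norm u \<le> R"
  shows "norm (f_op h u) \<le> M * R * norm u"
  using h_op_diff[OF assms, of 0] order_trans[OF norm_ge_zero assms] by (simp add: h_op_zero)

text \<open>An increment between \<open>q\<close> and \<open>r\<close> carries the weight of the
  earlier time, since it may be as large as the value at \<open>q\<close>.\<close>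

definition decaying :: "real \<Rightarrow> real \<Rightarrow> (real \<Rightarrow> ell2) \<Rightarrow> bool" where
  "decaying a T g \<longleftrightarrow> (\<forall>r\<in>{0..T}. norm (g r) \<le> a * exp (- \<gamma> * r) \<and>
     (\<forall>q\<in>{0..r}. norm (g r - g q) \<le> a * exp (- \<gamma> * q) * (r - q) powr \<beta>))"

lemma decayingD:
  assumes "decaying a T g"
  shows "0 \<le> r \<Longrightarrow> r \<le> T \<Longrightarrow> norm (g r) \<le> a * exp (- \<gamma> * r)"
    and "0 \<le> q \<Longrightarrow> q \<le> r \<Longrightarrow> r \<le> T \<Longrightarrow> norm (g r - g q) \<le> a * exp (- \<gamma> * q) * (r - q) powr \<beta>"
  using assms by (auto simp: decaying_def)

lemma decaying_mono: "decaying a T g \<Longrightarrow> t \<le> T \<Longrightarrow> decaying a t g"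
  by (auto simp: decaying_def)

text \<open>The 2 stands for the two sizes in an increment over more than unit time; in a shorter
  one the integrand costs 1, the semigroup \<open>\<Lambda>\<close>, and moving the weight from
  \<open>q\<close> to \<open>r\<close> costs \<open>exp \<gamma>\<close>.\<close>

definition "c_hs = 2 + (1 + \<Lambda>) * exp \<gamma>"

text \<open>Since \<open>\<gamma> \<le> lam\<close>, the decay of the integrand and of the semigroup combine to the
  factor \<open>exp (- \<gamma> * t)\<close>, uniformly over the whole interval of integration.\<close>

lemma hs_hoelder_semigroup:
  fixes E :: "ell2 \<Rightarrow> ell2"
  assumes g: "decaying a t g" and t: "t \<ge> 0" and E: "linear E" "\<And>y. norm (E y) \<le> \<epsilon> * norm y"
  shows "hs_hoelder \<beta> t (c_hs * a * exp (- \<gamma> * t) * \<epsilon>)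
    (\<lambda>j i r. coord (E (S (t - r) (coord (g r) i *\<^sub>R ebasis i))) j)"
proof -
  let ?y = "\<lambda>r i. E (S (t - r) (coord (g r) i *\<^sub>R ebasis i))"
  have a: "a \<ge> 0" using order_trans[OF norm_ge_zero decayingD(1)[OF g, of 0]] t by simp
  have eps: "\<epsilon> \<ge> 0" using order_trans[OF norm_ge_zero E(2)[of "ebasis 0"]] by simp
  have chs: "c_hs \<ge> 2" using rates by (simp add: c_hs_def)
  have size: "L2_set (\<lambda>(j, i). coord (?y r i) j) (J \<times> I) \<le> a * exp (- \<gamma> * t) * \<epsilon>"
    if "finite J" "finite I" "r \<in> {0..t}" for J I r
  proof -
    have "norm (?y r i) \<le> (\<epsilon> * exp (- lam * (t - r))) * \<bar>coord (g r) i\<bar>" for i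
      using order_trans[OF E(2) mult_left_mono[OF S_bound eps], of "t - r" "coord (g r) i *\<^sub>R ebasis i"] that
      by (simp add: mult_ac)
    then have "L2_set (\<lambda>i. norm (?y r i)) I \<le> L2_set (\<lambda>i. (\<epsilon> * exp (- lam * (t - r))) * \<bar>coord (g r) i\<bar>) I"
      by (intro L2_set_mono) auto
    also have "\<dots> = (\<epsilon> * exp (- lam * (t - r))) * L2_set (\<lambda>i. \<bar>coord (g r) i\<bar>) I"
      using eps by (simp add: L2_set_right_distrib)
    also have "\<dots> \<le> (\<epsilon> * exp (- lam * (t - r))) * (a * exp (- \<gamma> * r))"
      using eps that order_trans[OF L2_set_abs_coord_le[OF that(2)] decayingD(1)[OF g, of r]]
      by (intro mult_left_mono) auto
    also have "\<dots> = a * \<epsilon> * (exp (- lam * (t - r)) * exp (- \<gamma> * r))" by (simp add: mult_ac)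
    also have "\<dots> \<le> a * \<epsilon> * exp (- \<gamma> * t)"
      using exp_rate_le[of r t] that a eps by (intro mult_left_mono) auto
    finally show ?thesis
      using L2_set_coord_family[OF that(1), of "?y r" I] by (simp add: mult_ac)
  qed
  have incr: "L2_set (\<lambda>(j, i). coord (?y r i) j - coord (?y q i) j) (J \<times> I)
      \<le> c_hs * a * exp (- \<gamma> * t) * \<epsilon> * (r - q) powr \<beta>"
    if fin: "finite J" "finite I" and rq: "0 \<le> q" "q < r" "r \<le> t" for J I r q
  \<comment> \<open>Long increments need no smoothness because
    \<open>(r - q) powr \<beta> \<ge> 1\<close>; for short ones
    \<open>r - q \<le> (r - q) powr \<beta>\<close> lets the Lipschitz bound of the semigroup join
    the Hoelder bound of \<open>g\<close>.\<close>
  proof (cases "r - q \<le> 1")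
    case False
    have "L2_set (\<lambda>(j, i). coord (?y r i) j - coord (?y q i) j) (J \<times> I)
      \<le> L2_set (\<lambda>(j, i). coord (?y r i) j) (J \<times> I) + L2_set (\<lambda>(j, i). - coord (?y q i) j) (J \<times> I)"
      using L2_set_triangle_ineq[of "\<lambda>(j, i). coord (?y r i) j" "\<lambda>(j, i). - coord (?y q i) j" "J \<times> I"]
      by (simp add: case_prod_unfold)
    also have "L2_set (\<lambda>(j, i). - coord (?y q i) j) (J \<times> I) = L2_set (\<lambda>(j, i). coord (?y q i) j) (J \<times> I)"
      by (simp add: L2_set_def case_prod_unfold)
    also have "L2_set (\<lambda>(j, i). coord (?y r i) j) (J \<times> I) + \<dots> \<le> 2 * (a * exp (- \<gamma> * t) * \<epsilon>)"
      using size[OF fin, of r] size[OF fin, of q] rq by auto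
    also have "\<dots> \<le> c_hs * (a * exp (- \<gamma> * t) * \<epsilon>) * 1"
      using chs a eps by (simp add: mult_right_mono)
    also have "\<dots> \<le> c_hs * (a * exp (- \<gamma> * t) * \<epsilon>) * (r - q) powr \<beta>"
      using chs a eps False rates by (intro mult_left_mono ge_one_powr_ge_zero) auto
    finally show ?thesis by (simp add: mult_ac)
  next
    case True
    let ?e = "exp (- lam * (t - r))"
    have yi: "norm (?y r i - ?y q i)
      \<le> (\<epsilon> * ?e) * \<bar>coord (g r - g q) i\<bar> + (\<epsilon> * (\<Lambda> * (r - q) * ?e)) * \<bar>coord (g q) i\<bar>" for i
    proof -
      have lin: "linear (S (t - r))" using rq by (intro S_linear) auto
      have "S (t - r) (coord (g r) i *\<^sub>R ebasis i) - S (t - q) (coord (g q) i *\<^sub>R ebasis i)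
        = S (t - r) (coord (g r - g q) i *\<^sub>R ebasis i)
          - (S (t - q) (coord (g q) i *\<^sub>R ebasis i) - S (t - r) (coord (g q) i *\<^sub>R ebasis i))"
        by (simp add: linear_scale[OF lin] linear_diff[OF lin] algebra_simps)
      also have "norm \<dots> \<le> ?e * \<bar>coord (g r - g q) i\<bar> + \<Lambda> * (r - q) * ?e * \<bar>coord (g q) i\<bar>"
      proof (rule order_trans[OF norm_triangle_ineq4 add_mono])
        show "norm (S (t - r) (coord (g r - g q) i *\<^sub>R ebasis i)) \<le> ?e * \<bar>coord (g r - g q) i\<bar>"
          using S_bound[of "t - r" "coord (g r - g q) i *\<^sub>R ebasis i"] rq by simp
        show "norm (S (t - q) (coord (g q) i *\<^sub>R ebasis i) - S (t - r) (coord (g q) i *\<^sub>R ebasis i))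
           \<le> \<Lambda> * (r - q) * ?e * \<bar>coord (g q) i\<bar>"
          using S_diff_bound[of "t - r" "t - q" "coord (g q) i *\<^sub>R ebasis i"] rq by simp
      qed
      finally have "norm (E (S (t - r) (coord (g r) i *\<^sub>R ebasis i) - S (t - q) (coord (g q) i *\<^sub>R ebasis i)))
        \<le> \<epsilon> * (?e * \<bar>coord (g r - g q) i\<bar> + \<Lambda> * (r - q) * ?e * \<bar>coord (g q) i\<bar>)"
        by (rule order_trans[OF E(2) mult_left_mono[OF _ eps]])
      then show ?thesis
        by (simp only: linear_diff[OF E(1)] distrib_left mult.assoc)
    qed
    have "L2_set (\<lambda>i. norm (?y r i - ?y q i)) I
      \<le> L2_set (\<lambda>i. (\<epsilon> * ?e) * \<bar>coord (g r - g q) i\<bar> + (\<epsilon> * (\<Lambda> * (r - q) * ?e)) * \<bar>coord (g q) i\<bar>) I"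
      by (intro L2_set_mono yi) auto
    also have "\<dots> \<le> L2_set (\<lambda>i. (\<epsilon> * ?e) * \<bar>coord (g r - g q) i\<bar>) I
      + L2_set (\<lambda>i. (\<epsilon> * (\<Lambda> * (r - q) * ?e)) * \<bar>coord (g q) i\<bar>) I"
      by (rule L2_set_triangle_ineq)
    also have "\<dots> = (\<epsilon> * ?e) * L2_set (\<lambda>i. \<bar>coord (g r - g q) i\<bar>) I
      + (\<epsilon> * (\<Lambda> * (r - q) * ?e)) * L2_set (\<lambda>i. \<bar>coord (g q) i\<bar>) I"
      using eps rates rq by (simp add: L2_set_right_distrib)
    also have "\<dots> \<le> (\<epsilon> * ?e) * (a * exp (- \<gamma> * q) * (r - q) powr \<beta>)
      + (\<epsilon> * (\<Lambda> * (r - q) powr \<beta> * ?e)) * (a * exp (- \<gamma> * q))"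
    proof (intro add_mono mult_mono)
      show "L2_set (\<lambda>i. \<bar>coord (g r - g q) i\<bar>) I \<le> a * exp (- \<gamma> * q) * (r - q) powr \<beta>"
        using order_trans[OF L2_set_abs_coord_le[OF fin(2)] decayingD(2)[OF g, of q r]] rq by auto
      show "L2_set (\<lambda>i. \<bar>coord (g q) i\<bar>) I \<le> a * exp (- \<gamma> * q)"
        using order_trans[OF L2_set_abs_coord_le[OF fin(2)] decayingD(1)[OF g, of q]] rq by auto
      show "r - q \<le> (r - q) powr \<beta>"
        using powr_mono'[of \<beta> 1 "r - q"] exponents rq True by simp
    qed (use eps rates rq a in auto)
    also have "\<dots> = (1 + \<Lambda>) * a * \<epsilon> * (r - q) powr \<beta> * (?e * exp (- \<gamma> * q))"
      by (simp add: algebra_simps)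
    also have "\<dots> \<le> (1 + \<Lambda>) * a * \<epsilon> * (r - q) powr \<beta> * (exp \<gamma> * exp (- \<gamma> * t))"
    proof (rule mult_left_mono)
      have "?e * exp (- \<gamma> * q) = exp (\<gamma> * (r - q)) * (?e * exp (- \<gamma> * r))"
        by (simp add: exp_add[symmetric] algebra_simps)
      also have "\<dots> \<le> exp \<gamma> * exp (- \<gamma> * t)"
        using rates True rq mult_left_mono[OF True, of \<gamma>] by (intro mult_mono exp_rate_le) auto
      finally show "?e * exp (- \<gamma> * q) \<le> exp \<gamma> * exp (- \<gamma> * t)" .
    qed (use rates a eps in auto)
    also have "\<dots> \<le> c_hs * a * exp (- \<gamma> * t) * \<epsilon> * (r - q) powr \<beta>"
      using a eps by (simp add: c_hs_def algebra_simps)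
    finally show ?thesis
      using L2_set_coord_family[OF fin(1), of "\<lambda>i. ?y r i - ?y q i" I] by simp
  qed
  show ?thesis
    unfolding hs_hoelder_def
  proof (intro allI impI ballI conjI)
    fix J I :: "int set" and r assume fin: "finite J" "finite I" and r: "r \<in> {0..t}"
    have "a * exp (- \<gamma> * t) * \<epsilon> \<le> c_hs * (a * exp (- \<gamma> * t) * \<epsilon>)"
      using chs a eps mult_right_mono[of 1 c_hs "a * exp (- \<gamma> * t) * \<epsilon>"] by simp
    with size[OF fin r] show "L2_set (\<lambda>(j, i). coord (?y r i) j) (J \<times> I) \<le> c_hs * a * exp (- \<gamma> * t) * \<epsilon>"
      by (simp add: mult_ac)
    fix q assume q: "q \<in> {0..t}"
    consider "q < r" | "q = r" | "r < q" by linarith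
    then show "L2_set (\<lambda>(j, i). coord (?y r i) j - coord (?y q i) j) (J \<times> I)
      \<le> c_hs * a * exp (- \<gamma> * t) * \<epsilon> * \<bar>r - q\<bar> powr \<beta>"
    proof cases
      case 1
      then show ?thesis using incr[OF fin, of q r] q r by simp
    next
      case 2
      then show ?thesis by (simp add: L2_set_def case_prod_unfold)
    next
      case 3
      then show ?thesis using incr[OF fin, of r q] q r
        by (simp add: L2_set_def case_prod_unfold power2_commute)
    qed
  qed
qed

section \<open>The drift integral\<close>

definition drift :: "(real \<Rightarrow> ell2) \<Rightarrow> real \<Rightarrow> ell2" where
  "drift F t = integral {0..t} (\<lambda>r. S (t - r) (F r))"

text \<open>Contractivity of the semigroup takes care of the change of \<open>F\<close>, continuity
  in time at the fixed vector \<open>F r\<close> of the rest.\<close>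

lemma continuous_on_S_comp:
  assumes F: "continuous_on {0..T} F"
  shows "continuous_on {0..T} (\<lambda>r. S (T - r) (F r))"
  unfolding continuous_on_def
proof
  fix r assume r: "r \<in> {0..T}"
  have "((\<lambda>q. norm (F q - F r) + norm (S (T - q) (F r) - S (T - r) (F r))) \<longlongrightarrow>
     norm (F r - F r) + norm (S (T - r) (F r) - S (T - r) (F r))) (at r within {0..T})"
  proof (intro tendsto_intros)
    show "(F \<longlongrightarrow> F r) (at r within {0..T})" using F r by (simp add: continuous_on_def)
    have "isCont (\<lambda>t. S t (F r)) (T - r)"
      using has_vector_derivative_continuous[OF S_op_has_vector_derivative] params by simp
    then show "((\<lambda>q. S (T - q) (F r)) \<longlongrightarrow> S (T - r) (F r)) (at r within {0..T})"
      by (rule isCont_tendsto_compose) (intro tendsto_intros)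
  qed
  then have lim: "((\<lambda>q. norm (F q - F r) + norm (S (T - q) (F r) - S (T - r) (F r))) \<longlongrightarrow> 0) (at r within {0..T})"
    by simp
  have "norm (S (T - q) (F q) - S (T - r) (F r)) \<le> norm (F q - F r) + norm (S (T - q) (F r) - S (T - r) (F r))"
    if q: "q \<in> {0..T}" for q
  proof -
    have "S (T - q) (F q) - S (T - r) (F r) = S (T - q) (F q - F r) + (S (T - q) (F r) - S (T - r) (F r))"
      using linear_diff[OF S_linear[of "T - q"]] q by simp
    also have "norm \<dots> \<le> norm (S (T - q) (F q - F r)) + norm (S (T - q) (F r) - S (T - r) (F r))"
      by (rule norm_triangle_ineq)
    also have "norm (S (T - q) (F q - F r)) \<le> norm (F q - F r)"
    proof (rule order_trans[OF S_bound])
      have "exp (- lam * (T - q)) * norm (F q - F r) \<le> 1 * norm (F q - F r)"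
        using q params by (intro mult_right_mono) auto
      then show "exp (- lam * (T - q)) * norm (F q - F r) \<le> norm (F q - F r)" by simp
    qed (use q in auto)
    finally show ?thesis by simp
  qed
  then have "((\<lambda>q. S (T - q) (F q) - S (T - r) (F r)) \<longlongrightarrow> 0) (at r within {0..T})"
    by (intro Lim_null_comparison[OF _ lim]) (auto simp: eventually_at_filter)
  then show "((\<lambda>q. S (T - q) (F q)) \<longlongrightarrow> S (T - r) (F r)) (at r within {0..T})"
    by (rule Lim_null[THEN iffD2])
qed

text \<open>By \<open>exp_rate_le\<close> the integrand is of size
  \<open>a * exp (- \<gamma> * t)\<close> throughout. In the increment the old interval
  \<open>{0..s}\<close> yields the factor \<open>s * \<Lambda>\<close> and the new piece yields the
  1.\<close>

lemma drift_bounds: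
  assumes F: "continuous_on {0..t} F" and Fb: "\<And>r. 0 \<le> r \<Longrightarrow> r \<le> t \<Longrightarrow> norm (F r) \<le> a * exp (- \<gamma> * r)"
    and st: "0 \<le> s" "s \<le> t"
  shows "norm (drift F t) \<le> t * a * exp (- \<gamma> * t)"
    and "norm (drift F t - drift F s) \<le> (1 + s * \<Lambda>) * (t - s) * a * exp (- \<gamma> * s)"
proof -
  have a: "a \<ge> 0" using order_trans[OF norm_ge_zero Fb[of 0]] st by simp
  have Fs: "continuous_on {0..s} F" using continuous_on_subset[OF F, of "{0..s}"] st by auto
  have SF: "norm (S (y - r) (F r)) \<le> a * exp (- \<gamma> * y)" if "0 \<le> r" "r \<le> y" "y \<le> t" for r y
  proof -
    have "norm (S (y - r) (F r)) \<le> exp (- lam * (y - r)) * (a * exp (- \<gamma> * r))"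
      using that by (intro order_trans[OF S_bound] mult_left_mono Fb) auto
    also have "\<dots> = a * (exp (- lam * (y - r)) * exp (- \<gamma> * r))" by simp
    also have "\<dots> \<le> a * exp (- \<gamma> * y)" using that a by (intro mult_left_mono exp_rate_le) auto
    finally show ?thesis .
  qed
  show "norm (drift F t) \<le> t * a * exp (- \<gamma> * t)"
  proof -
    have "norm (integral {0..t} (\<lambda>r. S (t - r) (F r))) \<le> a * exp (- \<gamma> * t) * (t - 0)"
      by (rule integral_bound[OF _ continuous_on_S_comp[OF F]]) (use st SF[of _ t] in auto)
    then show ?thesis by (simp add: drift_def mult_ac)
  qed
  have ct: "continuous_on {0..t} (\<lambda>r. S (t - r) (F r))" by (rule continuous_on_S_comp[OF F])
  have ct0: "continuous_on {0..s} (\<lambda>r. S (t - r) (F r))" and ct1: "continuous_on {s..t} (\<lambda>r. S (t - r) (F r))"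
    using st by (auto intro: continuous_on_subset[OF ct])
  have cs: "continuous_on {0..s} (\<lambda>r. S (s - r) (F r))" by (rule continuous_on_S_comp[OF Fs])
  have "drift F t - drift F s = integral {0..s} (\<lambda>r. S (t - r) (F r)) + integral {s..t} (\<lambda>r. S (t - r) (F r))
     - integral {0..s} (\<lambda>r. S (s - r) (F r))"
    using Henstock_Kurzweil_Integration.integral_combine[OF st integrable_continuous_real[OF ct]]
    by (simp add: drift_def)
  also have "\<dots> = integral {0..s} (\<lambda>r. S (t - r) (F r) - S (s - r) (F r)) + integral {s..t} (\<lambda>r. S (t - r) (F r))"
    by (subst Henstock_Kurzweil_Integration.integral_diff)
       (auto intro!: integrable_continuous_real ct0 cs)
  also have "norm \<dots> \<le> \<Lambda> * (t - s) * (a * exp (- \<gamma> * s)) * (s - 0) + a * exp (- \<gamma> * s) * (t - s)"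
  proof (rule order_trans[OF norm_triangle_ineq add_mono])
    show "norm (integral {0..s} (\<lambda>r. S (t - r) (F r) - S (s - r) (F r)))
        \<le> \<Lambda> * (t - s) * (a * exp (- \<gamma> * s)) * (s - 0)"
    proof (rule integral_bound[OF st(1) continuous_on_diff[OF ct0 cs]])
      fix r assume r: "r \<in> {0..s}"
      have "norm (S (t - r) (F r) - S (s - r) (F r)) \<le> \<Lambda> * ((t - r) - (s - r)) * exp (- lam * (s - r)) * norm (F r)"
        using r st by (intro S_diff_bound) auto
      also have "\<dots> \<le> \<Lambda> * ((t - r) - (s - r)) * exp (- lam * (s - r)) * (a * exp (- \<gamma> * r))"
        using r st rates by (intro mult_left_mono Fb) auto
      also have "\<dots> = \<Lambda> * (t - s) * a * (exp (- lam * (s - r)) * exp (- \<gamma> * r))" by simp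
      also have "\<dots> \<le> \<Lambda> * (t - s) * a * exp (- \<gamma> * s)"
        using r st a rates by (intro mult_left_mono exp_rate_le) auto
      finally show "norm (S (t - r) (F r) - S (s - r) (F r)) \<le> \<Lambda> * (t - s) * (a * exp (- \<gamma> * s))"
        by (simp add: mult_ac)
    qed
    show "norm (integral {s..t} (\<lambda>r. S (t - r) (F r))) \<le> a * exp (- \<gamma> * s) * (t - s)"
    proof (rule integral_bound[OF st(2) ct1])
      fix r assume "r \<in> {s..t}"
      then have "norm (S (t - r) (F r)) \<le> a * exp (- \<gamma> * t)" using st by (intro SF) auto
      also have "\<dots> \<le> a * exp (- \<gamma> * s)" using a st rates by (intro mult_left_mono) auto
      finally show "norm (S (t - r) (F r)) \<le> a * exp (- \<gamma> * s)" .
    qed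
  qed
  finally show "norm (drift F t - drift F s) \<le> (1 + s * \<Lambda>) * (t - s) * a * exp (- \<gamma> * s)"
    by (simp add: algebra_simps)
qed

end

lemma power_le_exp:
  fixes \<theta> :: real
  assumes "\<theta> > 0"
  shows "\<exists>P>0. \<forall>t\<ge>0. (1 + t) ^ p \<le> P * exp (\<theta> * t)"
proof -
  \<comment> \<open>\<open>m * (1 + t) \<le> exp (m * t)\<close> holds as soon as
    \<open>m \<le> 1\<close>; the power \<open>p\<close> then produces the rate
    \<open>p * m\<close>, which has to stay below \<open>\<theta>\<close>. The 1 in the denominator
    covers \<open>p = 0\<close>.\<close>
  define m where "m = min (\<theta> / (real p + 1)) 1"
  have m: "0 < m" "m \<le> 1" using assms by (auto simp: m_def)
  have "real p * m \<le> real p * (\<theta> / (real p + 1))" by (intro mult_left_mono) (auto simp: m_def)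
  also have "\<dots> \<le> \<theta>" using assms by (simp add: field_simps)
  finally have mp: "real p * m \<le> \<theta>" .
  have "(1 + t) ^ p \<le> 1 / m ^ p * exp (\<theta> * t)" if t: "t \<ge> 0" for t
  proof -
    have "m * (1 + t) \<le> exp (m * t)"
      using exp_ge_add_one_self[of "m * t"] m unfolding distrib_left by linarith
    then have "(m * (1 + t)) ^ p \<le> exp (m * t) ^ p" using m t by (intro power_mono) auto
    also have "\<dots> = exp (real p * m * t)" by (simp add: exp_of_nat_mult[symmetric] mult_ac)
    also have "\<dots> \<le> exp (\<theta> * t)" using mp t by (simp add: mult_right_mono)
    finally have "m ^ p * (1 + t) ^ p \<le> exp (\<theta> * t)" unfolding power_mult_distrib .
    then show ?thesis using m by (simp add: pos_le_divide_eq mult.commute)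
  qed
  then show ?thesis using m by (intro exI[of _ "1 / m ^ p"]) auto
qed

context lattice_stability
begin

text \<open>With the growth rate fixed to \<open>\<theta>\<close>, the product with
  \<open>exp (- \<gamma> * T)\<close> still decays faster than \<open>exp (- \<mu> * T)\<close>, and
  \<open>\<kappa>\<close> is the only dependence on the path that remains.\<close>

definition tempered :: "real \<Rightarrow> (real \<Rightarrow> ell2) \<Rightarrow> bool" where
  "tempered \<kappa> w \<longleftrightarrow> continuous_on UNIV w \<and>
     (\<forall>T\<ge>0. \<forall>p\<in>{0..T}. \<forall>q\<in>{0..T}. norm (w p - w q) \<le> \<kappa> * exp (\<theta> * T) * \<bar>p - q\<bar> powr b)"

abbreviation "solution w x u \<equiv> mild_solution \<alpha> \<beta> \<nu> lam f h w x u"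

abbreviation "conv u t \<equiv> (\<lambda>r v. S (t - r) (h_op h (u r) v))"

lemma conv_entries:
  "(\<lambda>j i q. ebasis j \<bullet> conv u t q (ebasis i))
    = (\<lambda>j i q. coord (S (t - q) (coord (f_op h (u q)) i *\<^sub>R ebasis i)) j)"
  by (simp add: inner_ebasis h_op_ebasis coord_h)

lemma young_bounds:
  assumes g: "decaying a t (\<lambda>r. f_op h (u r))" and w: "tempered \<kappa> w" and st: "0 \<le> s" "s \<le> t"
  defines "Y \<equiv> young_const \<alpha> \<beta> b"
  shows "norm (young_integral \<alpha> (conv u t) w 0 t)
      \<le> Y * (1 + t) * (c_hs * a * exp (- \<gamma> * t)) * (\<kappa> * exp (\<theta> * t)) * t powr b"
    and "norm (young_integral \<alpha> (conv u t) w 0 t - young_integral \<alpha> (conv u s) w 0 s)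
      \<le> Y * (1 + t) * (\<kappa> * exp (\<theta> * t)) *
        (c_hs * a * exp (- \<gamma> * t) * (t - s) powr b + c_hs * a * exp (- \<gamma> * s) * (\<Lambda> * (t - s)) * s powr b)"
proof -
  have t: "t \<ge> 0" using st by simp
  have cont: "continuous_on UNIV w" and
    wb: "\<forall>p\<in>{0..t}. \<forall>q\<in>{0..t}. norm (w p - w q) \<le> \<kappa> * exp (\<theta> * t) * \<bar>p - q\<bar> powr b"
    using w t unfolding tempered_def by blast+
  \<comment> \<open>\<open>tempered\<close> does not fix the sign of \<open>\<kappa>\<close>; it is
    read off from the increment between 0 and 1.\<close>
  have "\<forall>p\<in>{0..1}. \<forall>q\<in>{0..1}. norm (w p - w q) \<le> \<kappa> * exp (\<theta> * 1) * \<bar>p - q\<bar> powr b"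
    using w zero_le_one unfolding tempered_def by blast
  from this[rule_format, of 0 1] have "norm (w 0 - w 1) \<le> \<kappa> * exp \<theta>" by simp
  then have "0 \<le> \<kappa> * exp \<theta>" using order_trans[OF norm_ge_zero] by fastforce
  then have k: "0 \<le> \<kappa> * exp (\<theta> * t)" by (simp add: zero_le_mult_iff)
  \<comment> \<open>\<open>hs_hoelder_semigroup\<close> is used twice: with the identity for the
    integrand itself, and with \<open>S (t - s)\<close> minus the identity, of norm at most
    \<open>\<Lambda> * (t - s)\<close>, for its change when the endpoint moves from \<open>s\<close>
    to \<open>t\<close>.\<close>
  have lin: "linear (\<lambda>x::ell2. x)" by (rule linearI) auto
  have hs: "hs_hoelder \<beta> y (c_hs * a * exp (- \<gamma> * y)) (\<lambda>j i q. ebasis j \<bullet> conv u y q (ebasis i))"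
    if "0 \<le> y" "y \<le> t" for y
    using hs_hoelder_semigroup[OF decaying_mono[OF g that(2)] that(1) lin, of 1]
    unfolding conv_entries by simp
  show "norm (young_integral \<alpha> (conv u t) w 0 t)
      \<le> Y * (1 + t) * (c_hs * a * exp (- \<gamma> * t)) * (\<kappa> * exp (\<theta> * t)) * t powr b"
    unfolding Y_def by (rule norm_young_integral_le[OF hs[OF t order_refl] cont k t wb])
  have hsd: "hs_hoelder \<beta> s (c_hs * a * exp (- \<gamma> * s) * (\<Lambda> * (t - s)))
     (\<lambda>j i q. ebasis j \<bullet> conv u t q (ebasis i) - ebasis j \<bullet> conv u s q (ebasis i))"
  proof -
    have ts: "t - s \<ge> 0" using st by simp
    have linE: "linear (\<lambda>y. S (t - s) y - y)"
      by (rule linear_compose_sub[OF S_linear[OF ts] lin])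
    have Eb: "norm (S (t - s) y - y) \<le> \<Lambda> * (t - s) * norm y" for y
      using norm_S_op_diff_id_le[of \<nu> lam "t - s" y] params ts by (simp add: \<Lambda>_def)
    have hE: "hs_hoelder \<beta> s (c_hs * a * exp (- \<gamma> * s) * (\<Lambda> * (t - s)))
      (\<lambda>j i r. coord (S (t - s) (S (s - r) (coord (f_op h (u r)) i *\<^sub>R ebasis i))
        - S (s - r) (coord (f_op h (u r)) i *\<^sub>R ebasis i)) j)"
      by (rule hs_hoelder_semigroup[OF decaying_mono[OF g st(2)] st(1) linE Eb])
    have eq: "S (t - s) (S (s - r) y) = S (t - r) y" for r y
      using S_op_add[of \<nu> lam "t - s" "s - r" y] params ts by simp
    show ?thesis
      using hE unfolding eq by (simp add: inner_ebasis h_op_ebasis coord_h)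
  qed
  show "norm (young_integral \<alpha> (conv u t) w 0 t - young_integral \<alpha> (conv u s) w 0 s)
      \<le> Y * (1 + t) * (\<kappa> * exp (\<theta> * t)) *
        (c_hs * a * exp (- \<gamma> * t) * (t - s) powr b + c_hs * a * exp (- \<gamma> * s) * (\<Lambda> * (t - s)) * s powr b)"
    unfolding Y_def
    by (rule norm_young_integral_diff_le[OF hs[OF t order_refl] hs[OF st] hsd cont k st wb])
qed

lemma solution_decomposition:
  assumes "solution w x u" "t \<ge> 0"
  shows "u t = S t x + drift (\<lambda>r. f_op f (u r)) t + young_integral \<alpha> (conv u t) w 0 t"
  using assms unfolding mild_solution_def drift_def by blast

lemma solution_continuous:
  assumes "solution w x u"
  shows "continuous_on {0..T} u"
proof (cases "T > 0")
  case True
  then obtain C where "\<forall>s\<in>{0..T}. \<forall>t\<in>{0..T}. dist (u s) (u t) \<le> C * \<bar>s - t\<bar> powr \<beta>"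
    using assms unfolding mild_solution_def Hoelder_on_def by blast
  then show ?thesis
    using rates by (intro hoelder_continuous_on[of _ _ C \<beta>]) (auto simp: dist_norm)
next
  case False
  then consider "T = 0" | "T < 0" by linarith
  then show ?thesis by cases auto
qed

text \<open>The bound is linear in \<open>norm x\<close> and in the size \<open>a\<close> of the
  coefficients along the solution, with \<open>C\<close> chosen before path, solution and times.
  Increments are measured with the exponent \<open>b\<close> of the path instead of
  \<open>\<beta>\<close>; the restriction to unit length allows
  \<open>t - s \<le> (t - s) powr b\<close>.\<close>

lemma a_priori_bound:
  obtains C where "C \<ge> 1"
    "\<And>\<kappa> w x u a s t. \<kappa> \<ge> 1 \<Longrightarrow> tempered \<kappa> w \<Longrightarrow> solution w x u \<Longrightarrow> 0 \<le> s \<Longrightarrow> s \<le> t \<Longrightarrow>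
       decaying a t (\<lambda>r. f_op h (u r)) \<Longrightarrow>
       (\<And>r. 0 \<le> r \<Longrightarrow> r \<le> t \<Longrightarrow> norm (f_op f (u r)) \<le> a * exp (- \<gamma> * r)) \<Longrightarrow>
       norm (u t) \<le> C * (norm x + a * \<kappa>) * exp (- \<mu> * t) \<and>
       (t - s \<le> 1 \<longrightarrow> norm (u t - u s) \<le> C * (norm x + a * \<kappa>) * exp (- \<mu> * s) * (t - s) powr b)"
proof -
  obtain P where P0: "\<And>t. t \<ge> 0 \<Longrightarrow> (1 + t)\<^sup>2 \<le> P * exp (\<theta> * t)"
    using power_le_exp[OF rates(5), of 2] by blast
  with P0[of 0] have P: "P \<ge> 1" "\<And>t. t \<ge> 0 \<Longrightarrow> (1 + t)\<^sup>2 \<le> P * exp (\<theta> * t)" by auto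
  define Y where "Y = young_const \<alpha> \<beta> b"
  have Y: "Y > 0" unfolding Y_def young_const_def
    using const_pos exponents by (intro mult_pos_pos add_pos_pos divide_pos_pos) auto
  have chs: "c_hs > 0" using rates by (simp add: c_hs_def add_pos_pos)
  \<comment> \<open>The factor \<open>2 * exp \<theta>\<close> comes from evaluating at
    \<open>s\<close> instead of \<open>t\<close>: for \<open>t - s \<le> 1\<close> one has
    \<open>1 + t \<le> 2 * (1 + s)\<close> and
    \<open>exp (\<theta> * t) \<le> exp \<theta> * exp (\<theta> * s)\<close>.\<close>
  define Q where "Q = (1 + \<Lambda>) * (1 + 2 * Y * exp \<theta> * c_hs)"
  have Q: "Q \<ge> 1" "Q \<ge> 1 + Y * c_hs"
  proof -
    have "exp \<theta> \<ge> 1" using rates by simp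
    then have e: "1 \<le> 2 * exp \<theta>" by linarith
    have "Y * c_hs * 1 \<le> Y * c_hs * (2 * exp \<theta>)" using Y chs e by (intro mult_left_mono) auto
    moreover have "1 * (1 + 2 * Y * exp \<theta> * c_hs) \<le> Q"
      unfolding Q_def using rates Y chs by (intro mult_right_mono) auto
    ultimately show "Q \<ge> 1 + Y * c_hs" by (simp add: mult_ac)
    then show "Q \<ge> 1" using Y chs by (smt (verit) mult_pos_pos)
  qed
  define C where "C = 1 + \<Lambda> + Q * P"
  show thesis
  proof (rule that[of C])
    show "C \<ge> 1" unfolding C_def using rates Q P by simp
    fix \<kappa> w x u a s t
    assume k: "\<kappa> \<ge> (1::real)" and w: "tempered \<kappa> w" and u: "solution w x u" and st: "0 \<le> s" "s \<le> t"
      and g: "decaying a t (\<lambda>r. f_op h (u r))"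
      and F: "\<And>r. 0 \<le> r \<Longrightarrow> r \<le> t \<Longrightarrow> norm (f_op f (u r)) \<le> a * exp (- \<gamma> * r)"
    let ?Y = "\<lambda>t. young_integral \<alpha> (conv u t) w 0 t" and ?D = "drift (\<lambda>r. f_op f (u r))"
    let ?g = "\<lambda>y. (1 + y)\<^sup>2 * exp (- \<gamma> * y) * exp (\<theta> * y)"
    have a: "a \<ge> 0" using order_trans[OF norm_ge_zero F[of 0]] st by simp
    have t: "t \<ge> 0" using st by simp
    have cont: "continuous_on {0..t} (\<lambda>r. f_op f (u r))"
    proof (rule continuous_on_compose2[OF _ solution_continuous[OF u, of t], of UNIV])
      show "continuous_on UNIV (f_op f)"
        using f_op_diff params by (intro lipschitz_on_continuous_on[OF lipschitz_onI[of _ _ D]]) (auto simp: dist_norm)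
    qed auto
    note dr = drift_bounds[OF cont F st]
    note yb = young_bounds[OF g w st, folded Y_def]
    have ak: "a \<le> a * \<kappa>" using a k mult_left_mono[of 1 \<kappa> a] by simp
    \<comment> \<open>This uses up \<open>\<gamma> = \<mu> + \<theta> + \<theta>\<close>: one
      \<open>\<theta>\<close> against the growth of the path, one against the square.\<close>
    have poly: "?g y \<le> P * exp (- \<mu> * y)" if "y \<ge> 0" for y
    proof -
      have "?g y \<le> P * exp (\<theta> * y) * exp (- \<gamma> * y) * exp (\<theta> * y)"
        by (intro mult_right_mono P that) auto
      also have "\<dots> = P * exp (- \<mu> * y)"
        by (simp add: mult.assoc exp_add[symmetric] rates(7) algebra_simps)
      finally show ?thesis .
    qed
    have pb: "y powr b \<le> 1 + y" if "y \<ge> 0" for y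
    proof -
      have "y powr b \<le> (1 + y) powr b" using that exponents by (intro powr_mono2) auto
      also have "\<dots> \<le> (1 + y) powr 1" using that params by (intro powr_mono) auto
      finally show ?thesis using that by simp
    qed
    have e1: "1 \<le> exp (\<theta> * y)" if "y \<ge> 0" for y using rates that by simp
    have sq: "y \<le> (1 + y)\<^sup>2" "1 + y \<le> (1 + y)\<^sup>2" if "y \<ge> 0" for y :: real
      using that by (auto simp: power2_eq_square algebra_simps)
    have emono: "exp (- lam * y) \<le> exp (- \<mu> * y)" if "y \<ge> 0" for y
      using mult_right_mono[of \<mu> lam y] that params by simp
    have size: "norm (u t) \<le> C * (norm x + a * \<kappa>) * exp (- \<mu> * t)"
    proof -
      have "norm (u t) \<le> norm (S t x) + norm (?D t) + norm (?Y t)"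
        unfolding solution_decomposition[OF u t] by (intro norm_triangle_le add_mono) auto
      also have "norm (S t x) \<le> exp (- \<mu> * t) * norm x"
        using t by (intro order_trans[OF S_bound] mult_right_mono emono) auto
      also have "norm (?D t) \<le> (a * \<kappa>) * ?g t"
      proof (rule order_trans[OF dr(1)])
        have "t * a * (exp (- \<gamma> * t) * 1) \<le> (1 + t)\<^sup>2 * (a * \<kappa>) * (exp (- \<gamma> * t) * exp (\<theta> * t))"
          using t a k ak sq e1 by (intro mult_mono) auto
        then show "t * a * exp (- \<gamma> * t) \<le> (a * \<kappa>) * ?g t"
          by (simp add: mult_ac)
      qed
      also have "norm (?Y t) \<le> (Y * c_hs * (a * \<kappa>)) * ?g t"
      proof (rule order_trans[OF yb(1)])
        have "(Y * (1 + t) * (c_hs * a * exp (- \<gamma> * t)) * (\<kappa> * exp (\<theta> * t))) * t powr b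
          \<le> (Y * (1 + t) * (c_hs * a * exp (- \<gamma> * t)) * (\<kappa> * exp (\<theta> * t))) * (1 + t)"
          using t a k Y chs pb by (intro mult_left_mono) auto
        then show "Y * (1 + t) * (c_hs * a * exp (- \<gamma> * t)) * (\<kappa> * exp (\<theta> * t)) * t powr b
          \<le> (Y * c_hs * (a * \<kappa>)) * ?g t"
          by (simp add: power2_eq_square mult_ac)
      qed
      also have "exp (- \<mu> * t) * norm x + (a * \<kappa>) * ?g t
          + (Y * c_hs * (a * \<kappa>)) * ?g t
        = exp (- \<mu> * t) * norm x + ((1 + Y * c_hs) * (a * \<kappa>)) * ?g t"
        by (simp only: distrib_right mult_1_left add.assoc)
      also have "\<dots> \<le> exp (- \<mu> * t) * norm x + (Q * (a * \<kappa>)) * (P * exp (- \<mu> * t))"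
        by (intro add_left_mono mult_mono[OF mult_right_mono[OF Q(2)] poly[OF t]]) (use a k Q in auto)
      also have "\<dots> \<le> C * (norm x + a * \<kappa>) * exp (- \<mu> * t)"
      proof -
        have "norm x + Q * P * (a * \<kappa>) \<le> C * norm x + C * (a * \<kappa>)"
          using a k \<open>C \<ge> 1\<close> rates
          by (intro add_mono mult_right_mono) (auto simp: C_def mult_le_cancel_right1)
        from mult_right_mono[OF this, of "exp (- \<mu> * t)"] show ?thesis
          by (simp add: distrib_left distrib_right mult_ac)
      qed
      finally show ?thesis by simp
    qed
    have "norm (u t - u s) \<le> C * (norm x + a * \<kappa>) * exp (- \<mu> * s) * (t - s) powr b" if ts: "t - s \<le> 1"
    proof -
      let ?d = "(t - s) powr b"
      have d: "t - s \<le> ?d" using powr_mono'[of b 1 "t - s"] st ts params by (cases "t = s") auto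
      have "u t - u s = (S t x - S s x) + (?D t - ?D s)
        + (?Y t - ?Y s)"
        by (subst solution_decomposition[OF u t], subst solution_decomposition[OF u st(1)]) simp
      then have "norm (u t - u s) \<le> norm (S t x - S s x) + norm (?D t - ?D s)
        + norm (?Y t - ?Y s)"
        by (simp only:) (intro norm_triangle_le add_mono order_refl norm_triangle_ineq)
      also have "norm (S t x - S s x) \<le> \<Lambda> * ?d * exp (- \<mu> * s) * norm x"
        using st d rates by (intro order_trans[OF S_diff_bound[OF st]] mult_mono mult_nonneg_nonneg emono) auto
      also have "norm (?D t - ?D s)
          \<le> ((1 + \<Lambda>) * (a * \<kappa>)) * ?g s * ?d"
      proof (rule order_trans[OF dr(2)])
        have "1 + s * \<Lambda> \<le> (1 + \<Lambda>) * (1 + s)" using st rates by (simp add: algebra_simps)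
        also have "\<dots> \<le> (1 + \<Lambda>) * (1 + s)\<^sup>2" using sq(2)[OF st(1)] rates by (intro mult_left_mono) auto
        finally have "(1 + s * \<Lambda>) * (t - s) * a * (exp (- \<gamma> * s) * 1)
           \<le> ((1 + \<Lambda>) * (1 + s)\<^sup>2) * ?d * (a * \<kappa>) * (exp (- \<gamma> * s) * exp (\<theta> * s))"
          using st a k ak d e1[OF st(1)] rates by (intro mult_mono) auto
        then show "(1 + s * \<Lambda>) * (t - s) * a * exp (- \<gamma> * s)
           \<le> ((1 + \<Lambda>) * (a * \<kappa>)) * ?g s * ?d"
          by (simp add: mult_ac)
      qed
      also have "norm (?Y t - ?Y s)
          \<le> ((1 + \<Lambda>) * (2 * Y * exp \<theta> * c_hs) * (a * \<kappa>)) * ?g s * ?d"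
      proof (rule order_trans[OF yb(2)])
        have "c_hs * a * exp (- \<gamma> * t) * ?d + c_hs * a * exp (- \<gamma> * s) * (\<Lambda> * (t - s)) * s powr b
          \<le> c_hs * a * exp (- \<gamma> * s) * ?d + c_hs * a * exp (- \<gamma> * s) * (\<Lambda> * ?d) * (1 + s)"
          using st a chs rates d pb[OF st(1)] by (intro add_mono mult_mono) auto
        also have "\<dots> = c_hs * a * exp (- \<gamma> * s) * ?d * (1 + \<Lambda> * (1 + s))" by (simp add: algebra_simps)
        also have "\<dots> \<le> c_hs * a * exp (- \<gamma> * s) * ?d * ((1 + \<Lambda>) * (1 + s))"
          using st a chs rates by (intro mult_left_mono) (auto simp: algebra_simps)
        finally have A: "c_hs * a * exp (- \<gamma> * t) * ?d + c_hs * a * exp (- \<gamma> * s) * (\<Lambda> * (t - s)) * s powr b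
          \<le> c_hs * a * exp (- \<gamma> * s) * ?d * ((1 + \<Lambda>) * (1 + s))" .
        have "\<theta> * t \<le> \<theta> + \<theta> * s" using mult_left_mono[OF ts, of \<theta>] rates by (simp add: algebra_simps)
        then have et: "exp (\<theta> * t) \<le> exp \<theta> * exp (\<theta> * s)" by (simp add: exp_add[symmetric])
        have "Y * (1 + t) * (\<kappa> * exp (\<theta> * t)) *
            (c_hs * a * exp (- \<gamma> * t) * ?d + c_hs * a * exp (- \<gamma> * s) * (\<Lambda> * (t - s)) * s powr b)
          \<le> Y * (2 * (1 + s)) * (\<kappa> * (exp \<theta> * exp (\<theta> * s))) * (c_hs * a * exp (- \<gamma> * s) * ?d * ((1 + \<Lambda>) * (1 + s)))"
          using st ts a k Y chs rates by (intro mult_mono A et) auto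
        also have "\<dots> = ((1 + \<Lambda>) * (2 * Y * exp \<theta> * c_hs) * (a * \<kappa>)) * ?g s * ?d"
          by (simp add: power2_eq_square mult_ac)
        finally show "Y * (1 + t) * (\<kappa> * exp (\<theta> * t)) *
            (c_hs * a * exp (- \<gamma> * t) * ?d + c_hs * a * exp (- \<gamma> * s) * (\<Lambda> * (t - s)) * s powr b)
          \<le> ((1 + \<Lambda>) * (2 * Y * exp \<theta> * c_hs) * (a * \<kappa>)) * ?g s * ?d" .
      qed
      also have "\<Lambda> * ?d * exp (- \<mu> * s) * norm x
          + ((1 + \<Lambda>) * (a * \<kappa>)) * ?g s * ?d
          + ((1 + \<Lambda>) * (2 * Y * exp \<theta> * c_hs) * (a * \<kappa>)) * ?g s * ?d
        = (\<Lambda> * exp (- \<mu> * s) * norm x + Q * (a * \<kappa>) * ?g s) * ?d"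
        unfolding Q_def by (simp only: distrib_left distrib_right mult_1_left mult_1_right mult_ac add_ac)
      also have "\<dots> \<le> (C * (norm x + a * \<kappa>) * exp (- \<mu> * s)) * ?d"
      proof (rule mult_right_mono)
        have "\<Lambda> * exp (- \<mu> * s) * norm x + Q * (a * \<kappa>) * ?g s
          \<le> \<Lambda> * exp (- \<mu> * s) * norm x + Q * (a * \<kappa>) * (P * exp (- \<mu> * s))"
          using a k Q poly[OF st(1)] by (intro add_left_mono mult_left_mono) auto
        also have "\<dots> = (\<Lambda> * norm x + Q * P * (a * \<kappa>)) * exp (- \<mu> * s)" by (simp add: algebra_simps)
        also have "\<dots> \<le> (C * norm x + C * (a * \<kappa>)) * exp (- \<mu> * s)"
          using a k Q P rates by (intro mult_right_mono add_mono) (auto simp: C_def)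
        finally show "\<Lambda> * exp (- \<mu> * s) * norm x + Q * (a * \<kappa>) * ?g s
          \<le> C * (norm x + a * \<kappa>) * exp (- \<mu> * s)" by (simp add: distrib_left)
      qed auto
      finally show ?thesis by simp
    qed
    with size show "norm (u t) \<le> C * (norm x + a * \<kappa>) * exp (- \<mu> * t) \<and>
       (t - s \<le> 1 \<longrightarrow> norm (u t - u s) \<le> C * (norm x + a * \<kappa>) * exp (- \<mu> * s) * (t - s) powr b)" by blast
  qed
qed

end

section \<open>The continuity method\<close>

lemma young_integral_0: "young_integral \<alpha> Z w s s = 0"
proof -
  have "(LBINT r:{s..s}. g r) = 0" for g :: "real \<Rightarrow> real"
    using set_integral_insert(2)[of "{}" g s] by (simp add: set_integrable_def set_lebesgue_integral_def)
  then show ?thesis unfolding young_integral_def by simp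
qed

context lattice_stability
begin

text \<open>Size alone would not propagate: the Young estimate also needs Hoelder control of
  \<open>h\<close> along the solution, so the \<open>\<beta>\<close>-seminorm is carried along with
  the same weight.\<close>

definition small_on :: "real \<Rightarrow> real \<Rightarrow> (real \<Rightarrow> ell2) \<Rightarrow> bool" where
  "small_on R T u \<longleftrightarrow> (\<forall>t\<in>{0..T}. norm (u t) \<le> R * exp (- \<mu> * t) \<and>
     (\<forall>s\<in>{0..t}. norm (u t - u s) \<le> R * exp (- \<mu> * s) * (t - s) powr \<beta>))"

lemma exp_double_rate: "r \<ge> 0 \<Longrightarrow> exp (- \<mu> * r) * exp (- \<mu> * r) \<le> exp (- \<gamma> * r)"
  using mult_right_mono[OF rates(4), of r] by (simp add: exp_add[symmetric])

text \<open>One factor \<open>R * exp (- \<mu> * r)\<close> comes from the local Lipschitz constant,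
  the other from the solution itself; the doubled rate \<open>2 * \<mu>\<close> is at least
  \<open>\<gamma>\<close>.\<close>

lemma small_on_decaying:
  assumes u: "small_on R t u" and R: "0 \<le> R" "R \<le> \<delta>"
  shows "decaying (M * R\<^sup>2) t (\<lambda>r. f_op h (u r))"
    and "0 \<le> r \<Longrightarrow> r \<le> t \<Longrightarrow> norm (f_op f (u r)) \<le> M * R\<^sup>2 * exp (- \<gamma> * r)"
proof -
  have ub: "norm (u r) \<le> R * exp (- \<mu> * r)" if "0 \<le> r" "r \<le> t" for r
    using u that by (auto simp: small_on_def)
  have sq: "M * (R * exp (- \<mu> * r)) * (R * exp (- \<mu> * r)) \<le> M * R\<^sup>2 * exp (- \<gamma> * r)" if "0 \<le> r" for r
  proof -
    have "M * R\<^sup>2 * (exp (- \<mu> * r) * exp (- \<mu> * r)) \<le> M * R\<^sup>2 * exp (- \<gamma> * r)"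
      using params by (intro mult_left_mono exp_double_rate that) auto
    then show ?thesis by (simp add: power2_eq_square mult_ac)
  qed
  have exp1: "R * exp (- \<mu> * r) \<le> \<delta>" if "0 \<le> r" for r
    using R that params mult_left_mono[of "exp (- \<mu> * r)" 1 R] by simp
  show "norm (f_op f (u r)) \<le> M * R\<^sup>2 * exp (- \<gamma> * r)" if "0 \<le> r" "r \<le> t"
  proof -
    have "norm (f_op f (u r)) \<le> M * (R * exp (- \<mu> * r)) * norm (u r)"
      using that by (intro f_op_quadratic ub exp1)
    also have "\<dots> \<le> M * (R * exp (- \<mu> * r)) * (R * exp (- \<mu> * r))"
      using that params R by (intro mult_left_mono ub) auto
    finally show ?thesis using sq[OF that(1)] by simp
  qed
  show "decaying (M * R\<^sup>2) t (\<lambda>r. f_op h (u r))"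
    unfolding decaying_def
  proof (intro ballI conjI)
    fix r assume r: "r \<in> {0..t}"
    have "norm (f_op h (u r)) \<le> M * (R * exp (- \<mu> * r)) * norm (u r)"
      using r by (intro h_op_quadratic ub) auto
    also have "\<dots> \<le> M * (R * exp (- \<mu> * r)) * (R * exp (- \<mu> * r))"
      using r params R by (intro mult_left_mono ub) auto
    finally show "norm (f_op h (u r)) \<le> M * R\<^sup>2 * exp (- \<gamma> * r)" using sq[of r] r by simp
    fix q assume q: "q \<in> {0..r}"
    have "R * exp (- \<mu> * r) \<le> R * exp (- \<mu> * q)" using q params R by (intro mult_left_mono) auto
    then have "norm (f_op h (u r) - f_op h (u q)) \<le> M * (R * exp (- \<mu> * q)) * norm (u r - u q)"
      using q r ub[of r] ub[of q] by (intro h_op_diff) auto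
    also have "\<dots> \<le> M * (R * exp (- \<mu> * q)) * (R * exp (- \<mu> * q) * (r - q) powr \<beta>)"
      using q r params R u by (intro mult_left_mono) (auto simp: small_on_def)
    also have "\<dots> = M * (R * exp (- \<mu> * q)) * (R * exp (- \<mu> * q)) * (r - q) powr \<beta>"
      by (simp add: mult.assoc)
    also have "\<dots> \<le> M * R\<^sup>2 * exp (- \<gamma> * q) * (r - q) powr \<beta>"
      using q by (intro mult_right_mono sq) auto
    finally show "norm (f_op h (u r) - f_op h (u q)) \<le> M * R\<^sup>2 * exp (- \<gamma> * q) * (r - q) powr \<beta>" .
  qed
qed

text \<open>No smallness is gained here. The point is to satisfy the hypotheses of the a priori
  bound on all of \<open>{0..N}\<close> with some finite \<open>a\<close>, and so to obtain a
  modulus of continuity of order \<open>b\<close> there.\<close>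

lemma solution_crude_bound:
  assumes u: "solution w x u" and N: "N > 0"
  shows "\<exists>a\<ge>0. decaying a N (\<lambda>r. f_op h (u r)) \<and>
    (\<forall>r. 0 \<le> r \<longrightarrow> r \<le> N \<longrightarrow> norm (f_op f (u r)) \<le> a * exp (- \<gamma> * r))"
proof -
  obtain c0 where c0: "\<forall>s\<in>{0..N}. \<forall>t\<in>{0..N}. dist (u s) (u t) \<le> c0 * \<bar>s - t\<bar> powr \<beta>"
    using u N unfolding mild_solution_def Hoelder_on_def by blast
  define c where "c = max c0 0"
  have c: "norm (u s - u t) \<le> c * \<bar>s - t\<bar> powr \<beta>" if "s \<in> {0..N}" "t \<in> {0..N}" for s t
  proof -
    have "norm (u s - u t) \<le> c0 * \<bar>s - t\<bar> powr \<beta>" using c0 that by (auto simp: dist_norm)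
    also have "\<dots> \<le> c * \<bar>s - t\<bar> powr \<beta>" by (intro mult_right_mono) (auto simp: c_def)
    finally show ?thesis .
  qed
  have c_pos: "c \<ge> 0" by (simp add: c_def)
  define m where "m = norm (u 0) + c * N powr \<beta>"
  have m_pos: "m \<ge> 0" using c_pos by (simp add: m_def)
  have m: "norm (u r) \<le> m" if r: "r \<in> {0..N}" for r
  proof -
    have "norm (u r) \<le> norm (u 0) + norm (u r - u 0)" by (simp add: norm_triangle_sub)
    also have "norm (u r - u 0) \<le> c * r powr \<beta>" using c[of r 0] r by simp
    also have "c * r powr \<beta> \<le> c * N powr \<beta>"
      using r c_pos rates by (intro mult_left_mono powr_mono2) auto
    finally show ?thesis by (simp add: m_def)
  qed
  define k where "k = M * m * m + M * m * c + D * m"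
  \<comment> \<open>The factor \<open>exp (\<gamma> * N)\<close> undoes the decaying weight on the
    bounded interval.\<close>
  define a where "a = k * exp (\<gamma> * N)"
  have k: "0 \<le> M * m * m" "0 \<le> M * m * c" "0 \<le> D * m" "k \<ge> 0"
    using params m_pos c_pos by (auto simp: k_def)
  have ka: "k \<le> a * exp (- \<gamma> * r)" if "0 \<le> r" "r \<le> N" for r
  proof -
    have "k * 1 \<le> k * exp (\<gamma> * N - \<gamma> * r)"
      using that k rates by (intro mult_left_mono) (auto intro!: mult_left_mono)
    then show ?thesis by (simp add: a_def exp_diff exp_minus divide_inverse)
  qed
  have "decaying a N (\<lambda>r. f_op h (u r))"
    unfolding decaying_def
  proof (intro ballI conjI)
    fix r assume r: "r \<in> {0..N}"
    have "norm (f_op h (u r)) \<le> M * m * m"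
      by (rule order_trans[OF h_op_quadratic[OF m[OF r]] mult_left_mono[OF m[OF r]]])
         (use params m_pos in simp)
    also have "\<dots> \<le> k" using k by (simp add: k_def)
    finally show "norm (f_op h (u r)) \<le> a * exp (- \<gamma> * r)" using ka[of r] r by simp
    fix q assume q: "q \<in> {0..r}"
    have "norm (f_op h (u r) - f_op h (u q)) \<le> M * m * norm (u r - u q)"
      using q r by (intro h_op_diff m) auto
    also have "\<dots> \<le> M * m * (c * (r - q) powr \<beta>)"
      using c[of r q] q r params m_pos by (intro mult_left_mono) auto
    also have "\<dots> = M * m * c * (r - q) powr \<beta>" by simp
    also have "\<dots> \<le> a * exp (- \<gamma> * q) * (r - q) powr \<beta>"
      using ka[of q] q r k by (intro mult_right_mono) (auto simp: k_def)
    finally show "norm (f_op h (u r) - f_op h (u q)) \<le> a * exp (- \<gamma> * q) * (r - q) powr \<beta>" .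
  qed
  moreover have "norm (f_op f (u r)) \<le> a * exp (- \<gamma> * r)" if "0 \<le> r" "r \<le> N" for r
  proof -
    have "norm (f_op f (u r)) \<le> D * m"
      using f_op_bound[of "u r"] m[of r] that params mult_left_mono[of "norm (u r)" m D] by simp
    also have "\<dots> \<le> k" using k by (simp add: k_def)
    finally show ?thesis using ka[OF that] by simp
  qed
  moreover have "a \<ge> 0" using k by (simp add: a_def)
  ultimately show ?thesis by blast
qed

text \<open>One step of the continuity method: the a priori bound improves \<open>R\<close> to \<open>R / 4\<close>, and the
  crude modulus of continuity of order \<open>b > \<beta>\<close> absorbs the loss on a short further interval.\<close>

lemma small_on_step:
  assumes T: "0 \<le> T" "T \<le> T'" "T' \<le> N" "T' - T \<le> \<eta>" and R: "R > 0"
    and size: "\<And>t. 0 \<le> t \<Longrightarrow> t \<le> T \<Longrightarrow> norm (u t) \<le> R / 4 * exp (- \<mu> * t)"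
    and incr: "\<And>s t. 0 \<le> s \<Longrightarrow> s \<le> t \<Longrightarrow> t \<le> T \<Longrightarrow> t - s \<le> 1 \<Longrightarrow>
      norm (u t - u s) \<le> R / 4 * exp (- \<mu> * s) * (t - s) powr \<beta>"
    and crude: "\<And>s t. 0 \<le> s \<Longrightarrow> s \<le> t \<Longrightarrow> t \<le> N \<Longrightarrow> t - s \<le> \<eta> \<Longrightarrow>
      norm (u t - u s) \<le> R / 2 * exp (- \<mu> * N) * (t - s) powr \<beta>"
    and eta: "0 < \<eta>" "\<eta> \<le> 1" "\<mu> * \<eta> \<le> ln 2"
  shows "small_on R T' u"
proof -
  have e: "exp (- \<mu> * N) \<le> exp (- \<mu> * t)" if "t \<le> N" for t
    using that params by simp
  have incr': "norm (u t - u s) \<le> R / 2 * exp (- \<mu> * s) * (t - s) powr \<beta>"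
    if st: "0 \<le> s" "s \<le> t" "t \<le> T" for s t
  \<comment> \<open>The a priori bound covers increments of at most unit length; longer ones are
    bounded by the two sizes, which doubles \<open>R / 4\<close>.\<close>
  proof (cases "t - s \<le> 1")
    case True
    have "R / 4 * (exp (- \<mu> * s) * (t - s) powr \<beta>) \<le> R / 2 * (exp (- \<mu> * s) * (t - s) powr \<beta>)"
      using R by (intro mult_right_mono) auto
    with incr[OF st True] show ?thesis by simp
  next
    case False
    have "norm (u t - u s) \<le> R / 4 * exp (- \<mu> * t) + R / 4 * exp (- \<mu> * s)"
      using size[of t] size[of s] st by (intro order_trans[OF norm_triangle_ineq4] add_mono) auto
    also have "\<dots> \<le> R / 4 * exp (- \<mu> * s) + R / 4 * exp (- \<mu> * s)"
      using st R params by (intro add_mono mult_left_mono) auto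
    also have "\<dots> = R / 2 * exp (- \<mu> * s) * 1" by simp
    also have "\<dots> \<le> R / 2 * exp (- \<mu> * s) * (t - s) powr \<beta>"
      using False R rates by (intro mult_left_mono ge_one_powr_ge_zero) auto
    finally show ?thesis .
  qed
  have late: "norm (u t - u s) \<le> R / 2 * exp (- \<mu> * s) * (t - s) powr \<beta>"
    if st: "T \<le> s" "s \<le> t" "t \<le> T'" for s t
  proof -
    have "norm (u t - u s) \<le> R / 2 * exp (- \<mu> * N) * (t - s) powr \<beta>"
      using st T by (intro crude) auto
    also have "\<dots> \<le> R / 2 * exp (- \<mu> * s) * (t - s) powr \<beta>"
      using e[of s] R st T by (intro mult_right_mono mult_left_mono) auto
    finally show ?thesis .
  qed
  show ?thesis
    unfolding small_on_def
  proof (intro ballI conjI)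
    fix t assume t: "t \<in> {0..T'}"
    show "norm (u t) \<le> R * exp (- \<mu> * t)"
    proof (cases "t \<le> T")
      case True
      have "R / 4 * exp (- \<mu> * t) \<le> R * exp (- \<mu> * t)" using R by (intro mult_right_mono) auto
      with size[of t] t True show ?thesis by simp
    next
      case False
      have tT: "t - T \<le> \<eta>" using t T by auto
      have "norm (u t) \<le> norm (u T) + norm (u t - u T)" by (simp add: norm_triangle_sub)
      also have "norm (u T) \<le> R / 4 * exp (- \<mu> * T)" using T by (intro size) auto
      \<comment> \<open>Moving the weight from \<open>T\<close> to \<open>t\<close> at most doubles
        it because \<open>\<mu> * \<eta> \<le> ln 2\<close>, so \<open>R / 4\<close> becomes
        \<open>R / 2\<close>; the crude increment supplies the other half.\<close>
      also have "exp (- \<mu> * T) \<le> 2 * exp (- \<mu> * t)"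
      proof -
        have "- \<mu> * T \<le> ln 2 + - \<mu> * t"
          using mult_left_mono[OF tT, of \<mu>] params eta by (simp add: algebra_simps)
        then have "exp (- \<mu> * T) \<le> exp (ln 2 + - \<mu> * t)" by simp
        then show ?thesis unfolding exp_add by simp
      qed
      also have "norm (u t - u T) \<le> R / 2 * exp (- \<mu> * N) * (t - T) powr \<beta>"
        using t T False tT by (intro crude) auto
      also have "\<dots> \<le> R / 2 * exp (- \<mu> * t) * 1"
        using t T False tT eta R rates e[of t] by (intro mult_mono powr_le1) auto
      finally show ?thesis using R by simp
    qed
    fix s assume s: "s \<in> {0..t}"
    have half: "R / 2 * exp (- \<mu> * s) * (t - s) powr \<beta> \<le> R * exp (- \<mu> * s) * (t - s) powr \<beta>"
      using R by (intro mult_right_mono) auto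
    consider "t \<le> T" | "T \<le> s" | "s \<le> T" "T \<le> t" by linarith
    then show "norm (u t - u s) \<le> R * exp (- \<mu> * s) * (t - s) powr \<beta>"
    proof cases
      case 1
      then show ?thesis using incr'[of s t] s half by simp
    next
      case 2
      then show ?thesis using late[of s t] s t half by simp
    next
      case 3
      \<comment> \<open>An increment across \<open>T\<close> is cut there, and each part has the
        constant \<open>R / 2\<close>.\<close>
      have "norm (u t - u s) \<le> norm (u t - u T) + norm (u T - u s)"
        using norm_triangle_ineq[of "u t - u T" "u T - u s"] by simp
      also have "\<dots> \<le> R / 2 * exp (- \<mu> * T) * (t - T) powr \<beta> + R / 2 * exp (- \<mu> * s) * (T - s) powr \<beta>"
        using 3 s t T by (intro add_mono late incr') auto
      also have "\<dots> \<le> R / 2 * exp (- \<mu> * s) * (t - s) powr \<beta> + R / 2 * exp (- \<mu> * s) * (t - s) powr \<beta>"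
        using 3 s R params rates by (intro add_mono mult_mono powr_mono2) auto
      finally show ?thesis by simp
    qed
  qed
qed

text \<open>Pathwise form of the result: all randomness is condensed in \<open>\<kappa>\<close>, and
  it only scales the admissible initial values by \<open>1 / \<kappa>\<close>.\<close>

theorem deterministic_stability:
  obtains C where "C \<ge> 1"
    "\<And>\<kappa> w x u t. \<kappa> \<ge> 1 \<Longrightarrow> tempered \<kappa> w \<Longrightarrow> solution w x u \<Longrightarrow> norm x \<le> 1 / (C * \<kappa>) \<Longrightarrow> t \<ge> 0 \<Longrightarrow>
       norm (u t) \<le> exp (- \<mu> * t)"
proof (rule a_priori_bound)
  fix C1 :: real
  assume C1: "C1 \<ge> 1" and apriori:
    "\<And>\<kappa> w x u a s t. \<kappa> \<ge> 1 \<Longrightarrow> tempered \<kappa> w \<Longrightarrow> solution w x u \<Longrightarrow> 0 \<le> s \<Longrightarrow> s \<le> t \<Longrightarrow>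
       decaying a t (\<lambda>r. f_op h (u r)) \<Longrightarrow>
       (\<And>r. 0 \<le> r \<Longrightarrow> r \<le> t \<Longrightarrow> norm (f_op f (u r)) \<le> a * exp (- \<gamma> * r)) \<Longrightarrow>
       norm (u t) \<le> C1 * (norm x + a * \<kappa>) * exp (- \<mu> * t) \<and>
       (t - s \<le> 1 \<longrightarrow> norm (u t - u s) \<le> C1 * (norm x + a * \<kappa>) * exp (- \<mu> * s) * (t - s) powr b)"
  \<comment> \<open>With \<open>R = \<rho> / \<kappa>\<close> the quadratic term
    \<open>C1 * M * R\<^sup>2 * \<kappa>\<close> equals \<open>C1 * M * \<rho> * R\<close>, which is
    at most \<open>R / 8\<close>. The bound \<open>\<delta>\<close> serves the local estimate of
    \<open>f\<close>, the bound 1 the final constant.\<close>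
  define \<rho> where "\<rho> = min 1 (min \<delta> (1 / (8 * C1 * M)))"
  have rho: "0 < \<rho>" "\<rho> \<le> 1" "\<rho> \<le> \<delta>" "C1 * M * \<rho> \<le> 1 / 8"
  proof -
    show "0 < \<rho>" "\<rho> \<le> 1" "\<rho> \<le> \<delta>" using params C1 by (auto simp: \<rho>_def)
    have "C1 * M * \<rho> \<le> C1 * M * (1 / (8 * C1 * M))"
      using params C1 by (intro mult_left_mono) (auto simp: \<rho>_def)
    then show "C1 * M * \<rho> \<le> 1 / 8" using params C1 by simp
  qed
  \<comment> \<open>The radius \<open>1 / (C * \<kappa>)\<close> is \<open>R / (8 * C1)\<close>, so
    the initial value contributes another \<open>R / 8\<close>; together this is the
    \<open>R / 4\<close> that the continuity step asks for.\<close>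
  define C where "C = 8 * C1 / \<rho>"
  show thesis
  proof (rule that[of C])
    have "1 * \<rho> \<le> 8 * C1" using rho C1 by linarith
    then show "C \<ge> 1" using rho by (simp add: C_def pos_le_divide_eq)
    fix \<kappa> w x u t0
    assume k: "\<kappa> \<ge> (1::real)" and w: "tempered \<kappa> w" and u: "solution w x u"
      and x: "norm x \<le> 1 / (C * \<kappa>)" and t0: "t0 \<ge> (0::real)"
    define R where "R = \<rho> / \<kappa>"
    have R: "0 < R" "R \<le> 1" "R \<le> \<delta>"
    proof -
      show "0 < R" using rho k by (simp add: R_def)
      have "R \<le> \<rho>" using rho k by (simp add: R_def divide_le_eq mult_le_cancel_left1)
      with rho show "R \<le> 1" "R \<le> \<delta>" by auto
    qed
    have small: "C1 * (norm x + M * R\<^sup>2 * \<kappa>) \<le> R / 4"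
    proof -
      have "C1 * norm x \<le> C1 * (R / (8 * C1))"
        using x C1 rho k by (intro mult_left_mono) (auto simp: C_def R_def mult_ac)
      also have "\<dots> = R / 8" using C1 by simp
      finally have 1: "C1 * norm x \<le> R / 8" .
      have "C1 * (M * R\<^sup>2 * \<kappa>) = (C1 * M * \<rho>) * R"
        using k by (simp add: R_def power2_eq_square)
      also have "\<dots> \<le> 1 / 8 * R" using rho R by (intro mult_right_mono) auto
      finally show ?thesis using 1 by (simp add: distrib_left)
    qed
    \<comment> \<open>A finite horizon makes the crude modulus, and hence the step length
      \<open>\<eta>\<close>, uniform; the final bound does not depend on it.\<close>
    define N where "N = t0 + 1"
    have N: "N > 0" using t0 by (simp add: N_def)
    from solution_crude_bound[OF u N] obtain a where a: "a \<ge> 0" "decaying a N (\<lambda>r. f_op h (u r))"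
      "\<And>r. 0 \<le> r \<Longrightarrow> r \<le> N \<Longrightarrow> norm (f_op f (u r)) \<le> a * exp (- \<gamma> * r)" by blast
    define K where "K = C1 * (norm x + a * \<kappa>) + 1"
    have K: "K > 0" using C1 a k by (simp add: K_def add_nonneg_pos)
    have crude: "norm (u t - u s) \<le> K * (t - s) powr b" if st: "0 \<le> s" "s \<le> t" "t \<le> N" "t - s \<le> 1" for s t
    proof -
      have "norm (u t - u s) \<le> (C1 * (norm x + a * \<kappa>) * exp (- \<mu> * s)) * (t - s) powr b"
        using apriori[OF k w u st(1,2) decaying_mono[OF a(2) st(3)] a(3)] st by auto
      also have "C1 * (norm x + a * \<kappa>) * exp (- \<mu> * s) \<le> C1 * (norm x + a * \<kappa>) * 1"
        using st params C1 a k by (intro mult_left_mono) auto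
      also have "C1 * (norm x + a * \<kappa>) * 1 \<le> K" by (simp add: K_def)
      finally show ?thesis by (simp add: mult_right_mono)
    qed
    define e where "e = R / 2 * exp (- \<mu> * N) / K"
    have e: "e > 0" using R K by (simp add: e_def)
    \<comment> \<open>Length at most 1 for the crude modulus, at most \<open>ln 2 / \<mu>\<close>
      for the doubling of the weight; the last entry lets the spare exponent
      \<open>b - \<beta>\<close> turn \<open>K\<close> into the small constant
      \<open>R / 2 * exp (- \<mu> * N)\<close>.\<close>
    define \<eta> where "\<eta> = min 1 (min (ln 2 / \<mu>) (e powr (1 / (b - \<beta>))))"
    have eta: "0 < \<eta>" "\<eta> \<le> 1" "\<mu> * \<eta> \<le> ln 2" "\<eta> powr (b - \<beta>) \<le> e"
    proof -
      show "0 < \<eta>" "\<eta> \<le> 1" using e params by (auto simp: \<eta>_def)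
      have "\<mu> * \<eta> \<le> \<mu> * (ln 2 / \<mu>)" using params by (intro mult_left_mono) (auto simp: \<eta>_def)
      then show "\<mu> * \<eta> \<le> ln 2" using params by simp
      have "\<eta> powr (b - \<beta>) \<le> (e powr (1 / (b - \<beta>))) powr (b - \<beta>)"
        using \<open>0 < \<eta>\<close> params by (intro powr_mono2) (auto simp: \<eta>_def)
      then show "\<eta> powr (b - \<beta>) \<le> e" using params e by (simp add: powr_powr)
    qed
    have fine: "norm (u t - u s) \<le> R / 2 * exp (- \<mu> * N) * (t - s) powr \<beta>"
      if st: "0 \<le> s" "s \<le> t" "t \<le> N" "t - s \<le> \<eta>" for s t
    proof -
      have "norm (u t - u s) \<le> K * ((t - s) powr (b - \<beta>) * (t - s) powr \<beta>)"
        using crude[of s t] st eta by (simp add: powr_add[symmetric])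
      also have "\<dots> \<le> K * (e * (t - s) powr \<beta>)"
      proof (intro mult_left_mono mult_right_mono)
        have "(t - s) powr (b - \<beta>) \<le> \<eta> powr (b - \<beta>)" using st params by (intro powr_mono2) auto
        with eta(4) show "(t - s) powr (b - \<beta>) \<le> e" by simp
      qed (use K in auto)
      also have "\<dots> = R / 2 * exp (- \<mu> * N) * (t - s) powr \<beta>" using K by (simp add: e_def)
      finally show ?thesis .
    qed
    have u0: "u 0 = x"
      using solution_decomposition[OF u, of 0] by (simp add: drift_def young_integral_0)
    \<comment> \<open>Steps of a fixed length, capped at \<open>N\<close>: finitely many reach the
      horizon, so induction replaces a supremum of good times.\<close>
    have "small_on R (min (real n * \<eta>) N) u" for n
    proof (induction n)
      case 0
      have "C1 * norm x \<le> C1 * (norm x + M * R\<^sup>2 * \<kappa>)"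
        using C1 params R k by (intro mult_left_mono) auto
      then have "norm x \<le> R / 4" using small mult_right_mono[OF C1 norm_ge_zero, of x] by linarith
      then show ?case using N R by (simp add: small_on_def u0)
    next
      case (Suc n)
      let ?T = "min (real n * \<eta>) N"
      have bounds: "norm (u t) \<le> R / 4 * exp (- \<mu> * t)"
        "t - s \<le> 1 \<Longrightarrow> norm (u t - u s) \<le> R / 4 * exp (- \<mu> * s) * (t - s) powr b"
        if st: "0 \<le> s" "s \<le> t" "t \<le> ?T" for s t
      proof -
        have sm: "small_on R t u" using Suc st by (auto simp: small_on_def)
        note A = apriori[OF k w u st(1,2) small_on_decaying(1)[OF sm] small_on_decaying(2)[OF sm]]
        have A1: "norm (u t) \<le> (C1 * (norm x + M * R\<^sup>2 * \<kappa>)) * exp (- \<mu> * t)"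
          and A2: "t - s \<le> 1 \<Longrightarrow> norm (u t - u s) \<le> (C1 * (norm x + M * R\<^sup>2 * \<kappa>)) * (exp (- \<mu> * s) * (t - s) powr b)"
          using A R by (auto simp: mult.assoc)
        show "norm (u t) \<le> R / 4 * exp (- \<mu> * t)"
          by (rule order_trans[OF A1 mult_right_mono[OF small]]) simp
        show "norm (u t - u s) \<le> R / 4 * exp (- \<mu> * s) * (t - s) powr b" if "t - s \<le> 1"
          using order_trans[OF A2[OF that] mult_right_mono[OF small]] by (simp add: mult.assoc)
      qed
      show ?case
      proof (rule small_on_step[where T = ?T and N = N and \<eta> = \<eta>])
        show "0 \<le> ?T" "?T \<le> min (real (Suc n) * \<eta>) N" "min (real (Suc n) * \<eta>) N \<le> N"
          "min (real (Suc n) * \<eta>) N - ?T \<le> \<eta>"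
          using N eta by (auto simp: min_def algebra_simps)
        show "norm (u t) \<le> R / 4 * exp (- \<mu> * t)" if "0 \<le> t" "t \<le> ?T" for t
          using bounds(1)[OF that(1) order_refl that(2)] .
        show "norm (u t - u s) \<le> R / 4 * exp (- \<mu> * s) * (t - s) powr \<beta>"
          if st: "0 \<le> s" "s \<le> t" "t \<le> ?T" "t - s \<le> 1" for s t
        proof (rule order_trans[OF bounds(2)[OF st] mult_left_mono])
          show "(t - s) powr b \<le> (t - s) powr \<beta>"
            using st params by (intro powr_mono') auto
        qed (use R in auto)
      qed (use R eta fine in auto)
    qed
    moreover obtain n where "real n * \<eta> \<ge> N"
      using reals_Archimedean3[OF eta(1)] less_imp_le by blast
    ultimately have "small_on R N u" by (metis min.absorb2)
    then have "norm (u t0) \<le> R * exp (- \<mu> * t0)" using t0 by (auto simp: small_on_def N_def)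
    also have "\<dots> \<le> 1 * exp (- \<mu> * t0)" using R by (intro mult_right_mono) auto
    finally show "norm (u t0) \<le> exp (- \<mu> * t0)" by simp
  qed
qed

end

section \<open>Growth of paths\<close>

text \<open>Kolmogorov chaining: at the level \<open>k\<close> comparable to \<open>y - x\<close>
  the dyadic points to the left of \<open>x\<close> and \<open>y\<close> are equal or adjacent, and
  refining from them to \<open>x\<close> and \<open>y\<close> costs a geometric series each.\<close>

lemma dyadic_chaining_unit:
  fixes v :: "real \<Rightarrow> 'a::real_normed_vector"
  assumes b: "b > 0" and \<kappa>: "\<kappa> \<ge> 0" and cont: "continuous_on {0..1} v"
    and incr: "\<And>k j. j < 2 ^ k \<Longrightarrow> norm (v (real (Suc j) / 2 ^ k) - v (real j / 2 ^ k)) \<le> \<kappa> * (2 powr (- b)) ^ k"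
    and xy: "0 \<le> x" "x \<le> y" "y \<le> 1"
  shows "norm (v y - v x) \<le> \<kappa> * ((1 + 2 * 2 powr (- b) / (1 - 2 powr (- b))) * 2 powr b) * (y - x) powr b"
proof (cases "x = y")
  case False
  define q :: real where "q = 2 powr (- b)"
  have q: "0 < q" "q < 1" using b powr_less_mono[of "- b" 0 2] by (auto simp: q_def)
  \<comment> \<open>Index of the dyadic point of level \<open>k\<close> to the left of
    \<open>z\<close>; from one level to the next this point stays or moves by one step of the finer
    grid.\<close>
  define a where "a k z = nat \<lfloor>2 ^ k * z\<rfloor>" for k and z :: real
  have a: "real (a k z) \<le> 2 ^ k * z" "2 ^ k * z < real (a k z) + 1" if "0 \<le> z" for k z
    using that by (simp_all add: a_def)
  define p where "p k z = real (a k z) / 2 ^ k" for k z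
  have step: "norm (v (p (Suc k) z) - v (p k z)) \<le> \<kappa> * q ^ Suc k" if z: "0 \<le> z" "z \<le> 1" for k z
  proof -
    have "real (2 * a k z) \<le> 2 ^ Suc k * z" "2 ^ Suc k * z < real (2 * a k z) + 2"
      using a[OF z(1), of k] by auto
    with a[OF z(1), of "Suc k"] have "real (2 * a k z) < real (a (Suc k) z) + 1" "real (a (Suc k) z) < real (2 * a k z) + 2"
      by linarith+
    then have "a (Suc k) z = 2 * a k z \<or> a (Suc k) z = Suc (2 * a k z)" by linarith
    then show ?thesis
    proof
      assume "a (Suc k) z = 2 * a k z"
      then have "p (Suc k) z = p k z" by (simp add: p_def)
      then show ?thesis using \<kappa> q by simp
    next
      assume A: "a (Suc k) z = Suc (2 * a k z)"
      have "2 ^ Suc k * z \<le> 2 ^ Suc k * 1" by (rule mult_left_mono[OF z(2)]) simp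
      from order_trans[OF a(1)[OF z(1)] this] have "real (a (Suc k) z) \<le> real (2 ^ Suc k)" by simp
      then have "2 * a k z < 2 ^ Suc k" unfolding of_nat_le_iff A by simp
      from incr[OF this] show ?thesis by (simp add: p_def A q_def)
    qed
  qed
  have tail: "norm (v z - v (p k z)) \<le> \<kappa> * q ^ k * (q / (1 - q))" if z: "0 \<le> z" "z \<le> 1" for k z
  proof -
    \<comment> \<open>The geometric sum is kept as a difference of two tails, which turns the
      induction step into an identity; dropping the subtracted tail makes the bound uniform in
      \<open>n\<close>.\<close>
    have "norm (v (p (k + n) z) - v (p k z)) \<le> \<kappa> * q ^ k * (q / (1 - q)) - \<kappa> * q ^ (k + n) * (q / (1 - q))" for n
    proof (induction n)
      case (Suc n)
      have "norm (v (p (k + Suc n) z) - v (p k z)) \<le> norm (v (p (Suc (k + n)) z) - v (p (k + n) z)) + norm (v (p (k + n) z) - v (p k z))"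
        using norm_triangle_ineq[of "v (p (Suc (k + n)) z) - v (p (k + n) z)" "v (p (k + n) z) - v (p k z)"] by simp
      also have "\<dots> \<le> \<kappa> * q ^ Suc (k + n) + (\<kappa> * q ^ k * (q / (1 - q)) - \<kappa> * q ^ (k + n) * (q / (1 - q)))"
        by (intro add_mono step z Suc)
      also have "\<dots> = \<kappa> * q ^ k * (q / (1 - q)) - \<kappa> * q ^ (k + Suc n) * (q / (1 - q))"
      proof -
        have "q / (1 - q) = q + q * (q / (1 - q))" using q by (simp add: field_simps)
        then have "\<kappa> * q ^ (k + n) * (q / (1 - q)) = \<kappa> * q ^ (k + n) * (q + q * (q / (1 - q)))"
          by (rule arg_cong)
        then show ?thesis by (simp only: distrib_left add_Suc_right power_Suc mult_ac)
      qed
      finally show ?case .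
    qed simp
    then have bound: "norm (v (p (k + n) z) - v (p k z)) \<le> \<kappa> * q ^ k * (q / (1 - q))" for n
      by (rule order_trans) (use \<kappa> q in simp)
    have pz: "p n z \<le> z" "z - (1 / 2) ^ n \<le> p n z" "0 \<le> p n z" for n
    proof -
      show "p n z \<le> z" using a(1)[OF z(1), of n] by (simp add: p_def pos_divide_le_eq mult.commute)
      have "z \<le> (real (a n z) + 1) / 2 ^ n"
        using a(2)[OF z(1), of n] by (simp add: pos_le_divide_eq mult.commute)
      then show "z - (1 / 2) ^ n \<le> p n z" by (simp add: p_def add_divide_distrib power_one_over)
      show "0 \<le> p n z" by (simp add: p_def)
    qed
    have "(\<lambda>n. p n z) \<longlonglongrightarrow> z"
    proof -
      have "(\<lambda>n. z - (1 / 2) ^ n) \<longlonglongrightarrow> z - 0" by (intro tendsto_intros LIMSEQ_power_zero) auto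
      then have lim: "(\<lambda>n. z - (1 / 2) ^ n) \<longlonglongrightarrow> z" by simp
      show ?thesis by (rule tendsto_sandwich[OF _ _ lim tendsto_const]) (use pz in auto)
    qed
    then have "(\<lambda>n. p (k + n) z) \<longlonglongrightarrow> z" using LIMSEQ_ignore_initial_segment[of _ z k] by (simp add: add.commute)
    moreover have "p (k + n) z \<in> {0..1}" for n using pz(1)[of "k + n"] pz(3)[of "k + n"] z by auto
    ultimately have "(\<lambda>n. v (p (k + n) z)) \<longlonglongrightarrow> v z"
      using z by (intro continuous_on_tendsto_compose[OF cont]) auto
    then have "(\<lambda>n. norm (v (p (k + n) z) - v (p k z))) \<longlonglongrightarrow> norm (v z - v (p k z))"
      by (intro tendsto_intros)
    then show ?thesis by (rule LIMSEQ_le_const2) (use bound in auto)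
  qed
  define d where "d = y - x"
  have d: "0 < d" "d \<le> 1" using xy False by (auto simp: d_def)
  obtain n where n: "(1 / 2) ^ n < d" using real_arch_pow_inv[of d "1 / 2"] d by auto
  \<comment> \<open>Minimality gives \<open>(1 / 2) ^ Suc k < d\<close> and
    \<open>d \<le> (1 / 2) ^ k\<close>; for \<open>k = 0\<close> the upper bound is
    \<open>d \<le> 1\<close>.\<close>
  define k where "k = (LEAST k. (1 / 2) ^ Suc k < d)"
  have "(1 / 2) ^ Suc n < d" using n power_decreasing[of n "Suc n" "1 / 2 :: real"] by linarith
  then have k1: "(1 / 2) ^ Suc k < d" unfolding k_def by (rule LeastI)
  have k2: "d \<le> (1 / 2) ^ k"
  proof (cases k)
    case (Suc l)
    then have "\<not> (1 / 2) ^ Suc l < d" using not_less_Least[of l "\<lambda>k. (1 / 2) ^ Suc k < d"] by (simp add: k_def)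
    then show ?thesis unfolding Suc by simp
  qed (use d in simp)
  have mid: "norm (v (p k y) - v (p k x)) \<le> \<kappa> * q ^ k"
  proof -
    have y0: "0 \<le> y" using xy by simp
    have "2 ^ k * y - 2 ^ k * x \<le> 2 ^ k * (1 / 2) ^ k"
      using mult_left_mono[OF k2, of "2 ^ k"] by (simp add: d_def algebra_simps)
    also have "\<dots> = 1" by (simp add: power_one_over)
    finally have "2 ^ k * y \<le> 2 ^ k * x + 1" by simp
    moreover have "2 ^ k * x \<le> 2 ^ k * y" using xy by simp
    ultimately have "real (a k y) < real (a k x) + 2" "real (a k x) < real (a k y) + 1"
      using a[OF xy(1), of k] a[OF y0, of k] by linarith+
    then have "a k y = a k x \<or> a k y = Suc (a k x)" by linarith
    then show ?thesis
    proof
      assume A: "a k y = Suc (a k x)"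
      have "2 ^ k * y \<le> 2 ^ k * 1" by (rule mult_left_mono[OF xy(3)]) simp
      from order_trans[OF a(1)[OF y0] this] have "real (a k y) \<le> real (2 ^ k)" by simp
      then have "a k x < 2 ^ k" unfolding of_nat_le_iff A by simp
      from incr[OF this] show ?thesis by (simp add: p_def A q_def)
    qed (use \<kappa> q in \<open>simp add: p_def\<close>)
  qed
  have "norm (v y - v x) \<le> norm (v y - v (p k y)) + norm (v (p k y) - v (p k x)) + norm (v x - v (p k x))"
    using norm_triangle_ineq4[of "v y - v (p k y) + (v (p k y) - v (p k x))" "v x - v (p k x)"]
      norm_triangle_ineq[of "v y - v (p k y)" "v (p k y) - v (p k x)"] by simp
  also have "\<dots> \<le> \<kappa> * q ^ k * (q / (1 - q)) + \<kappa> * q ^ k + \<kappa> * q ^ k * (q / (1 - q))"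
    using xy by (intro add_mono tail mid) auto
  also have "\<dots> = \<kappa> * (1 + 2 * q / (1 - q)) * q ^ k"
  proof -
    have "\<kappa> * Q * g + \<kappa> * Q + \<kappa> * Q * g = \<kappa> * (1 + 2 * g) * Q" for Q g by (simp add: algebra_simps)
    from this[of "q ^ k" "q / (1 - q)"] show ?thesis by simp
  qed
  also have "\<dots> \<le> \<kappa> * (1 + 2 * q / (1 - q)) * (2 powr b * d powr b)"
  proof (rule mult_left_mono)
    have "q ^ k = 2 powr b * ((1 / 2) ^ Suc k) powr b"
    proof -
      have "(1 / 2 :: real) ^ Suc k = 2 powr (- real (Suc k))"
        by (simp only: powr_minus powr_realpow zero_less_numeral power_one_over inverse_eq_divide)
      then have "2 powr b * ((1 / 2) ^ Suc k) powr b = 2 powr (b + - real (Suc k) * b)"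
        by (simp only: powr_powr powr_add)
      also have "b + - real (Suc k) * b = real k * - b" by (simp add: algebra_simps)
      finally show ?thesis by (simp add: q_def powr_power)
    qed
    also have "\<dots> \<le> 2 powr b * d powr b"
      using k1 b by (intro mult_left_mono powr_mono2) auto
    finally show "q ^ k \<le> 2 powr b * d powr b" .
  qed (use \<kappa> q in auto)
  finally show ?thesis by (simp add: q_def d_def mult_ac)
qed simp

text \<open>The 1 is the link between the two grid points, the quotient collects the two geometric
  tails of ratio \<open>2 powr (- b)\<close>, and \<open>2 powr b\<close> arises because the grid
  width may be almost twice the distance.\<close>

definition c_chain :: "real \<Rightarrow> real" where
  "c_chain b = (1 + 2 * 2 powr (- b) / (1 - 2 powr (- b))) * 2 powr b"

lemma c_chain_ge_1: "b > 0 \<Longrightarrow> c_chain b \<ge> 1"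
proof -
  assume b: "b > 0"
  have "2 powr (- b) < 1" using b powr_less_mono[of "- b" 0 2] by simp
  moreover have "2 powr b \<ge> 1" using b by (simp add: ge_one_powr_ge_zero)
  ultimately have "1 * 1 \<le> c_chain b" unfolding c_chain_def by (intro mult_mono) auto
  then show ?thesis by simp
qed

text \<open>Rescaling to \<open>{0..1}\<close>: for \<open>N \<ge> 1\<close> distances can only
  shrink, so the constant is free of \<open>N\<close>.\<close>

lemma dyadic_chaining:
  fixes w :: "real \<Rightarrow> 'a::real_normed_vector"
  assumes b: "b > 0" and \<kappa>: "\<kappa> \<ge> 0" and N: "N \<ge> 1" and cont: "continuous_on {0..N} w"
    and incr: "\<And>k j. j < 2 ^ k \<Longrightarrow>
      norm (w (real (Suc j) / 2 ^ k * N) - w (real j / 2 ^ k * N)) \<le> \<kappa> * (2 powr (- b)) ^ k"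
    and st: "s \<in> {0..N}" "t \<in> {0..N}"
  shows "norm (w s - w t) \<le> \<kappa> * c_chain b * \<bar>s - t\<bar> powr b"
proof -
  have *: "norm (w t - w s) \<le> \<kappa> * c_chain b * (t - s) powr b" if st: "0 \<le> s" "s \<le> t" "t \<le> N" for s t
  proof -
    have "continuous_on {0..1} (\<lambda>x. w (x * N))"
      by (rule continuous_on_compose2[OF cont]) (use N in \<open>auto intro!: continuous_intros simp: mult_left_le_one_le\<close>)
    from dyadic_chaining_unit[OF b \<kappa> this incr, of "s / N" "t / N"]
    have "norm (w t - w s) \<le> \<kappa> * c_chain b * (t / N - s / N) powr b"
      using st N by (simp add: c_chain_def divide_right_mono)
    also have "\<dots> \<le> \<kappa> * c_chain b * (t - s) powr b"
    proof (intro mult_left_mono powr_mono2)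
      show "t / N - s / N \<le> t - s"
        using st N by (simp add: diff_divide_distrib[symmetric] divide_le_eq mult_le_cancel_left1)
    qed (use b \<kappa> st N c_chain_ge_1[OF b] in \<open>auto simp: divide_right_mono\<close>)
    finally show ?thesis .
  qed
  show ?thesis
    using *[of s t] *[of t s] st by (cases "s \<le> t") (auto simp: norm_minus_commute abs_minus_commute)
qed

text \<open>Jensen's inequality for weights that need not sum to 1. With the weights
  \<open>(coord \<sigma> i)\<^sup>2\<close> it reduces moments of the norm to moments of single
  coordinates.\<close>

lemma sum_power_jensen:
  fixes p y :: "'i \<Rightarrow> real"
  assumes "finite F" "even m" "m > 0" "\<And>i. i \<in> F \<Longrightarrow> p i \<ge> 0"
  shows "(\<Sum>i\<in>F. p i * y i) ^ m \<le> (\<Sum>i\<in>F. p i) ^ (m - 1) * (\<Sum>i\<in>F. p i * y i ^ m)"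
proof (cases "(\<Sum>i\<in>F. p i) = 0")
  case True
  then have "\<forall>i\<in>F. p i = 0" using assms by (simp add: sum_nonneg_eq_0_iff)
  then show ?thesis using assms by (simp add: zero_power)
next
  case False
  define P where "P = (\<Sum>i\<in>F. p i)"
  have P: "P > 0" using False assms(4) sum_nonneg[of F p] by (simp add: P_def less_le)
  have "(\<Sum>i\<in>F. (p i / P) *\<^sub>R y i) ^ m \<le> (\<Sum>i\<in>F. (p i / P) * y i ^ m)"
    using False assms P
    by (intro convex_on_sum[OF _ _ convex_power_even[OF assms(2)]])
       (auto simp: sum_divide_distrib[symmetric] P_def)
  then have "((\<Sum>i\<in>F. p i * y i) / P) ^ m \<le> (\<Sum>i\<in>F. p i * y i ^ m) / P"
    by (simp add: sum_divide_distrib)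
  then have "((\<Sum>i\<in>F. p i * y i) / P) ^ m * P ^ m \<le> (\<Sum>i\<in>F. p i * y i ^ m) / P * P ^ m"
    using P by (intro mult_right_mono) auto
  also have "\<dots> = P ^ (m - 1) * (\<Sum>i\<in>F. p i * y i ^ m)"
    using P assms(3) by (cases m) (auto simp: field_simps)
  finally show ?thesis using P by (simp add: power_divide P_def)
qed

text \<open>The norm as a limit along a sequence, since both measurability and Fatou's lemma require
  countable limits rather than the net of finite sets.\<close>

lemma norm_sq_LIMSEQ: "(\<lambda>n. \<Sum>i\<in>{- int n..int n}. (coord u i)\<^sup>2) \<longlonglongrightarrow> (norm u)\<^sup>2"
proof -
  have "filterlim (\<lambda>n. {- int n..int n}) (finite_subsets_at_top UNIV) sequentially"
    unfolding filterlim_finite_subsets_at_top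
  proof (intro allI impI)
    fix X :: "int set" assume X: "finite X \<and> X \<subseteq> UNIV"
    define k where "k = Max (abs ` X)"
    have k: "\<bar>x\<bar> \<le> k" if "x \<in> X" for x using X that by (simp add: k_def)
    show "\<forall>\<^sub>F n in sequentially. finite {- int n..int n} \<and> X \<subseteq> {- int n..int n} \<and> {- int n..int n} \<subseteq> UNIV"
      using eventually_ge_at_top[of "nat k"]
    proof eventually_elim
      case (elim n)
      have "x \<in> {- int n..int n}" if "x \<in> X" for x using k[OF that] elim by auto
      then show ?case by blast
    qed
  qed
  from filterlim_compose[OF infsum_tendsto[OF coord_sq_summable[of u]] this] show ?thesis
    unfolding norm_ell2_sq .
qed

section \<open>Measurability on the path space\<close>

lemma openin_compact_open_C0_subset: "openin compact_open_C0 G \<Longrightarrow> G \<subseteq> C0"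
  using openin_subset[of compact_open_C0 G]
  unfolding compact_open_C0_def topology_generated_by_topspace by blast

lemma space_borel_C0: "space borel_C0 = C0"
  unfolding borel_C0_def by (rule space_measure_of) (use openin_compact_open_C0_subset in blast)

lemma sets_borel_C0: "openin compact_open_C0 G \<Longrightarrow> G \<in> sets borel_C0"
  unfolding borel_C0_def by (rule in_measure_of) (use openin_compact_open_C0_subset in blast)+

text \<open>The singleton \<open>{t}\<close> is compact, so preimages of open sets under evaluation
  are subbasic sets of the compact open topology.\<close>

lemma evaluation_measurable: "(\<lambda>\<omega>. coord (\<omega> t) i) \<in> borel_measurable borel_C0"
proof (rule borel_measurableI)
  fix U :: "real set" assume "open U"
  then have V: "open ((\<lambda>u. coord u i) -` U)" by (rule open_vimage[OF _ continuous_on_coord])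
  have "(\<lambda>\<omega>. coord (\<omega> t) i) -` U \<inter> space borel_C0 = {\<omega>\<in>C0. \<omega> ` {t} \<subseteq> (\<lambda>u. coord u i) -` U}"
    by (auto simp: space_borel_C0)
  moreover have "openin compact_open_C0 \<dots>"
    unfolding compact_open_C0_def
    by (rule topology_generated_by_Basis, rule CollectI, intro exI conjI) (rule refl compact_sing V)+
  ultimately show "(\<lambda>\<omega>. coord (\<omega> t) i) -` U \<inter> space borel_C0 \<in> sets borel_C0"
    by (simp add: sets_borel_C0)
qed

lemma increment_measurable [measurable]: "(\<lambda>\<omega>. norm (\<omega> s - \<omega> t)) \<in> borel_measurable borel_C0"
proof -
  have "(\<lambda>\<omega>. (norm (\<omega> s - \<omega> t))\<^sup>2) \<in> borel_measurable borel_C0"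
  proof (rule borel_measurable_LIMSEQ_real)
    show "(\<lambda>n. \<Sum>i\<in>{- int n..int n}. (coord (\<omega> s) i - coord (\<omega> t) i)\<^sup>2) \<longlonglongrightarrow> (norm (\<omega> s - \<omega> t))\<^sup>2" for \<omega>
      using norm_sq_LIMSEQ[of "\<omega> s - \<omega> t"] by simp
    show "(\<lambda>\<omega>. \<Sum>i\<in>{- int n..int n}. (coord (\<omega> s) i - coord (\<omega> t) i)\<^sup>2) \<in> borel_measurable borel_C0" for n
      using evaluation_measurable by measurable
  qed
  then have "(\<lambda>\<omega>. sqrt ((norm (\<omega> s - \<omega> t))\<^sup>2)) \<in> borel_measurable borel_C0" by measurable
  then show ?thesis by simp
qed

text \<open>Natural constants, natural intervals and rational times suffice by continuity, which
  presents the set by countably many measurable conditions.\<close>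

lemma C0_Hoelder_countable:
  assumes \<gamma>: "\<gamma> > 0"
  shows "C0_Hoelder \<gamma> = {\<omega>\<in>C0. \<forall>n::nat. \<exists>c::nat. \<forall>s\<in>\<rat> \<inter> {- real n..real n}. \<forall>t\<in>\<rat> \<inter> {- real n..real n}.
    norm (\<omega> s - \<omega> t) \<le> real c * \<bar>s - t\<bar> powr \<gamma>}" (is "_ = ?R")
proof (intro equalityI subsetI)
  fix \<omega> assume w: "\<omega> \<in> C0_Hoelder \<gamma>"
  have "\<exists>c::nat. \<forall>s\<in>\<rat> \<inter> {- real n..real n}. \<forall>t\<in>\<rat> \<inter> {- real n..real n}.
    norm (\<omega> s - \<omega> t) \<le> real c * \<bar>s - t\<bar> powr \<gamma>" for n
  proof -
    obtain C where C: "\<forall>s\<in>{- real n..real n}. \<forall>t\<in>{- real n..real n}. dist (\<omega> s) (\<omega> t) \<le> C * \<bar>s - t\<bar> powr \<gamma>"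
      using w unfolding C0_Hoelder_def Hoelder_on_def by blast
    have "norm (\<omega> s - \<omega> t) \<le> real (nat \<lceil>C\<rceil>) * \<bar>s - t\<bar> powr \<gamma>" if "s \<in> {- real n..real n}" "t \<in> {- real n..real n}" for s t
    proof -
      have "norm (\<omega> s - \<omega> t) \<le> C * \<bar>s - t\<bar> powr \<gamma>" using C that by (simp add: dist_norm)
      also have "\<dots> \<le> real (nat \<lceil>C\<rceil>) * \<bar>s - t\<bar> powr \<gamma>" by (intro mult_right_mono real_nat_ceiling_ge) auto
      finally show ?thesis .
    qed
    then show ?thesis by blast
  qed
  then show "\<omega> \<in> ?R" using w by (auto simp: C0_Hoelder_def)
next
  fix \<omega> assume w: "\<omega> \<in> ?R"
  then have cont: "continuous_on UNIV \<omega>" by (simp add: C0_def)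
  have "Hoelder_on \<gamma> {a..b} \<omega>" for a b
  proof -
    \<comment> \<open>The 1 leaves room: rational sequences converging to points of
      \<open>{a..b}\<close> eventually lie in \<open>{- real n..real n}\<close>.\<close>
    define n where "n = nat \<lceil>max \<bar>a\<bar> \<bar>b\<bar> + 1\<rceil>"
    have n: "max \<bar>a\<bar> \<bar>b\<bar> + 1 \<le> real n" unfolding n_def by (rule real_nat_ceiling_ge)
    obtain c :: nat where c: "\<forall>s\<in>\<rat> \<inter> {- real n..real n}. \<forall>t\<in>\<rat> \<inter> {- real n..real n}.
        norm (\<omega> s - \<omega> t) \<le> real c * \<bar>s - t\<bar> powr \<gamma>" using w by blast
    have "dist (\<omega> s) (\<omega> t) \<le> real c * \<bar>s - t\<bar> powr \<gamma>" if st: "s \<in> {a..b}" "t \<in> {a..b}" for s t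
    proof -
      obtain X where X: "\<And>k. X k \<in> \<rat>" "X \<longlonglongrightarrow> s"
        using closure_sequential[of s \<rat>] Rats_closure_real by auto
      obtain Y where Y: "\<And>k. Y k \<in> \<rat>" "Y \<longlonglongrightarrow> t"
        using closure_sequential[of t \<rat>] Rats_closure_real by auto
      have in_range: "\<forall>\<^sub>F k in sequentially. Z k \<in> {- real n..real n}" if "Z \<longlonglongrightarrow> z" "z \<in> {a..b}" for Z z
      proof -
        have l: "- real n < z" "z < real n" using that(2) n by auto
        show ?thesis
          using order_tendstoD(1)[OF that(1) l(1)] order_tendstoD(2)[OF that(1) l(2)]
          by eventually_elim auto
      qed
      have lim1: "(\<lambda>k. norm (\<omega> (X k) - \<omega> (Y k))) \<longlonglongrightarrow> norm (\<omega> s - \<omega> t)"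
        using continuous_on_tendsto_compose[OF cont X(2)] continuous_on_tendsto_compose[OF cont Y(2)]
        by (intro tendsto_intros) auto
      have lim2: "(\<lambda>k. real c * \<bar>X k - Y k\<bar> powr \<gamma>) \<longlonglongrightarrow> real c * \<bar>s - t\<bar> powr \<gamma>"
        using \<gamma> by (intro tendsto_intros X Y) auto
      have "\<forall>\<^sub>F k in sequentially. norm (\<omega> (X k) - \<omega> (Y k)) \<le> real c * \<bar>X k - Y k\<bar> powr \<gamma>"
        using in_range[OF X(2) st(1)] in_range[OF Y(2) st(2)] by eventually_elim (use c X Y in auto)
      then show ?thesis unfolding dist_norm by (rule tendsto_le[OF sequentially_bot lim2 lim1])
    qed
    then show ?thesis unfolding Hoelder_on_def by blast
  qed
  then show "\<omega> \<in> C0_Hoelder \<gamma>" using w by (auto simp: C0_Hoelder_def)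
qed

lemma C0_Hoelder_measurable:
  assumes "\<gamma> > 0"
  shows "C0_Hoelder \<gamma> \<in> sets borel_C0"
proof -
  have count: "countable (\<rat> \<inter> {- real n..real n})" for n
    using countable_rat by (rule countable_subset[rotated]) auto
  have "{\<omega>\<in>space borel_C0. \<forall>n::nat. \<exists>c::nat. \<forall>s\<in>\<rat> \<inter> {- real n..real n}. \<forall>t\<in>\<rat> \<inter> {- real n..real n}.
    norm (\<omega> s - \<omega> t) \<le> real c * \<bar>s - t\<bar> powr \<gamma>} \<in> sets borel_C0"
    using count by measurable
  then show ?thesis unfolding C0_Hoelder_countable[OF assms] space_borel_C0 .
qed

definition gaussian_moment :: "nat \<Rightarrow> real" where
  "gaussian_moment m = fact (2 * m) / (2 ^ m * fact m)"

text \<open>\<open>gaussian_moment m\<close> is the double factorial (2m-1)!!, the moment of order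
  \<open>2 * m\<close> of the standard normal law; scaling by the variance gives the general case.
  The degenerate law of variance 0 is treated separately.\<close>

lemma centered_gaussian_moments:
  assumes "prob_space M" and X: "centered_gaussian M X"
  shows "integrable M (\<lambda>w. (X w)\<^sup>2)"
    and "m > 0 \<Longrightarrow> (\<integral>\<^sup>+w. ennreal (X w ^ (2 * m)) \<partial>M) \<le> ennreal (gaussian_moment m * (\<integral>w. (X w)\<^sup>2 \<partial>M) ^ m)"
proof -
  have [measurable]: "X \<in> borel_measurable M" using X by (simp add: centered_gaussian_def)
  have "integrable M (\<lambda>w. (X w)\<^sup>2) \<and> (m > 0 \<longrightarrow>
    (\<integral>\<^sup>+w. ennreal (X w ^ (2 * m)) \<partial>M) \<le> ennreal (gaussian_moment m * (\<integral>w. (X w)\<^sup>2 \<partial>M) ^ m))"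
  proof (cases "AE w in M. X w = 0")
    case True
    have "integrable M (\<lambda>w. (X w)\<^sup>2) \<longleftrightarrow> integrable M (\<lambda>w. 0 :: real)"
      using True by (intro integrable_cong_AE) auto
    moreover have "(\<integral>\<^sup>+w. ennreal (X w ^ (2 * m)) \<partial>M) = (\<integral>\<^sup>+w. 0 \<partial>M)" if "m > 0"
      using True that by (intro nn_integral_cong_AE) auto
    ultimately show ?thesis by simp
  next
    case False
    then obtain s where s: "s > 0" "distributed M lborel X (normal_density 0 s)"
      using X unfolding centered_gaussian_def by blast
    have moment: "(\<integral>\<^sup>+w. ennreal (X w ^ (2 * k)) \<partial>M) = ennreal (gaussian_moment k * (s\<^sup>2) ^ k)" for k
    proof -
      have "(\<integral>\<^sup>+w. ennreal (X w ^ (2 * k)) \<partial>M)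
        = (\<integral>\<^sup>+x. ennreal (normal_density 0 s x) * ennreal (x ^ (2 * k)) \<partial>lborel)"
        by (rule distributed_nn_integral[OF s(2), symmetric]) simp
      also have "\<dots> = (\<integral>\<^sup>+x. ennreal (normal_density 0 s x * x ^ (2 * k)) \<partial>lborel)"
        by (intro nn_integral_cong) (simp add: ennreal_mult)
      also have "\<dots> = ennreal (fact (2 * k) / ((2 / s\<^sup>2) ^ k * fact k))"
      proof -
        have hb: "has_bochner_integral lborel (\<lambda>x. normal_density 0 s x * x ^ (2 * k)) (fact (2 * k) / ((2 / s\<^sup>2) ^ k * fact k))"
          using normal_moment_even[OF s(1), of 0 k] by (simp only: diff_zero)
        show ?thesis
          using nn_integral_eq_integral[OF integrable.intros[OF hb]]
          unfolding has_bochner_integral_integral_eq[OF hb] by simp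
      qed
      also have "fact (2 * k) / ((2 / s\<^sup>2) ^ k * fact k) = gaussian_moment k * (s\<^sup>2) ^ k"
        using s by (simp add: gaussian_moment_def power_divide field_simps)
      finally show ?thesis .
    qed
    have "gaussian_moment 1 = 1" by (simp add: gaussian_moment_def fact_2)
    then have two: "(\<integral>\<^sup>+w. ennreal ((X w)\<^sup>2) \<partial>M) = ennreal (s\<^sup>2)"
      using moment[of 1] by simp
    have int: "integrable M (\<lambda>w. (X w)\<^sup>2)"
      by (rule integrableI_nn_integral_finite[OF _ _ two]) auto
    have "ennreal (\<integral>w. (X w)\<^sup>2 \<partial>M) = ennreal (s\<^sup>2)"
      using nn_integral_eq_integral[OF int] two by simp
    then have "(\<integral>w. (X w)\<^sup>2 \<partial>M) = s\<^sup>2" by simp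
    with int moment[of m] show ?thesis by simp
  qed
  then show "integrable M (\<lambda>w. (X w)\<^sup>2)"
    and "m > 0 \<Longrightarrow> (\<integral>\<^sup>+w. ennreal (X w ^ (2 * m)) \<partial>M) \<le> ennreal (gaussian_moment m * (\<integral>w. (X w)\<^sup>2 \<partial>M) ^ m)"
    by auto
qed

text \<open>An increment is a linear combination of the process, hence Gaussian; in its variance the
  covariances cancel down to \<open>\<bar>t - s\<bar> powr (2 * H)\<close>, which determines all
  even moments.\<close>

lemma fBm_increment_moment:
  assumes M: "prob_space M" and b: "fBm M H b" and m: "m > 0"
  shows "(\<lambda>w. b t w - b s w) \<in> borel_measurable M"
    and "(\<integral>\<^sup>+w. ennreal ((b t w - b s w) ^ (2 * m)) \<partial>M) \<le> ennreal (gaussian_moment m * \<bar>t - s\<bar> powr (2 * H * real m))"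
proof -
  have gauss: "centered_gaussian M (\<lambda>w. \<Sum>u\<in>J. c u * b u w)" if "finite J" for J c
    using b that unfolding fBm_def centered_gaussian_process_def by blast
  have g1: "centered_gaussian M (b u)" for u
    using gauss[of "{u}" "\<lambda>_. 1"] by simp
  then have meas: "b u \<in> borel_measurable M" for u by (simp add: centered_gaussian_def)
  show "(\<lambda>w. b t w - b s w) \<in> borel_measurable M" by (intro borel_measurable_diff meas)
  show "(\<integral>\<^sup>+w. ennreal ((b t w - b s w) ^ (2 * m)) \<partial>M) \<le> ennreal (gaussian_moment m * \<bar>t - s\<bar> powr (2 * H * real m))"
  \<comment> \<open>The increment is a combination over the index set \<open>{s, t}\<close>, which
    collapses for equal times; there both sides vanish because \<open>m > 0\<close>.\<close>
  proof (cases "s = t")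
    case True
    then show ?thesis using m by (simp add: zero_power)
  next
    case False
    have "(\<lambda>w. \<Sum>u\<in>{s, t}. (if u = t then 1 else - 1) * b u w) = (\<lambda>w. b t w - b s w)"
      using False by (auto simp: fun_eq_iff)
    with gauss[of "{s, t}" "\<lambda>u. if u = t then 1 else - 1"]
    have diff: "centered_gaussian M (\<lambda>w. b t w - b s w)" by simp
    have i2: "integrable M (\<lambda>w. (b u w)\<^sup>2)" for u by (rule centered_gaussian_moments(1)[OF M g1])
    have ip: "integrable M (\<lambda>w. b s w * b t w)"
    proof (rule Bochner_Integration.integrable_bound)
      show "integrable M (\<lambda>w. (b s w)\<^sup>2 + (b t w)\<^sup>2)" by (intro Bochner_Integration.integrable_add i2)
      have "\<bar>x * y\<bar> \<le> x\<^sup>2 + y\<^sup>2" for x y :: real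
        using sum_squares_bound[of "\<bar>x\<bar>" "\<bar>y\<bar>"] mult_nonneg_nonneg[OF abs_ge_zero[of x] abs_ge_zero[of y]]
        unfolding abs_mult power2_abs by linarith
      then show "AE w in M. norm (b s w * b t w) \<le> norm ((b s w)\<^sup>2 + (b t w)\<^sup>2)"
        by (intro AE_I2) (simp only: real_norm_def abs_of_nonneg sum_power2_ge_zero)
    qed (intro borel_measurable_times meas)
    have cov: "(\<integral>w. b u w * b v w \<partial>M) = (\<bar>u\<bar> powr (2 * H) + \<bar>v\<bar> powr (2 * H) - \<bar>v - u\<bar> powr (2 * H)) / 2" for u v
      using b unfolding fBm_def by blast
    have sq: "(\<integral>w. (b u w)\<^sup>2 \<partial>M) = \<bar>u\<bar> powr (2 * H)" for u
      using cov[of u u] by (simp add: power2_eq_square)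
    have alg: "x + y - 2 * ((y + x - z) / 2) = z" for x y z :: real by (simp add: field_simps)
    have expand: "(b t w - b s w)\<^sup>2 = (b t w)\<^sup>2 + (b s w)\<^sup>2 - 2 * (b s w * b t w)" for w
      by (simp add: power2_eq_square algebra_simps)
    have "(\<integral>w. (b t w - b s w)\<^sup>2 \<partial>M) = (\<integral>w. (b t w)\<^sup>2 \<partial>M) + (\<integral>w. (b s w)\<^sup>2 \<partial>M) - 2 * (\<integral>w. b s w * b t w \<partial>M)"
      unfolding expand
      by (simp only: Bochner_Integration.integral_diff Bochner_Integration.integral_add integral_mult_right_zero
          Bochner_Integration.integrable_add integrable_mult_right i2 ip)
    then have var: "(\<integral>w. (b t w - b s w)\<^sup>2 \<partial>M) = \<bar>t - s\<bar> powr (2 * H)"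
      by (simp only: sq cov alg)
    have pow: "(\<bar>t - s\<bar> powr (2 * H)) ^ m = \<bar>t - s\<bar> powr (2 * H * real m)"
      using powr_power[of "\<bar>t - s\<bar>" "2 * H" m] False by (simp add: mult.commute)
    show ?thesis
      using centered_gaussian_moments(2)[OF M diff m] unfolding var pow .
  qed
qed

text \<open>For truncations to finitely many coordinates Jensen's inequality with weights of total
  mass at most \<open>(norm \<sigma>)\<^sup>2\<close> gives a bound independent of the truncation;
  Fatou's lemma removes it.\<close>

lemma ell2_fBm_increment_moment:
  assumes B: "ell2_fBm M H \<sigma> B" and m: "m > 0" "even m"
  shows "(\<integral>\<^sup>+w. ennreal (norm (B w t - B w s) ^ (2 * m)) \<partial>M)
    \<le> ennreal (gaussian_moment m * norm \<sigma> ^ (2 * m) * \<bar>t - s\<bar> powr (2 * H * real m))"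
proof -
  from B obtain b :: "int \<Rightarrow> real \<Rightarrow> 'a \<Rightarrow> real" where M: "prob_space M" and b: "\<And>i. fBm M H (b i)"
    and repr: "\<And>t. AE w in M. ((\<lambda>i. (coord \<sigma> i * b i t w) *\<^sub>R ebasis i) has_sum B w t) UNIV"
    unfolding ell2_fBm_def by blast
  have coordB: "coord u j = coord \<sigma> j * b j t w"
    if "((\<lambda>i. (coord \<sigma> i * b i t w) *\<^sub>R ebasis i) has_sum u) UNIV" for t w u j
  proof -
    have "((\<lambda>i. ebasis j \<bullet> (coord \<sigma> i * b i t w) *\<^sub>R ebasis i) has_sum (ebasis j \<bullet> u)) UNIV"
      by (rule has_sum_bounded_linear[OF bounded_linear_inner_right that])
    then have "coord u j = (\<Sum>\<^sub>\<infinity>i. ebasis j \<bullet> (coord \<sigma> i * b i t w) *\<^sub>R ebasis i)"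
      by (simp add: infsumI inner_ebasis)
    also have "\<dots> = (\<Sum>\<^sub>\<infinity>i\<in>{j}. coord \<sigma> i * b i t w)"
      by (rule infsum_cong_neutral) (auto simp: inner_ebasis ebasis.rep_eq)
    finally show ?thesis by simp
  qed
  define X where "X i w = b i t w - b i s w" for i w
  have [measurable]: "X i \<in> borel_measurable M" for i
    unfolding X_def by (rule fBm_increment_moment(1)[OF M b m(1)])
  define p where "p i = (coord \<sigma> i)\<^sup>2" for i
  define d where "d = \<bar>t - s\<bar> powr (2 * H * real m)"
  define F where "F n = {- int n..int n}" for n
  define g where "g n w = (\<Sum>i\<in>F n. p i * (X i w)\<^sup>2) ^ m" for n w
  have gm: "gaussian_moment m \<ge> 0" by (simp add: gaussian_moment_def)
  \<comment> \<open>The series represents \<open>B\<close> at each fixed time only almost surely; an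
    increment involves two times, so the exceptional set stays null.\<close>
  have lim: "AE w in M. (\<lambda>n. ennreal (g n w)) \<longlonglongrightarrow> ennreal (norm (B w t - B w s) ^ (2 * m))"
    using repr[of t] repr[of s]
  proof eventually_elim
    case (elim w)
    have "coord (B w t - B w s) i = coord \<sigma> i * X i w" for i
      using coordB[OF elim(1)] coordB[OF elim(2)] by (simp add: X_def algebra_simps)
    then have "g n w = (\<Sum>i\<in>{- int n..int n}. (coord (B w t - B w s) i)\<^sup>2) ^ m" for n
      by (simp only: g_def F_def p_def power_mult_distrib)
    moreover have "(\<lambda>n. (\<Sum>i\<in>{- int n..int n}. (coord (B w t - B w s) i)\<^sup>2) ^ m) \<longlonglongrightarrow> ((norm (B w t - B w s))\<^sup>2) ^ m"
      by (intro tendsto_power norm_sq_LIMSEQ)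
    ultimately show ?case by (simp only: power_mult tendsto_ennrealI)
  qed
  have bound: "(\<integral>\<^sup>+w. ennreal (g n w) \<partial>M) \<le> ennreal (gaussian_moment m * norm \<sigma> ^ (2 * m) * d)" for n
  proof -
    define P where "P = (\<Sum>i\<in>F n. p i)"
    have P: "0 \<le> P" "P \<le> (norm \<sigma>)\<^sup>2"
      using sum_coord_sq_le_norm[of "F n" \<sigma>] by (auto simp: P_def p_def F_def intro: sum_nonneg)
    have "g n w \<le> P ^ (m - 1) * (\<Sum>i\<in>F n. p i * X i w ^ (2 * m))" for w
      using sum_power_jensen[of "F n" m p "\<lambda>i. (X i w)\<^sup>2"] m
      by (simp add: g_def P_def p_def F_def power_mult)
    then have "(\<integral>\<^sup>+w. ennreal (g n w) \<partial>M) \<le> (\<integral>\<^sup>+w. ennreal (P ^ (m - 1) * (\<Sum>i\<in>F n. p i * X i w ^ (2 * m))) \<partial>M)"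
      by (intro nn_integral_mono ennreal_leI)
    also have "\<dots> = (\<integral>\<^sup>+w. (\<Sum>i\<in>F n. ennreal (P ^ (m - 1) * p i) * ennreal (X i w ^ (2 * m))) \<partial>M)"
    proof (intro nn_integral_cong)
      fix w
      have "ennreal (P ^ (m - 1) * (\<Sum>i\<in>F n. p i * X i w ^ (2 * m))) = ennreal (\<Sum>i\<in>F n. (P ^ (m - 1) * p i) * X i w ^ (2 * m))"
        by (simp add: sum_distrib_left mult.assoc)
      also have "\<dots> = (\<Sum>i\<in>F n. ennreal ((P ^ (m - 1) * p i) * X i w ^ (2 * m)))"
        using P by (intro sum_ennreal[symmetric]) (auto simp: p_def)
      also have "\<dots> = (\<Sum>i\<in>F n. ennreal (P ^ (m - 1) * p i) * ennreal (X i w ^ (2 * m)))"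
        using P by (intro sum.cong ennreal_mult refl) (auto simp: p_def)
      finally show "ennreal (P ^ (m - 1) * (\<Sum>i\<in>F n. p i * X i w ^ (2 * m)))
        = (\<Sum>i\<in>F n. ennreal (P ^ (m - 1) * p i) * ennreal (X i w ^ (2 * m)))" .
    qed
    also have "\<dots> = (\<Sum>i\<in>F n. ennreal (P ^ (m - 1) * p i) * (\<integral>\<^sup>+w. ennreal (X i w ^ (2 * m)) \<partial>M))"
      by (simp add: nn_integral_sum nn_integral_cmult)
    also have "\<dots> \<le> (\<Sum>i\<in>F n. ennreal (P ^ (m - 1) * p i) * ennreal (gaussian_moment m * d))"
      unfolding X_def d_def by (intro sum_mono mult_left_mono fBm_increment_moment(2)[OF M b m(1)]) auto
    also have "\<dots> = (\<Sum>i\<in>F n. ennreal (P ^ (m - 1) * p i * (gaussian_moment m * d)))"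
      using P gm by (intro sum.cong ennreal_mult[symmetric] refl) (auto simp: p_def d_def)
    also have "\<dots> = ennreal (\<Sum>i\<in>F n. P ^ (m - 1) * p i * (gaussian_moment m * d))"
      using P gm by (intro sum_ennreal) (auto simp: p_def d_def)
    also have "(\<Sum>i\<in>F n. P ^ (m - 1) * p i * (gaussian_moment m * d)) = P ^ m * (gaussian_moment m * d)"
    proof -
      have "P ^ (m - 1) * P = P ^ m" using m by (simp add: power_eq_if mult.commute)
      then show ?thesis by (simp add: sum_distrib_left[symmetric] sum_distrib_right[symmetric] P_def)
    qed
    also have "ennreal \<dots> \<le> ennreal (gaussian_moment m * norm \<sigma> ^ (2 * m) * d)"
    proof (rule ennreal_leI)
      have "P ^ m * (gaussian_moment m * d) \<le> ((norm \<sigma>)\<^sup>2) ^ m * (gaussian_moment m * d)"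
        using P gm by (intro mult_right_mono power_mono) (auto simp: d_def)
      then show "P ^ m * (gaussian_moment m * d) \<le> gaussian_moment m * norm \<sigma> ^ (2 * m) * d"
        unfolding power_mult by (simp only: mult_ac)
    qed
    finally show ?thesis .
  qed
  have "(\<integral>\<^sup>+w. ennreal (norm (B w t - B w s) ^ (2 * m)) \<partial>M) = (\<integral>\<^sup>+w. liminf (\<lambda>n. ennreal (g n w)) \<partial>M)"
    using lim by (intro nn_integral_cong_AE) (auto elim!: eventually_mono dest!: lim_imp_Liminf[rotated])
  also have "\<dots> \<le> liminf (\<lambda>n. \<integral>\<^sup>+w. ennreal (g n w) \<partial>M)"
    by (rule nn_integral_liminf) (simp add: g_def)
  also have "\<dots> \<le> liminf (\<lambda>n. ennreal (gaussian_moment m * norm \<sigma> ^ (2 * m) * d))"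
    by (intro Liminf_mono always_eventually allI bound)
  finally show ?thesis by (simp add: Liminf_const d_def)
qed

text \<open>The factor \<open>(2 powr b) ^ k\<close> normalises level \<open>k\<close> for Hoelder
  exponent \<open>b\<close>, and the power \<open>p\<close> makes the expectation a moment.
  \<open>Suc n\<close> keeps the interval length at least 1, as \<open>dyadic_chaining\<close>
  requires.\<close>

definition dyadic_term :: "real \<Rightarrow> nat \<Rightarrow> nat \<Rightarrow> nat \<Rightarrow> nat \<Rightarrow> (real \<Rightarrow> ell2) \<Rightarrow> real" where
  "dyadic_term b p n k j \<omega> =
    ((2 powr b) ^ k * norm (\<omega> (real (Suc j) / 2 ^ k * real (Suc n)) - \<omega> (real j / 2 ^ k * real (Suc n)))) ^ p"

text \<open>Finiteness of this sum bounds the \<open>b\<close>-Hoelder seminorms over all intervals \<open>{0..T}\<close>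
  by a constant times \<open>exp (\<theta> * T)\<close>, while its expectation only involves moments of increments.\<close>

definition dyadic_sum :: "real \<Rightarrow> nat \<Rightarrow> real \<Rightarrow> (real \<Rightarrow> ell2) \<Rightarrow> ennreal" where
  "dyadic_sum b p \<theta> \<omega> = (\<Sum>n. ennreal (exp (- \<theta> * real n)) * (\<Sum>k. \<Sum>j<2 ^ k. ennreal (dyadic_term b p n k j \<omega>)))"

lemma dyadic_term_measurable [measurable]: "dyadic_term b p n k j \<in> borel_measurable borel_C0"
  unfolding dyadic_term_def by measurable

lemma dyadic_sum_measurable [measurable]: "dyadic_sum b p \<theta> \<in> borel_measurable borel_C0"
  unfolding dyadic_sum_def by measurable

text \<open>Every dyadic increment is one term of the sum, so its finiteness bounds them all at once
  after the weight in \<open>n\<close> is undone; chaining does the rest.\<close>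

lemma dyadic_sum_tempered:
  assumes b: "b > 0" and p: "p > 0" and fin: "dyadic_sum b p \<theta> \<omega> < \<top>" and \<omega>: "continuous_on UNIV \<omega>"
    and T: "T \<ge> 0" "s \<in> {0..T}" "t \<in> {0..T}" and \<theta>: "\<theta> > 0"
  shows "norm (\<omega> s - \<omega> t) \<le> c_chain b * (1 + enn2real (dyadic_sum b p \<theta> \<omega>)) * exp (\<theta> * T) * \<bar>s - t\<bar> powr b"
proof -
  let ?level = "\<lambda>n k. \<Sum>j<2 ^ k. ennreal (dyadic_term b p n k j \<omega>)"
  define K where "K = enn2real (dyadic_sum b p \<theta> \<omega>)"
  \<comment> \<open>The interval \<open>{0..Suc n}\<close> contains \<open>{0..T}\<close>, while the
    weight \<open>exp (\<theta> * n)\<close> is still at most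
    \<open>exp (\<theta> * T)\<close>.\<close>
  define n where "n = nat \<lfloor>T\<rfloor>"
  have n: "real n \<le> T" "T \<le> real (Suc n)" 
  proof -
    have "real n = real_of_int \<lfloor>T\<rfloor>" using T by (simp add: n_def)
    then show "real n \<le> T" "T \<le> real (Suc n)" by linarith+
  qed
  have K0: "K \<ge> 0" by (simp add: K_def)
  have enn: "dyadic_sum b p \<theta> \<omega> = ennreal K" using fin by (simp add: K_def)
  have e1: "1 \<le> exp (\<theta> * real n)" using \<theta> by simp
  have term_bound: "dyadic_term b p n k j \<omega> \<le> exp (\<theta> * real n) * K" if j: "j < 2 ^ k" for k j
  proof -
    have nn: "dyadic_term b p n k j \<omega> \<ge> 0" by (simp add: dyadic_term_def)
    have "ennreal (dyadic_term b p n k j \<omega>) \<le> (?level n k)"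
      using j by (intro member_le_sum) auto
    also have "\<dots> \<le> (\<Sum>k. ?level n k)"
      using sum_le_suminf[of "\<lambda>k. ?level n k" "{k}"] by simp
    finally have "ennreal (exp (- \<theta> * real n)) * ennreal (dyadic_term b p n k j \<omega>)
      \<le> ennreal (exp (- \<theta> * real n)) * (\<Sum>k. ?level n k)"
      by (rule mult_left_mono) simp
    also have "\<dots> \<le> dyadic_sum b p \<theta> \<omega>"
      unfolding dyadic_sum_def
      using sum_le_suminf[of "\<lambda>n. ennreal (exp (- \<theta> * real n)) * (\<Sum>k. ?level n k)" "{n}"]
      by simp
    finally have "exp (- \<theta> * real n) * dyadic_term b p n k j \<omega> \<le> K"
      using nn K0 unfolding enn by (simp add: ennreal_mult[symmetric])
    then show ?thesis by (simp add: exp_minus field_simps)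
  qed
  have incr: "norm (\<omega> (real (Suc j) / 2 ^ k * real (Suc n)) - \<omega> (real j / 2 ^ k * real (Suc n)))
     \<le> ((1 + K) * exp (\<theta> * real n)) * (2 powr (- b)) ^ k" if j: "j < 2 ^ k" for k j
  proof -
    define x where "x = (2 powr b) ^ k * norm (\<omega> (real (Suc j) / 2 ^ k * real (Suc n)) - \<omega> (real j / 2 ^ k * real (Suc n)))"
    have "x \<le> (1 + K) * exp (\<theta> * real n)"
    \<comment> \<open>Instead of extracting a root, \<open>x\<close> is bounded by the larger of 1
      and \<open>x ^ p\<close>; this is the 1 in \<open>1 + K\<close>.\<close>
    proof (cases "x \<le> 1")
      case True
      have "1 * 1 \<le> (1 + K) * exp (\<theta> * real n)" using K0 e1 by (intro mult_mono) auto
      with True show ?thesis by simp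
    next
      case False
      then have "x \<le> x ^ p" using p by (intro self_le_power) auto
      also have "\<dots> \<le> exp (\<theta> * real n) * K" using term_bound[OF j] by (simp add: dyadic_term_def x_def)
      also have "\<dots> \<le> (1 + K) * exp (\<theta> * real n)" by (simp add: algebra_simps)
      finally show ?thesis .
    qed
    then have "(2 powr (- b)) ^ k * x \<le> (2 powr (- b)) ^ k * ((1 + K) * exp (\<theta> * real n))"
      by (rule mult_left_mono) simp
    moreover have "(2 powr (- b)) ^ k * (2 powr b) ^ k = (1::real)"
      by (simp add: power_mult_distrib[symmetric] powr_add[symmetric])
    ultimately show ?thesis by (simp add: x_def mult.assoc[symmetric]) (simp add: mult_ac)
  qed
  have "norm (\<omega> s - \<omega> t) \<le> ((1 + K) * exp (\<theta> * real n)) * c_chain b * \<bar>s - t\<bar> powr b"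
    using T n K0 by (intro dyadic_chaining[OF b _ _ _ incr]) (auto intro: continuous_on_subset[OF \<omega>])
  also have "\<dots> \<le> ((1 + K) * exp (\<theta> * T)) * c_chain b * \<bar>s - t\<bar> powr b"
    using n K0 \<theta> c_chain_ge_1[OF b] by (intro mult_right_mono mult_left_mono) auto
  finally show ?thesis by (simp add: K_def mult_ac)
qed

text \<open>The expectation is finite: level \<open>k\<close> has \<open>2 ^ k\<close> increments,
  and the moments of order \<open>2 * m\<close> beat this number exactly when
  \<open>2 * m * (H - b) > 1\<close>.\<close>

lemma dyadic_sum_finite_AE:
  assumes B: "ell2_fBm M H \<sigma> B" and m: "m > 0" "even m" and exps: "1 < real (2 * m) * (H - b)" "H < 1" "b > 0"
    and \<theta>: "\<theta> > 0"
  shows "AE \<omega> in distr M borel_C0 B. dyadic_sum b (2 * m) \<theta> \<omega> < \<top>"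
proof -
  let ?level = "\<lambda>n k w. \<Sum>j<2 ^ k. ennreal (dyadic_term b (2 * m) n k j (B w))"
  have BM [measurable]: "B \<in> M \<rightarrow>\<^sub>M borel_C0" and M: "prob_space M" using B by (auto simp: ell2_fBm_def)
  define c where "c = gaussian_moment m * norm \<sigma> ^ (2 * m)"
  define h where "h = 2 * H * real m"
  \<comment> \<open>The ratio of the expected contributions of consecutive levels: 2 for the number
    of increments, the next factor for the normalisation, the last one for the moments.\<close>
  define r where "r = 2 * ((2 powr b) ^ (2 * m) * 2 powr (- h))"
  have c: "c \<ge> 0" by (simp add: c_def gaussian_moment_def)
  have r: "0 < r" "r < 1"
  proof -
    have "r = 2 powr (1 + real (2 * m) * b - h)"
      by (simp add: r_def powr_add powr_diff powr_minus powr_power divide_inverse)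
    moreover have "1 + real (2 * m) * b - h < 0" using exps by (simp add: h_def algebra_simps)
    ultimately show "0 < r" "r < 1" using powr_less_mono[of "1 + real (2 * m) * b - h" 0 2] by auto
  qed
  \<comment> \<open>Half of \<open>\<theta>\<close> absorbs the polynomial growth of the moments in
    the interval length; the other half leaves a convergent geometric series in
    \<open>n\<close>.\<close>
  obtain P where P: "P > 0" "\<And>t. t \<ge> 0 \<Longrightarrow> (1 + t) ^ (2 * m) \<le> P * exp (\<theta> / 2 * t)"
    using power_le_exp[of "\<theta> / 2" "2 * m"] \<theta> by auto
  have term_bound: "(\<integral>\<^sup>+w. ennreal (dyadic_term b (2 * m) n k j (B w)) \<partial>M)
    \<le> ennreal (c * real (Suc n) ^ (2 * m) * (r / 2) ^ k)" for n k j
  proof -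
    let ?t = "real (Suc j) / 2 ^ k * real (Suc n)" and ?s = "real j / 2 ^ k * real (Suc n)"
    have ts: "\<bar>?t - ?s\<bar> = real (Suc n) / 2 ^ k"
      by (simp add: left_diff_distrib[symmetric] diff_divide_distrib[symmetric])
    have "(\<integral>\<^sup>+w. ennreal (dyadic_term b (2 * m) n k j (B w)) \<partial>M)
      = (\<integral>\<^sup>+w. ennreal (((2 powr b) ^ k) ^ (2 * m)) * ennreal (norm (B w ?t - B w ?s) ^ (2 * m)) \<partial>M)"
      by (intro nn_integral_cong) (simp add: dyadic_term_def power_mult_distrib ennreal_mult)
    also have "\<dots> = ennreal (((2 powr b) ^ k) ^ (2 * m)) * (\<integral>\<^sup>+w. ennreal (norm (B w ?t - B w ?s) ^ (2 * m)) \<partial>M)"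
    proof (rule nn_integral_cmult)
      have "(\<lambda>w. norm (B w ?t - B w ?s)) \<in> borel_measurable M"
        using measurable_compose[OF BM increment_measurable[of ?t ?s]] .
      then show "(\<lambda>w. ennreal (norm (B w ?t - B w ?s) ^ (2 * m))) \<in> borel_measurable M" by measurable
    qed
    also have "\<dots> \<le> ennreal (((2 powr b) ^ k) ^ (2 * m)) * ennreal (c * (real (Suc n) / 2 ^ k) powr h)"
      using ell2_fBm_increment_moment[OF B m, of ?t ?s] unfolding ts c_def h_def by (rule mult_left_mono) simp
    also have "\<dots> = ennreal (((2 powr b) ^ k) ^ (2 * m) * (c * (real (Suc n) / 2 ^ k) powr h))"
      using c by (simp add: ennreal_mult)
    also have "\<dots> \<le> ennreal (c * real (Suc n) ^ (2 * m) * (r / 2) ^ k)"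
    proof (rule ennreal_leI)
      have "(real (Suc n) / 2 ^ k) powr h = real (Suc n) powr h * (2 powr (- h)) ^ k"
      proof -
        have "(2 ^ k) powr h = (2 powr h :: real) ^ k"
          by (simp add: powr_realpow[symmetric] powr_powr powr_power mult.commute)
        moreover have "(real (Suc n) / 2 ^ k) powr h = real (Suc n) powr h / (2 ^ k) powr h"
          by (rule powr_divide)
        ultimately show ?thesis by (simp add: powr_minus power_inverse divide_inverse)
      qed
      \<comment> \<open>As \<open>H < 1\<close> and the base is at least 1, the real exponent may be
        raised to the natural number \<open>2 * m\<close>, the form in which \<open>P\<close>
        applies.\<close>
      moreover have "real (Suc n) powr h \<le> real (Suc n) ^ (2 * m)"
      proof -
        have "H * real m \<le> 1 * real m" using exps by (intro mult_right_mono) auto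
        then have "real (Suc n) powr h \<le> real (Suc n) powr real (2 * m)"
          by (intro powr_mono) (auto simp: h_def)
        then show ?thesis by (simp only: powr_realpow of_nat_0_less_iff zero_less_Suc)
      qed
      ultimately have "(real (Suc n) / 2 ^ k) powr h \<le> real (Suc n) ^ (2 * m) * (2 powr (- h)) ^ k"
        by (simp add: mult_right_mono)
      then have "((2 powr b) ^ k) ^ (2 * m) * (c * (real (Suc n) / 2 ^ k) powr h)
        \<le> ((2 powr b) ^ k) ^ (2 * m) * (c * (real (Suc n) ^ (2 * m) * (2 powr (- h)) ^ k))"
        using c by (intro mult_left_mono) auto
      also have "\<dots> = c * real (Suc n) ^ (2 * m) * (r / 2) ^ k"
        by (simp add: r_def power_mult_distrib power_mult[symmetric] mult_ac)
      finally show "((2 powr b) ^ k) ^ (2 * m) * (c * (real (Suc n) / 2 ^ k) powr h) \<le> c * real (Suc n) ^ (2 * m) * (r / 2) ^ k" .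
    qed
    finally show ?thesis .
  qed
  have tm [measurable]: "(\<lambda>w. dyadic_term b (2 * m) n k j (B w)) \<in> borel_measurable M" for n k j
    using measurable_compose[OF BM dyadic_term_measurable] .
  have level: "(\<integral>\<^sup>+w. (?level n k w) \<partial>M)
    \<le> ennreal (c * real (Suc n) ^ (2 * m) * r ^ k)" for n k
  proof -
    have "(\<integral>\<^sup>+w. (?level n k w) \<partial>M)
      = (\<Sum>j<2 ^ k. \<integral>\<^sup>+w. ennreal (dyadic_term b (2 * m) n k j (B w)) \<partial>M)"
      by (rule nn_integral_sum) measurable
    also have "\<dots> \<le> (\<Sum>j<(2::nat) ^ k. ennreal (c * real (Suc n) ^ (2 * m) * (r / 2) ^ k))"
      by (intro sum_mono term_bound)
    also have "\<dots> = ennreal (\<Sum>j<(2::nat) ^ k. c * real (Suc n) ^ (2 * m) * (r / 2) ^ k)"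
      using c r by (intro sum_ennreal) auto
    also have "(\<Sum>j<(2::nat) ^ k. c * real (Suc n) ^ (2 * m) * (r / 2) ^ k) = 2 ^ k * (c * real (Suc n) ^ (2 * m) * (r / 2) ^ k)"
      by simp
    also have "2 ^ k * (c * real (Suc n) ^ (2 * m) * (r / 2) ^ k) = c * real (Suc n) ^ (2 * m) * r ^ k"
      by (simp add: power_divide)
    finally show ?thesis .
  qed
  have inner: "(\<integral>\<^sup>+w. (\<Sum>k. ?level n k w) \<partial>M)
    \<le> ennreal (c * real (Suc n) ^ (2 * m) * (1 / (1 - r)))" for n
  proof -
    have "(\<integral>\<^sup>+w. (\<Sum>k. ?level n k w) \<partial>M)
      = (\<Sum>k. \<integral>\<^sup>+w. (?level n k w) \<partial>M)"
      by (rule nn_integral_suminf) measurable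
    also have "\<dots> \<le> (\<Sum>k. ennreal (c * real (Suc n) ^ (2 * m) * r ^ k))"
      by (intro suminf_le level) auto
    also have "\<dots> = ennreal (c * real (Suc n) ^ (2 * m) * (1 / (1 - r)))"
      using c r by (intro suminf_ennreal_eq sums_mult geometric_sums) auto
    finally show ?thesis .
  qed
  have "(\<integral>\<^sup>+w. dyadic_sum b (2 * m) \<theta> (B w) \<partial>M)
     = (\<Sum>n. \<integral>\<^sup>+w. ennreal (exp (- \<theta> * real n)) * (\<Sum>k. ?level n k w) \<partial>M)"
    unfolding dyadic_sum_def by (rule nn_integral_suminf) measurable
  also have "\<dots> = (\<Sum>n. ennreal (exp (- \<theta> * real n)) * (\<integral>\<^sup>+w. (\<Sum>k. ?level n k w) \<partial>M))"
    by (intro suminf_cong nn_integral_cmult) measurable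
  also have "\<dots> \<le> (\<Sum>n. ennreal ((c * P / (1 - r)) * exp (- \<theta> / 2) ^ n))"
  proof (intro suminf_le)
    fix n
    have "ennreal (exp (- \<theta> * real n)) * (\<integral>\<^sup>+w. (\<Sum>k. ?level n k w) \<partial>M)
      \<le> ennreal (exp (- \<theta> * real n)) * ennreal (c * real (Suc n) ^ (2 * m) * (1 / (1 - r)))"
      by (intro mult_left_mono inner) simp
    also have "\<dots> = ennreal (exp (- \<theta> * real n) * (c * real (Suc n) ^ (2 * m) * (1 / (1 - r))))"
      using c r by (intro ennreal_mult[symmetric]) auto
    also have "\<dots> \<le> ennreal ((c * P / (1 - r)) * exp (- \<theta> / 2) ^ n)"
    proof (rule ennreal_leI)
      have "real (Suc n) ^ (2 * m) \<le> P * exp (\<theta> / 2 * real n)" using P(2)[of "real n"] by simp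
      then have "exp (- \<theta> * real n) * (c * real (Suc n) ^ (2 * m) * (1 / (1 - r)))
        \<le> exp (- \<theta> * real n) * (c * (P * exp (\<theta> / 2 * real n)) * (1 / (1 - r)))"
        using c r by (intro mult_left_mono mult_right_mono) auto
      also have "\<dots> = (c * P / (1 - r)) * (exp (- \<theta> * real n) * exp (\<theta> / 2 * real n))" by simp
      also have "exp (- \<theta> * real n) * exp (\<theta> / 2 * real n) = exp (- \<theta> / 2) ^ n"
        by (simp add: exp_add[symmetric] exp_of_nat_mult[symmetric] algebra_simps)
      finally show "exp (- \<theta> * real n) * (c * real (Suc n) ^ (2 * m) * (1 / (1 - r))) \<le> (c * P / (1 - r)) * exp (- \<theta> / 2) ^ n" .
    qed
    finally show "ennreal (exp (- \<theta> * real n)) * (\<integral>\<^sup>+w. (\<Sum>k. ?level n k w) \<partial>M)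
      \<le> ennreal ((c * P / (1 - r)) * exp (- \<theta> / 2) ^ n)" .
  qed auto
  also have "\<dots> = ennreal ((c * P / (1 - r)) * (1 / (1 - exp (- \<theta> / 2))))"
    using c r P \<theta> by (intro suminf_ennreal_eq sums_mult geometric_sums) auto
  finally have "(\<integral>\<^sup>+w. dyadic_sum b (2 * m) \<theta> (B w) \<partial>M) \<noteq> \<infinity>" by (auto simp: top_unique)
  moreover have "(\<lambda>w. dyadic_sum b (2 * m) \<theta> (B w)) \<in> borel_measurable M"
    using measurable_compose[OF BM dyadic_sum_measurable] .
  ultimately have "AE w in M. dyadic_sum b (2 * m) \<theta> (B w) \<noteq> \<infinity>"
    by (intro nn_integral_PInf_AE) auto
  then have "AE w in M. dyadic_sum b (2 * m) \<theta> (B w) < \<top>"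
    by (simp add: less_top infinity_ennreal_def)
  then show ?thesis by (subst AE_distr_iff[OF BM]) (auto simp: less_top[symmetric])
qed

text \<open>The explicit formula turns measurability of the random ball into measurability of its
  radius.\<close>

lemma infdist_cball_0:
  fixes x :: "'b::real_normed_vector"
  assumes "r > 0"
  shows "infdist x (cball 0 r) = max 0 (norm x - r)"
proof (cases "norm x \<le> r")
  case True
  then show ?thesis by (simp add: infdist_zero)
next
  case False
  define y where "y = (r / norm x) *\<^sub>R x"
  have x: "norm x > r" "norm x > 0" using False assms by auto
  have "y \<in> cball 0 r" using x assms by (simp add: y_def)
  then have "infdist x (cball 0 r) \<le> dist x y" by (rule infdist_le)
  also have "dist x y = norm ((1 - r / norm x) *\<^sub>R x)" by (simp add: dist_norm y_def algebra_simps)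
  also have "\<dots> = norm x - r" using x by (simp add: field_simps)
  finally have "infdist x (cball 0 r) \<le> norm x - r" .
  moreover have "norm x - r \<le> infdist x (cball 0 r)"
  proof -
    have ne: "cball (0::'b) r \<noteq> {}" using assms by simp
    show ?thesis
      unfolding infdist_notempty[OF ne]
    proof (rule cINF_greatest[OF ne])
      fix y :: 'b assume "y \<in> cball 0 r"
      then show "norm x - r \<le> dist x y" using norm_triangle_sub[of x y] by (simp add: dist_norm)
    qed
  qed
  ultimately show ?thesis using x by simp
qed

section \<open>Exponential stability\<close>

text \<open>Derivatives within the closed interval are enough for the mean value bound, so that it
  also applies to \<open>f'\<close>, whose derivative is given only within
  \<open>{-\<delta>..\<delta>}\<close>.\<close>

lemma derivative_lipschitz:
  fixes k :: "real \<Rightarrow> real"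
  assumes "\<And>z. z \<in> {- R..R} \<Longrightarrow> (k has_real_derivative k' z) (at z within {- R..R})"
    and "\<And>z. z \<in> {- R..R} \<Longrightarrow> \<bar>k' z\<bar> \<le> c" and "\<bar>x\<bar> \<le> R" "\<bar>y\<bar> \<le> R"
  shows "\<bar>k x - k y\<bar> \<le> c * \<bar>x - y\<bar>"
  using field_differentiable_bound[of "{- R..R}" k k' c x y] assms by (auto simp: abs_le_iff)

theorem theorem4p3:
  fixes \<nu> lam \<beta> \<beta>' H \<delta> D\<^sub>f M\<^sub>f D\<^sub>h M\<^sub>h \<alpha> eps \<mu> :: real
    and \<sigma> :: ell2
    and f f' f'' h h' h'' :: "int \<Rightarrow> real \<Rightarrow> real"
    and M :: "'a measure" and B :: "'a \<Rightarrow> real \<Rightarrow> ell2"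
    and \<phi> :: "real \<Rightarrow> (real \<Rightarrow> ell2) \<Rightarrow> ell2 \<Rightarrow> ell2"
  assumes "\<nu> > 0" and "lam > 0"
    and "1 / 2 < \<beta>" and "\<beta> < \<beta>'" and "\<beta>' < H" and "H < 1" and "\<delta> > 0"
    and "\<And>i z. (f i has_real_derivative f' i z) (at z)"
    and "\<And>i. continuous_on UNIV (f' i)"
    and "D\<^sub>f \<ge> 0" and "\<And>i z. \<bar>f' i z\<bar> \<le> D\<^sub>f"
    and "\<And>i. f i 0 = 0" and "\<And>i. f' i 0 = 0"
    and "\<And>i z. z \<in> {-\<delta>..\<delta>} \<Longrightarrow>
           (f' i has_real_derivative f'' i z) (at z within {-\<delta>..\<delta>})"
    and "\<And>i. continuous_on {-\<delta>..\<delta>} (f'' i)"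
    and "M\<^sub>f > 0" and "\<And>i z. z \<in> {-\<delta>..\<delta>} \<Longrightarrow> \<bar>f'' i z\<bar> \<le> M\<^sub>f"
    and "\<And>i z. (h i has_real_derivative h' i z) (at z)"
    and "\<And>i z. (h' i has_real_derivative h'' i z) (at z)"
    and "\<And>i. continuous_on UNIV (h'' i)"
    and "D\<^sub>h \<ge> 0" and "\<And>i z. \<bar>h' i z\<bar> \<le> D\<^sub>h"
    and "M\<^sub>h \<ge> 0" and "\<And>i z. \<bar>h'' i z\<bar> \<le> M\<^sub>h"
    and "\<And>i. h i 0 = 0" and "\<And>i. h' i 0 = 0"
    and "ell2_fBm M H \<sigma> B"
    and "1 - \<beta>' < \<alpha>" and "\<alpha> < \<beta>"
    and "\<And>\<omega> x. \<omega> \<in> C0_Hoelder \<beta>' \<Longrightarrow>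
           mild_solution \<alpha> \<beta> \<nu> lam f h \<omega> x (\<lambda>t. \<phi> t \<omega> x)"
    and "\<And>\<omega> x v. \<omega> \<in> C0_Hoelder \<beta>' \<Longrightarrow> mild_solution \<alpha> \<beta> \<nu> lam f h \<omega> x v \<Longrightarrow>
           (\<forall>t\<ge>0. v t = \<phi> t \<omega> x)"
    and "0 < eps" and "eps < 1 - exp (- lam)"
    and "0 < \<mu>" and "\<mu> < lam - ln (1 + eps * exp lam)"
  shows "exponentially_stable
           (restrict_space (distr M borel_C0 B) (C0_Hoelder \<beta>')) \<phi> \<mu>"
proof -
  \<comment> \<open>The sum dominates both constants and is positive even if
    \<open>M\<^sub>h\<close> is 0.\<close>
  let ?M = "M\<^sub>f + M\<^sub>h"
  note [simp] = assms(12,13,25,26)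
  have deriv_f: "(f i has_real_derivative f' i z) (at z within S)" for i z S
    using assms(8) by (rule DERIV_subset) simp
  have deriv_h: "(h i has_real_derivative h' i z) (at z within S)" "(h' i has_real_derivative h'' i z) (at z within S)" for i z S
    using assms(18,19)[THEN DERIV_subset] by simp_all
  \<comment> \<open>The subtracted logarithm is positive because its argument exceeds 1.\<close>
  have rate: "\<mu> < lam"
  proof -
    have "0 < ln (1 + eps * exp lam)" using assms(32) by (intro ln_gt_zero) simp
    then show ?thesis using assms(35) by simp
  qed
  interpret lattice_stability \<alpha> \<beta> \<beta>' \<nu> lam \<mu> \<delta> "D\<^sub>f" ?M f h
  proof
    show "0 < \<alpha>" "\<alpha> < \<beta>" "\<beta> \<le> 1" "\<alpha> < 1" "1 - \<beta>' < \<alpha>" "0 < \<beta>'" using assms(3-6,28,29) by auto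
    show "\<nu> > 0" "lam > 0" "0 < \<mu>" "\<mu> < lam" "\<beta> < \<beta>'" "\<beta>' \<le> 1" "\<delta> > 0" "D\<^sub>f \<ge> 0" "?M > 0"
      using assms(1-7,10,16,23,34) rate by auto
    show "f i 0 = 0" "h i 0 = 0" for i by auto
    show "\<bar>f i x - f i y\<bar> \<le> D\<^sub>f * \<bar>x - y\<bar>" for i x y
      by (rule derivative_lipschitz[where R = "max \<bar>x\<bar> \<bar>y\<bar>", OF deriv_f assms(11)]) auto
    show "\<bar>f i x\<bar> \<le> ?M * R * \<bar>x\<bar>" if x: "\<bar>x\<bar> \<le> R" and R: "R \<le> \<delta>" for i x R
    proof -
      have R0: "R \<ge> 0" using x by simp
      \<comment> \<open>Two mean value steps: since \<open>f' i 0 = 0\<close>, the second derivative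
        bounds \<open>f' i\<close> by \<open>M\<^sub>f * R\<close> on \<open>{- R..R}\<close>, and
        this bound is the Lipschitz constant of \<open>f i\<close> there. The argument for
        \<open>h\<close> is the same.\<close>
      have "\<bar>f' i z\<bar> \<le> M\<^sub>f * R" if z: "z \<in> {- R..R}" for z
      proof -
        have "\<bar>f' i z - f' i 0\<bar> \<le> M\<^sub>f * \<bar>z - 0\<bar>"
          by (rule derivative_lipschitz[OF assms(14,17)]) (use z R R0 in auto)
        also have "\<dots> \<le> M\<^sub>f * R" using z assms(16) by (intro mult_left_mono) auto
        finally show ?thesis by simp
      qed
      then have "\<bar>f i x - f i 0\<bar> \<le> M\<^sub>f * R * \<bar>x - 0\<bar>"
        by (intro derivative_lipschitz[where R = R, OF deriv_f]) (use x R0 in auto)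
      also have "\<dots> \<le> ?M * R * \<bar>x - 0\<bar>" using R0 assms(23) by (intro mult_right_mono) auto
      finally show ?thesis by simp
    qed
    show "\<bar>h i x - h i y\<bar> \<le> ?M * R * \<bar>x - y\<bar>" if x: "\<bar>x\<bar> \<le> R" and y: "\<bar>y\<bar> \<le> R" for i x y R
    proof -
      have R0: "R \<ge> 0" using x by simp
      have "\<bar>h' i z\<bar> \<le> M\<^sub>h * R" if z: "z \<in> {- R..R}" for z
      proof -
        have "\<bar>h' i z - h' i 0\<bar> \<le> M\<^sub>h * \<bar>z - 0\<bar>"
          by (rule derivative_lipschitz[where R = R, OF deriv_h(2) assms(24)]) (use z R0 in auto)
        also have "\<dots> \<le> M\<^sub>h * R" using z assms(23) by (intro mult_left_mono) auto
        finally show ?thesis by simp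
      qed
      then have "\<bar>h i x - h i y\<bar> \<le> M\<^sub>h * R * \<bar>x - y\<bar>"
        by (intro derivative_lipschitz[where R = R, OF deriv_h(1)]) (use x y in auto)
      also have "\<dots> \<le> ?M * R * \<bar>x - y\<bar>" using R0 assms(16) by (intro mult_right_mono) auto
      finally show ?thesis .
    qed
  qed
  let ?\<Omega> = "C0_Hoelder \<beta>'" and ?D = "distr M borel_C0 B"
  let ?P = "restrict_space ?D ?\<Omega>"
  \<comment> \<open>The strict gap between \<open>H\<close> and \<open>\<beta>'\<close> lets high
    moments win in the chaining; doubling \<open>n\<close> makes \<open>m\<close> even, as the
    moment estimate requires.\<close>
  obtain n where n: "1 < real n * (H - \<beta>')" using reals_Archimedean3[of "H - \<beta>'"] assms(5) by auto
  define m where "m = 2 * n"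
  have m: "m > 0" "even m" "1 < real (2 * m) * (H - \<beta>')"
  proof -
    have "n \<noteq> 0" using n by (intro notI) simp
    then show "m > 0" "even m" by (auto simp: m_def)
    have "real n * (H - \<beta>') \<le> real (2 * m) * (H - \<beta>')"
      using assms(5) by (intro mult_right_mono) (auto simp: m_def)
    with n show "1 < real (2 * m) * (H - \<beta>')" by simp
  qed
  show ?thesis
  proof (rule deterministic_stability)
    fix C :: real
    assume C: "C \<ge> 1" and stable: "\<And>\<kappa> w x u t. \<kappa> \<ge> 1 \<Longrightarrow> tempered \<kappa> w \<Longrightarrow> solution w x u \<Longrightarrow>
      norm x \<le> 1 / (C * \<kappa>) \<Longrightarrow> t \<ge> 0 \<Longrightarrow> norm (u t) \<le> exp (- \<mu> * t)"
    \<comment> \<open>The growth constant provided by \<open>dyadic_sum_tempered\<close>. On the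
      null set where the sum is infinite \<open>enn2real\<close> returns 0, so
      \<open>\<kappa>\<close> is at least 1 and the radius below positive for every path.\<close>
    define \<kappa> where "\<kappa> \<omega> = c_chain \<beta>' * (1 + enn2real (dyadic_sum \<beta>' (2 * m) \<theta> \<omega>))" for \<omega>
    define U where "U \<omega> = cball (0::ell2) (1 / (C * \<kappa> \<omega>))" for \<omega>
    have kappa: "\<kappa> \<omega> \<ge> 1" for \<omega>
      using mult_mono[OF c_chain_ge_1[OF exponents(6)], of 1 "1 + enn2real (dyadic_sum \<beta>' (2 * m) \<theta> \<omega>)"]
        c_chain_ge_1[OF exponents(6)] by (simp add: \<kappa>_def)
    have radius: "1 / (C * \<kappa> \<omega>) > 0" for \<omega> using C kappa[of \<omega>] by simp
    have nbhd: "random_neighborhood ?P U 0"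
      unfolding random_neighborhood_def
    proof (intro conjI ballI allI)
      show "0 \<in> interior (U \<omega>)" for \<omega>
        by (rule interiorI[of "ball 0 (1 / (C * \<kappa> \<omega>))"]) (use radius in \<open>auto simp: U_def\<close>)
      show "(\<lambda>\<omega>. infdist x (U \<omega>)) \<in> borel_measurable ?P" for x
      proof -
        have "(\<lambda>\<omega>. infdist x (U \<omega>)) = (\<lambda>\<omega>. max 0 (norm x - 1 / (C * \<kappa> \<omega>)))"
          by (simp add: U_def infdist_cball_0[OF radius])
        moreover have "(\<lambda>\<omega>. max 0 (norm x - 1 / (C * \<kappa> \<omega>))) \<in> borel_measurable ?D"
          unfolding \<kappa>_def by measurable
        ultimately show ?thesis by (simp add: measurable_restrict_space1)
      qed
    qed
    have "AE \<omega> in ?D. \<omega> \<in> ?\<Omega> \<longrightarrow> (\<forall>t\<ge>0. (SUP x\<in>U \<omega>. ereal (norm (\<phi> t \<omega> x))) \<le> ereal (1 * exp (- \<mu> * t)))"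
      using dyadic_sum_finite_AE[OF assms(27) m assms(6) exponents(6) rates(5)]
    proof (eventually_elim, intro impI allI SUP_least)
      fix \<omega> t x
      assume fin: "dyadic_sum \<beta>' (2 * m) \<theta> \<omega> < \<top>" and w: "\<omega> \<in> ?\<Omega>" and t: "t \<ge> (0::real)" and x: "x \<in> U \<omega>"
      have cont: "continuous_on UNIV \<omega>" using w by (simp add: C0_Hoelder_def C0_def)
      have "tempered (\<kappa> \<omega>) \<omega>"
        unfolding tempered_def \<kappa>_def using m(1) cont
        by (intro conjI allI impI ballI dyadic_sum_tempered[OF exponents(6) _ fin cont _ _ _ rates(5)]) auto
      from stable[OF kappa this assms(30)[OF w], of x t] x t
      show "ereal (norm (\<phi> t \<omega> x)) \<le> ereal (1 * exp (- \<mu> * t))" by (simp add: U_def)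
    qed
    \<comment> \<open>Measurability of the Hoelder paths lets the conditional statement pass to the
      restricted measure.\<close>
    then have "AE \<omega> in ?P. \<forall>t\<ge>0. (SUP x\<in>U \<omega>. ereal (norm (\<phi> t \<omega> x))) \<le> ereal (1 * exp (- \<mu> * t))"
      using C0_Hoelder_measurable[OF exponents(6)]
      by (subst AE_restrict_space_iff) (auto simp: sets.Int_space_eq2)
    \<comment> \<open>The prefactor is the constant 1; all dependence on the path sits in the radius
      of \<open>U\<close>.\<close>
    with nbhd assms(34) show ?thesis
      unfolding exponentially_stable_def by (intro conjI exI[of _ "\<lambda>_. 1"] exI[of _ U]) auto
  qed
qed

end
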